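(* Let $p\ge 3$ be a prime, let $k$ be a field of characteristic $p$, and let $\lambda=(a,b)\vdash n$ be a two part partition (so $a\ge b>0$ and $a+b=n$). Then $$\dim_k H^1(\mathcal{S}_n,S^\lambda)=\begin{cases}1 & \text{if } \lambda \text{ is James or pointed},\\ 0 & \text{otherwise.}\end{cases}$$
   Context: $\mathcal{S}_n$ is the symmetric group on $\{1,\dots,n\}$, $S^\lambda$ is the Specht module over $k$ indexed by $\lambda$, in James' convention: the submodule, spanned by the polytabloids, of the permutation module $M^\lambda$ on $\lambda$-tabloids. $H^1(\mathcal{S}_n,S^\lambda)=\mathrm{Ext}^1_{k\mathcal{S}_n}(k,S^\lambda)$ with $k$ the trivial module. For a positive integer $x$ with base $p$ expansion $x=\sum_{i=0}^{\alpha}x_ip^i$, $0\le x_i\le p-1$, $x_\alpha\neq 0$, put $l_p(x)=\alpha$ (the $p$-adic length) and let $\mathrm{val}_p(x)$ be the least $i$ with $x_i\ne 0$ (the $p$-adic valuation). A two part partition $(a,b)$, $a\ge b>0$, is called James if $\mathrm{val}_p(a+1)>l_p(b)$. It is called pointed if $b=p^\beta+\hat b$ for some integers $\beta,\hat b\ge 0$ with $\hat b<p^{\mathrm{val}_p(a+1)}<p^\beta$. *)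

theory Defs
  imports
    "Jordan_Normal_Form.VS_Connect"
    "HOL-Algebra.AbelCoset"
    "HOL-Algebra.Sym_Groups"
    "HOL-Computational_Algebra.Primes"
begin

hide_const (open) Multiset.mult Polynomial.smult

text \<open>
  The ground field is a type \<open>'k :: field\<close>, turned into a ring record by \<^term>\<open>class_ring\<close>. A left
  \<open>kG\<close>-module is a vector space over it together with a linear action of the group \<open>G\<close>.
\<close>

record ('k, 'v, 'g) kG_module = "('k, 'v) module" +
  act :: "'g \<Rightarrow> 'v \<Rightarrow> 'v"

locale kG_module = V: vectorspace class_ring M + G: group G
  for G :: "('g, 'm) monoid_scheme" (structure)
    and M :: "('k::field, 'v, 'g, 'e) kG_module_scheme" +
  assumes act_closed: "\<lbrakk>g \<in> carrier G; v \<in> carrier M\<rbrakk> \<Longrightarrow> act M g v \<in> carrier M"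
    and act_add: "\<lbrakk>g \<in> carrier G; v \<in> carrier M; w \<in> carrier M\<rbrakk>
      \<Longrightarrow> act M g (v \<oplus>\<^bsub>M\<^esub> w) = act M g v \<oplus>\<^bsub>M\<^esub> act M g w"
    and act_smult: "\<lbrakk>g \<in> carrier G; v \<in> carrier M\<rbrakk>
      \<Longrightarrow> act M g (c \<odot>\<^bsub>M\<^esub> v) = c \<odot>\<^bsub>M\<^esub> act M g v"
    and act_one: "v \<in> carrier M \<Longrightarrow> act M \<one> v = v"
    and act_mult: "\<lbrakk>g \<in> carrier G; h \<in> carrier G; v \<in> carrier M\<rbrakk>
      \<Longrightarrow> act M (g \<otimes> h) v = act M g (act M h v)"

text \<open>
  \<^term>\<open>vectorspace.dim\<close> is unspecified for spaces that are not finite-dimensional, so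
  finite-dimensionality is stated along with the dimension.
\<close>

definition has_dim :: "('k::field, 'v, 'e) module_scheme \<Rightarrow> nat \<Rightarrow> bool"
  where "has_dim V d \<longleftrightarrow>
    vectorspace class_ring V \<and> vectorspace.fin_dim class_ring V \<and> vectorspace.dim class_ring V = d"

text \<open>
  The permutation module of a finite \<open>G\<close>-set \<open>X\<close>: a function \<open>f\<close> on \<open>X\<close> stands for the formal
  linear combination of the \<open>x \<in> X\<close> with coefficients \<open>f x\<close>, and \<open>g\<close> sends the basis element \<open>x\<close>
  to \<open>\<phi> g x\<close>; hence the inverse in the formula for coefficients.
\<close>

definition perm_rep ::
    "('g, 'm) monoid_scheme \<Rightarrow> 'x set \<Rightarrow> ('g \<Rightarrow> 'x \<Rightarrow> 'x) \<Rightarrow> ('k::field, 'x \<Rightarrow> 'k, 'g) kG_module"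
  where "perm_rep G X \<phi> =
    module.extend (ring.func_space class_ring X)
      (kG_module.fields (\<lambda>g f. restrict (\<lambda>x. f (\<phi> (inv\<^bsub>G\<^esub> g) x)) X))"


section \<open>Group cohomology\<close>

definition kG_hom ::
    "('g, 'm) monoid_scheme \<Rightarrow> ('k::field, 'v, 'g, 'e) kG_module_scheme
      \<Rightarrow> ('k, 'w, 'g, 'f) kG_module_scheme \<Rightarrow> ('v \<Rightarrow> 'w) set"
  where "kG_hom G M N =
    {f \<in> LinearCombinations.module_hom class_ring M N \<inter> extensional (carrier M).
      \<forall>g\<in>carrier G. \<forall>v\<in>carrier M. f (act M g v) = act N g (f v)}"

definition hom_space ::
    "('g, 'm) monoid_scheme \<Rightarrow> ('k::field, 'v, 'g, 'e) kG_module_scheme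
      \<Rightarrow> ('k, 'w, 'g, 'f) kG_module_scheme \<Rightarrow> ('k, 'v \<Rightarrow> 'w) module"
  where "hom_space G M N =
    \<lparr>carrier = kG_hom G M N,
     mult = undefined,
     one = undefined,
     zero = (\<lambda>v\<in>carrier M. \<zero>\<^bsub>N\<^esub>),
     add = (\<lambda>f h. \<lambda>v\<in>carrier M. f v \<oplus>\<^bsub>N\<^esub> h v),
     smult = (\<lambda>c f. \<lambda>v\<in>carrier M. c \<odot>\<^bsub>N\<^esub> f v)\<rparr>"

definition quotient_module :: "('k, 'v, 'e) module_scheme \<Rightarrow> 'v set \<Rightarrow> ('k, 'v set) module"
  where "quotient_module V W =
    \<lparr>carrier = a_rcosets\<^bsub>V\<^esub> W,
     mult = undefined,
     one = undefined,
     zero = W,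
     add = set_add V,
     smult = (\<lambda>c C. \<Union>v\<in>C. W +>\<^bsub>V\<^esub> (c \<odot>\<^bsub>V\<^esub> v))\<rparr>"

text \<open>
  The bar resolution \<open>\<dots> \<rightarrow> P\<^sub>1 \<rightarrow> P\<^sub>0 \<rightarrow> k\<close> of the trivial module of a finite group \<open>G\<close> by free
  \<open>kG\<close>-modules, in homogeneous form: \<open>P\<^sub>m\<close> has the \<open>k\<close>-basis \<open>G\<^bsup>m+1\<^esup>\<close> with diagonal left
  multiplication, and the boundary sends \<open>(g\<^sub>0, \<dots>, g\<^sub>m)\<close> to the alternating sum over \<open>i\<close> of the
  tuples with \<open>g\<^sub>i\<close> omitted.
\<close>

definition bar_basis :: "('g, 'm) monoid_scheme \<Rightarrow> nat \<Rightarrow> 'g list set"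
  where "bar_basis G m = {gs. length gs = Suc m \<and> set gs \<subseteq> carrier G}"

definition bar_module ::
    "('g, 'm) monoid_scheme \<Rightarrow> nat \<Rightarrow> ('k::field, 'g list \<Rightarrow> 'k, 'g) kG_module"
  where "bar_module G m = perm_rep G (bar_basis G m) (\<lambda>g. map (\<lambda>h. g \<otimes>\<^bsub>G\<^esub> h))"

definition omit_nth :: "nat \<Rightarrow> 'a list \<Rightarrow> 'a list"
  where "omit_nth i xs = take i xs @ drop (Suc i) xs"

text \<open>The boundary \<open>P\<^bsub>m+1\<^esub> \<rightarrow> P\<^sub>m\<close>, in coefficients.\<close>

definition bar_boundary ::
    "('g, 'm) monoid_scheme \<Rightarrow> nat \<Rightarrow> ('g list \<Rightarrow> 'k::field) \<Rightarrow> ('g list \<Rightarrow> 'k)"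
  where "bar_boundary G m f =
    (\<lambda>ys\<in>bar_basis G m. \<Sum>xs\<in>bar_basis G (Suc m). \<Sum>i\<le>Suc m.
      if omit_nth i xs = ys then (-1) ^ i * f xs else 0)"

definition cochains ::
    "('g, 'm) monoid_scheme \<Rightarrow> ('k::field, 'v, 'g, 'e) kG_module_scheme \<Rightarrow> nat
      \<Rightarrow> ('k, ('g list \<Rightarrow> 'k) \<Rightarrow> 'v) module"
  where "cochains G M m = hom_space G (bar_module G m :: ('k, 'g list \<Rightarrow> 'k, 'g) kG_module) M"

definition coboundary ::
    "('g, 'm) monoid_scheme \<Rightarrow> nat
      \<Rightarrow> (('g list \<Rightarrow> 'k::field) \<Rightarrow> 'v) \<Rightarrow> (('g list \<Rightarrow> 'k) \<Rightarrow> 'v)"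
  where "coboundary G m \<phi> =
    (\<lambda>f\<in>carrier (bar_module G (Suc m) :: ('k, 'g list \<Rightarrow> 'k, 'g) kG_module).
      \<phi> (bar_boundary G m f))"

definition cocycles ::
    "('g, 'm) monoid_scheme \<Rightarrow> ('k::field, 'v, 'g, 'e) kG_module_scheme \<Rightarrow> nat
      \<Rightarrow> (('g list \<Rightarrow> 'k) \<Rightarrow> 'v) set"
  where "cocycles G M m =
    {\<phi> \<in> carrier (cochains G M m). coboundary G m \<phi> = \<zero>\<^bsub>cochains G M (Suc m)\<^esub>}"

definition coboundaries ::
    "('g, 'm) monoid_scheme \<Rightarrow> ('k::field, 'v, 'g, 'e) kG_module_scheme \<Rightarrow> nat
      \<Rightarrow> (('g list \<Rightarrow> 'k) \<Rightarrow> 'v) set"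
  where "coboundaries G M m =
    (case m of
      0 \<Rightarrow> {\<zero>\<^bsub>cochains G M 0\<^esub>}
    | Suc j \<Rightarrow> coboundary G j ` carrier (cochains G M j))"

text \<open>
  \<open>H\<^sup>m(G, M)\<close> is the cohomology of \<open>Hom\<^bsub>kG\<^esub>(P, M)\<close> in degree \<open>m\<close>, that is,
  \<open>Ext\<^bsub>kG\<^esub>\<^sup>m(k, M)\<close> computed from the projective resolution \<open>P\<close> of \<open>k\<close>.
\<close>

definition group_cohomology ::
    "('g, 'm) monoid_scheme \<Rightarrow> ('k::field, 'v, 'g, 'e) kG_module_scheme \<Rightarrow> nat
      \<Rightarrow> ('k, (('g list \<Rightarrow> 'k) \<Rightarrow> 'v) set) module"
  where "group_cohomology G M m =
    quotient_module (cochains G M m\<lparr>carrier := cocycles G M m\<rparr>) (coboundaries G M m)"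


section \<open>Specht modules\<close>

text \<open>
  Rows and columns of a diagram are numbered from \<open>0\<close>. A \<open>\<mu>\<close>-tableau is a bijection from the
  diagram onto \<open>{1..n}\<close>, made a total function by the value \<open>0\<close> outside the diagram. Permutations
  of \<open>{1..n}\<close> fix \<open>0\<close>, so they act on tableaux by composition.
\<close>

type_synonym tableau = "nat \<times> nat \<Rightarrow> nat"

definition diagram :: "nat list \<Rightarrow> (nat \<times> nat) set"
  where "diagram \<mu> = {(i, j). i < length \<mu> \<and> j < \<mu> ! i}"

definition tableaux :: "nat list \<Rightarrow> tableau set"
  where "tableaux \<mu> =
    {t. bij_betw t (diagram \<mu>) {1..sum_list \<mu>} \<and> (\<forall>x. x \<notin> diagram \<mu> \<longrightarrow> t x = 0)}"

definition row_stabilizer :: "nat list \<Rightarrow> tableau \<Rightarrow> (nat \<Rightarrow> nat) set"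
  where "row_stabilizer \<mu> t =
    {\<pi>. \<pi> permutes {1..sum_list \<mu>} \<and>
      (\<forall>i. \<pi> ` t ` {x \<in> diagram \<mu>. fst x = i} = t ` {x \<in> diagram \<mu>. fst x = i})}"

definition column_stabilizer :: "nat list \<Rightarrow> tableau \<Rightarrow> (nat \<Rightarrow> nat) set"
  where "column_stabilizer \<mu> t =
    {\<pi>. \<pi> permutes {1..sum_list \<mu>} \<and>
      (\<forall>j. \<pi> ` t ` {x \<in> diagram \<mu>. snd x = j} = t ` {x \<in> diagram \<mu>. snd x = j})}"

definition tabloid :: "nat list \<Rightarrow> tableau \<Rightarrow> tableau set"
  where "tabloid \<mu> t = (\<lambda>\<pi>. \<pi> \<circ> t) ` row_stabilizer \<mu> t"

definition tabloids :: "nat list \<Rightarrow> tableau set set"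
  where "tabloids \<mu> = tabloid \<mu> ` tableaux \<mu>"

definition tabloid_module :: "nat list \<Rightarrow> ('k::field, tableau set \<Rightarrow> 'k, nat \<Rightarrow> nat) kG_module"
  where "tabloid_module \<mu> =
    perm_rep (sym_group (sum_list \<mu>)) (tabloids \<mu>) (\<lambda>\<pi> T. (\<lambda>t. \<pi> \<circ> t) ` T)"

definition polytabloid :: "nat list \<Rightarrow> tableau \<Rightarrow> (tableau set \<Rightarrow> 'k::field)"
  where "polytabloid \<mu> t =
    (\<lambda>T\<in>tabloids \<mu>. \<Sum>\<pi>\<in>column_stabilizer \<mu> t.
      if tabloid \<mu> (\<pi> \<circ> t) = T then of_int (sign \<pi>) else 0)"

definition specht_module :: "nat list \<Rightarrow> ('k::field, tableau set \<Rightarrow> 'k, nat \<Rightarrow> nat) kG_module"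
  where "specht_module \<mu> =
    (tabloid_module \<mu>)
      \<lparr>carrier := LinearCombinations.module.span class_ring (tabloid_module \<mu>)
        (polytabloid \<mu> ` tableaux \<mu>)\<rparr>"


section \<open>James and pointed partitions\<close>

definition p_digit :: "nat \<Rightarrow> nat \<Rightarrow> nat \<Rightarrow> nat"
  where "p_digit p x i = x div p ^ i mod p"

definition p_length :: "nat \<Rightarrow> nat \<Rightarrow> nat"
  where "p_length p x = (GREATEST i. p_digit p x i \<noteq> 0)"

definition p_val :: "nat \<Rightarrow> nat \<Rightarrow> nat"
  where "p_val p x = (LEAST i. p_digit p x i \<noteq> 0)"

definition James_partition :: "nat \<Rightarrow> nat \<Rightarrow> nat \<Rightarrow> bool"
  where "James_partition p a b \<longleftrightarrow> p_val p (a + 1) > p_length p b"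

definition pointed_partition :: "nat \<Rightarrow> nat \<Rightarrow> nat \<Rightarrow> bool"
  where "pointed_partition p a b \<longleftrightarrow>
    (\<exists>\<beta> b'. b = p ^ \<beta> + b' \<and> b' < p ^ p_val p (a + 1) \<and> p ^ p_val p (a + 1) < p ^ \<beta>)"

end

theory Submission
  imports Defs
begin

text \<open>
  Write \<open>n = a + b\<close>, \<open>G = S\<^sub>n\<close>, and let \<open>M\<close> be the permutation module on the tabloids of shape \<open>(a, b)\<close>.
  A tabloid is determined by its second row, so \<open>M\<close> consists of the functions on the \<open>b\<close>-subsets of
  \<open>{1..n}\<close>, and the Specht module \<open>S\<close> is a submodule of it.

  The first cohomology of \<open>M\<close> vanishes. By Shapiro's argument it is the space of additive characters
  of the stabilizer \<open>S\<^sub>a \<times> S\<^sub>b\<close> of a tabloid, and this group is generated by transpositions, on which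
  a character takes a value \<open>x\<close> with \<open>2 x = 0\<close>. Hence every cocycle with values in \<open>S\<close> has the form
  \<open>g \<mapsto> g v - v\<close> for some \<open>v \<in> M\<close> whose class in \<open>M / S\<close> is fixed by \<open>G\<close>, and the first cohomology
  of \<open>S\<close> is the space of these \<open>v\<close> modulo \<open>S\<close> and the constant functions (\<open>has_dim_H1_0\<close>,
  \<open>has_dim_H1_1\<close>).

  For a function \<open>v\<close> on \<open>b\<close>-subsets and a set \<open>I\<close> with fewer than \<open>b\<close> elements let \<open>\<rho> I\<close> be the sum of
  \<open>v\<close> over the \<open>b\<close>-subsets that contain \<open>I\<close>. James' kernel intersection theorem says that \<open>v \<in> S\<close> if
  and only if \<open>\<rho> = 0\<close> (\<open>specht_module_two_rows\<close>). So the class of \<open>v\<close> is fixed by \<open>G\<close> if and only if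
  \<open>\<rho> I = c (card I)\<close> for some sequence \<open>c\<close>: then \<open>v\<close> is a block design with multiplicities in the
  field. Counting twice gives \<open>((n - i) choose t) c (i + t) = ((b - i) choose t) c i\<close> for
  \<open>i + t < b\<close>. Conversely every family \<open>\<rho>\<close> with the analogous consistency property comes from a
  function \<open>v\<close> (\<open>consistent_extends\<close>). This is the exactness of the first steps of a resolution of \<open>S\<close>
  by permutation modules; the proof is an induction on \<open>n\<close> that splits the subsets according to
  whether they contain a chosen point.

  It remains to solve this linear system in \<open>c\<close>, with the solution \<open>c i = ((n - i) choose (b - i))\<close> of
  the constant function counted as trivial. In terms of \<open>d j = c (b - j)\<close>, Lucas' theorem shows that a
  solution is determined by its values at the powers of \<open>p\<close>, and that most of these values vanish
  after a multiple of the trivial solution is subtracted. If \<open>(a, b)\<close> is James, the trivial solution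
  is zero and there is one solution supported on the multiples of the largest power of \<open>p\<close> that
  is at most \<open>b\<close>. If \<open>(a, b)\<close> is pointed, with \<open>b = p ^ \<beta> + b'\<close>, the solutions are spanned by the trivial one and
  the indicator of \<open>p ^ \<beta>\<close>. In all other cases only multiples of the trivial one are left
  (\<open>weight_solutions\<close>).
\<close>

section \<open>Quotients of vector spaces of dimension at most one\<close>

lemma has_dim_0:
  assumes "vectorspace class_ring V" "carrier V = {\<zero>\<^bsub>V\<^esub>}"
  shows "has_dim V 0"
proof -
  interpret vectorspace class_ring V by fact
  have "span {} = carrier V" using assms(2) by (auto simp: span_def lincomb_def)
  hence "basis {}" by (auto simp: basis_def lin_dep_def)
  thus ?thesis using dim_basis[of "{}"] assms(1) unfolding has_dim_def fin_dim_def basis_def by auto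
qed

lemma has_dim_1:
  assumes "vectorspace class_ring V" "e \<in> carrier V" "e \<noteq> \<zero>\<^bsub>V\<^esub>"
    and "\<And>v. v \<in> carrier V \<Longrightarrow> \<exists>c. v = c \<odot>\<^bsub>V\<^esub> e"
  shows "has_dim V 1"
proof -
  interpret vectorspace class_ring V by fact
  have lc: "lincomb a {e} = a e \<odot>\<^bsub>V\<^esub> e" for a
    using assms(2) by (simp add: lincomb_def)
  have "span {e} = carrier V"
  proof
    show "span {e} \<subseteq> carrier V" using assms(2) by (intro span_is_subset2) auto
    show "carrier V \<subseteq> span {e}"
    proof
      fix v assume "v \<in> carrier V"
      then obtain c where "v = c \<odot>\<^bsub>V\<^esub> e" using assms(4) by blast
      hence "v = lincomb (\<lambda>_. c) {e}" by (simp add: lc)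
      thus "v \<in> span {e}" unfolding span_def by auto
    qed
  qed
  moreover have "lin_indpt {e}"
  proof
    assume "lin_dep {e}"
    then obtain A a v where *: "A \<subseteq> {e}" "lincomb a A = \<zero>\<^bsub>V\<^esub>" "v \<in> A" "a v \<noteq> 0"
      unfolding lin_dep_def by auto
    hence "A = {e}" "v = e" by auto
    hence z: "a e \<odot>\<^bsub>V\<^esub> e = \<zero>\<^bsub>V\<^esub>" "a e \<noteq> 0" using * lc by auto
    have "e = (inverse (a e) * a e) \<odot>\<^bsub>V\<^esub> e" using z(2) smult_one[OF assms(2)] by simp
    also have "\<dots> = inverse (a e) \<odot>\<^bsub>V\<^esub> (a e \<odot>\<^bsub>V\<^esub> e)"
      using smult_assoc1[of "inverse (a e)" "a e" e] assms(2) by simp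
    also have "\<dots> = \<zero>\<^bsub>V\<^esub>" unfolding z(1) using smult_r_null[of "inverse (a e)"] by simp
    finally show False using assms(3) by simp
  qed
  ultimately have "basis {e}" using assms(2) by (simp add: basis_def)
  thus ?thesis using dim_basis[of "{e}"] assms(1) unfolding has_dim_def fin_dim_def basis_def by auto
qed

locale quotient_space = V: vectorspace class_ring V for V :: "('k::field, 'v, 'e) module_scheme" (structure) +
  fixes W
  assumes W_subset: "w \<in> W \<Longrightarrow> w \<in> carrier V"
    and W_zero: "\<zero> \<in> W"
    and W_add: "w \<in> W \<Longrightarrow> w' \<in> W \<Longrightarrow> w \<oplus> w' \<in> W"
    and W_smult: "w \<in> W \<Longrightarrow> c \<odot> w \<in> W"
begin

lemma W_neg: "w \<in> W \<Longrightarrow> \<ominus> w \<in> W"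
  by (subst V.smult_minus_1[OF W_subset, symmetric]) (auto intro: W_smult)

sublocale AW: abelian_subgroup W V
proof (rule abelian_subgroupI3)
  show "additive_subgroup W V"
    by (intro additive_subgroup.intro subgroup.intro) (auto simp: W_zero W_add W_subset W_neg a_inv_def[symmetric])
qed (rule V.M.abelian_group_axioms)

lemma coset_eq_iff:
  assumes "v \<in> carrier V" "w \<in> carrier V"
  shows "W +> v = W +> w \<longleftrightarrow> v \<ominus> w \<in> W"
proof
  assume "W +> v = W +> w"
  hence "v \<in> W +> w" using AW.a_rcos_self[OF assms(1)] by simp
  thus "v \<ominus> w \<in> W" using AW.a_rcos_module[OF assms(2,1)] by (simp add: a_minus_def)
next
  assume "v \<ominus> w \<in> W"
  hence "v \<in> W +> w" using AW.a_rcos_module[OF assms(2,1)] by (simp add: a_minus_def)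
  thus "W +> v = W +> w" using V.a_repr_independence[OF _ assms(2) AW.a_subgroup] by simp
qed

lemma quotient_carrier: "carrier (quotient_module V W) = (\<lambda>v. W +> v) ` carrier V"
  by (auto simp: quotient_module_def A_RCOSETS_def RCOSETS_def a_r_coset_def)

lemma quotient_add:
  assumes "v \<in> carrier V" "w \<in> carrier V"
  shows "(W +> v) \<oplus>\<^bsub>quotient_module V W\<^esub> (W +> w) = W +> (v \<oplus> w)"
  using AW.a_rcos_sum[OF assms] by (simp add: quotient_module_def)

lemma quotient_zero: "\<zero>\<^bsub>quotient_module V W\<^esub> = W +> \<zero>"
  using V.a_coset_join2[OF V.zero_closed AW.a_subgroup] W_zero by (simp add: quotient_module_def)

lemma quotient_smult:
  assumes v: "v \<in> carrier V"
  shows "c \<odot>\<^bsub>quotient_module V W\<^esub> (W +> v) = W +> (c \<odot> v)"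
proof -
  have "W +> (c \<odot> u) = W +> (c \<odot> v)" if "u \<in> W +> v" for u
  proof -
    have u: "u \<in> carrier V" using that v W_subset by (auto simp: a_r_coset_def r_coset_def)
    have "u \<ominus> v \<in> W" using that AW.a_rcos_module[OF v u] by (simp add: a_minus_def)
    hence "c \<odot> (u \<ominus> v) \<in> W" by (rule W_smult)
    also have "c \<odot> (u \<ominus> v) = c \<odot> u \<ominus> c \<odot> v"
      using u v by (simp add: a_minus_def V.smult_r_distr V.smult_r_minus)
    finally show ?thesis using u v by (subst coset_eq_iff) auto
  qed
  moreover have "v \<in> W +> v" using AW.a_rcos_self[OF v] .
  ultimately have "(\<Union>u\<in>W +> v. W +> (c \<odot> u)) = W +> (c \<odot> v)" by blast
  thus ?thesis by (simp add: quotient_module_def)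
qed

lemma vectorspace_quotient: "vectorspace class_ring (quotient_module V W)"
proof -
  let ?Q = "quotient_module V W"
  note simps = quotient_carrier quotient_add quotient_zero quotient_smult
  have "module class_ring ?Q"
  proof (rule module_criteria)
    show "cring (class_ring :: 'k ring)" using class_field[where 'a = 'k] unfolding field_def domain_def by blast
    show "\<forall>v\<in>carrier ?Q. \<exists>neg_v\<in>carrier ?Q. v \<oplus>\<^bsub>?Q\<^esub> neg_v = \<zero>\<^bsub>?Q\<^esub>"
    proof
      fix x assume "x \<in> carrier ?Q"
      then obtain v where v: "v \<in> carrier V" "x = W +> v" by (auto simp: quotient_carrier)
      thus "\<exists>neg_v\<in>carrier ?Q. x \<oplus>\<^bsub>?Q\<^esub> neg_v = \<zero>\<^bsub>?Q\<^esub>"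
        by (intro bexI[of _ "W +> (\<ominus> v)"]) (auto simp: simps V.r_neg)
    qed
    have dist: "(a + b) \<odot> v = a \<odot> v \<oplus> b \<odot> v" if "v \<in> carrier V" for a b v
      using V.smult_l_distr[of a b v] that by simp
    have assoc: "(a * b) \<odot> v = a \<odot> (b \<odot> v)" if "v \<in> carrier V" for a b v
      using V.smult_assoc1[of a b v] that by simp
    have one: "1 \<odot> v = v" if "v \<in> carrier V" for v
      using V.smult_one[of v] that by simp
    have closed: "a \<odot> v \<in> carrier V" if "v \<in> carrier V" for a v
      using V.smult_closed[of a v] that by simp
    show "\<forall>a b v. a \<in> carrier class_ring \<and> b \<in> carrier class_ring \<and> v \<in> carrier ?Q \<longrightarrow>
       (a \<oplus>\<^bsub>class_ring\<^esub> b) \<odot>\<^bsub>?Q\<^esub> v = a \<odot>\<^bsub>?Q\<^esub> v \<oplus>\<^bsub>?Q\<^esub> b \<odot>\<^bsub>?Q\<^esub> v"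
      by (auto simp: simps dist closed)
    show "\<forall>a b v. a \<in> carrier class_ring \<and> b \<in> carrier class_ring \<and> v \<in> carrier ?Q \<longrightarrow>
       (a \<otimes>\<^bsub>class_ring\<^esub> b) \<odot>\<^bsub>?Q\<^esub> v = a \<odot>\<^bsub>?Q\<^esub> (b \<odot>\<^bsub>?Q\<^esub> v)"
      by (auto simp: simps assoc closed)
    show "\<forall>v\<in>carrier ?Q. \<one>\<^bsub>class_ring\<^esub> \<odot>\<^bsub>?Q\<^esub> v = v"
      by (auto simp: simps one closed)
    show "\<forall>a v w. a \<in> carrier class_ring \<and> v \<in> carrier ?Q \<and> w \<in> carrier ?Q \<longrightarrow>
       a \<odot>\<^bsub>?Q\<^esub> (v \<oplus>\<^bsub>?Q\<^esub> w) = a \<odot>\<^bsub>?Q\<^esub> v \<oplus>\<^bsub>?Q\<^esub> a \<odot>\<^bsub>?Q\<^esub> w"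
      by (auto simp: simps closed V.smult_r_distr)
    show "\<forall>c v. c \<in> carrier class_ring \<and> v \<in> carrier ?Q \<longrightarrow> c \<odot>\<^bsub>?Q\<^esub> v \<in> carrier ?Q"
      by (auto simp: simps closed)
    show "\<forall>v w x. v \<in> carrier ?Q \<and> w \<in> carrier ?Q \<and> x \<in> carrier ?Q \<longrightarrow>
       (v \<oplus>\<^bsub>?Q\<^esub> w) \<oplus>\<^bsub>?Q\<^esub> x = v \<oplus>\<^bsub>?Q\<^esub> (w \<oplus>\<^bsub>?Q\<^esub> x)"
      by (auto simp: simps V.a_assoc)
    show "\<forall>v w. v \<in> carrier ?Q \<and> w \<in> carrier ?Q \<longrightarrow> v \<oplus>\<^bsub>?Q\<^esub> w = w \<oplus>\<^bsub>?Q\<^esub> v"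
      by (auto simp: simps V.a_comm)
  qed (auto simp: simps)
  thus ?thesis by (intro vectorspace.intro class_field)
qed

lemma has_dim_quotient_0:
  assumes "carrier V \<subseteq> W"
  shows "has_dim (quotient_module V W) 0"
proof (rule has_dim_0[OF vectorspace_quotient])
  have "W +> v = W +> \<zero>" if "v \<in> carrier V" for v
    using that assms V.minus_closed by (subst coset_eq_iff) auto
  thus "carrier (quotient_module V W) = {\<zero>\<^bsub>quotient_module V W\<^esub>}"
    unfolding quotient_carrier quotient_zero using V.zero_closed by blast
qed

lemma has_dim_quotient_1:
  assumes "e \<in> carrier V" "e \<notin> W" "\<And>v. v \<in> carrier V \<Longrightarrow> \<exists>c. v \<ominus> c \<odot> e \<in> W"
  shows "has_dim (quotient_module V W) 1"
proof (rule has_dim_1[OF vectorspace_quotient])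
  have closed: "a \<odot> v \<in> carrier V" if "v \<in> carrier V" for a v
    using V.smult_closed[of a v] that by simp
  show "W +> e \<in> carrier (quotient_module V W)" using assms(1) by (auto simp: quotient_carrier)
  show "W +> e \<noteq> \<zero>\<^bsub>quotient_module V W\<^esub>"
    using assms(1,2) AW.a_rcos_self[of e] by (auto simp: quotient_module_def)
  fix x assume "x \<in> carrier (quotient_module V W)"
  then obtain v where v: "v \<in> carrier V" "x = W +> v" by (auto simp: quotient_carrier)
  then obtain c where "v \<ominus> c \<odot> e \<in> W" using assms(3) by blast
  hence "x = c \<odot>\<^bsub>quotient_module V W\<^esub> (W +> e)"
    using v assms(1) by (simp add: quotient_smult coset_eq_iff closed)
  thus "\<exists>c. x = c \<odot>\<^bsub>quotient_module V W\<^esub> (W +> e)" by blast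
qed

end

section \<open>Cochains as equivariant functions on tuples\<close>

lemma perm_rep_simps:
  fixes X :: "'x set" and G :: "('g, 'm) monoid_scheme" and \<phi> :: "'g \<Rightarrow> 'x \<Rightarrow> 'x"
  defines "M \<equiv> perm_rep G X \<phi> :: ('k::field, 'x \<Rightarrow> 'k, 'g) kG_module"
  shows "carrier M = X \<rightarrow>\<^sub>E UNIV"
    and "add M = (\<lambda>f h. \<lambda>x\<in>X. f x + h x)"
    and "zero M = (\<lambda>x\<in>X. 0)"
    and "module.smult M = (\<lambda>c f. \<lambda>x\<in>X. c * f x)"
    and "act M = (\<lambda>g f. \<lambda>x\<in>X. f (\<phi> (inv\<^bsub>G\<^esub> g) x))"
  unfolding M_def perm_rep_def by (simp_all add: class_ring.func_space_def module.defs kG_module.defs)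

lemma finite_bar_basis: "finite (carrier G) \<Longrightarrow> finite (bar_basis G m)"
  using finite_lists_length_eq[of "carrier G" "Suc m"] by (simp add: bar_basis_def conj_commute)

definition bar_unit :: "('g, 'm) monoid_scheme \<Rightarrow> nat \<Rightarrow> 'g list \<Rightarrow> ('g list \<Rightarrow> 'k::field)"
  where "bar_unit G m xs = (\<lambda>ys\<in>bar_basis G m. if ys = xs then 1 else 0)"

text \<open>
  A linear map out of the bar module is determined by its values \<open>D\<close> on tuples, which are the
  basis; every cochain will be written in this form, and the coboundary then becomes an alternating
  sum over omitted entries, computed without reference to the bar module.
\<close>

definition linear_extension ::
    "('g, 'm) monoid_scheme \<Rightarrow> nat \<Rightarrow> 'x set \<Rightarrow> ('g list \<Rightarrow> 'x \<Rightarrow> 'k::field) \<Rightarrow> ('g list \<Rightarrow> 'k) \<Rightarrow> ('x \<Rightarrow> 'k)"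
  where "linear_extension G m X D =
    (\<lambda>f\<in>bar_basis G m \<rightarrow>\<^sub>E UNIV. \<lambda>x\<in>X. \<Sum>xs\<in>bar_basis G m. f xs * D xs x)"

lemma linear_extension_unit:
  assumes "finite (carrier G)" "xs \<in> bar_basis G m" "x \<in> X"
  shows "linear_extension G m X D (bar_unit G m xs) x = D xs x"
proof -
  have "(\<Sum>ys\<in>bar_basis G m. bar_unit G m xs ys * D ys x) = (\<Sum>ys\<in>bar_basis G m. if ys = xs then D xs x else 0)"
    by (intro sum.cong) (auto simp: bar_unit_def)
  also have "\<dots> = D xs x" using assms(1,2) by (simp add: finite_bar_basis)
  finally show ?thesis using assms(3) by (simp add: linear_extension_def bar_unit_def)
qed

lemma linear_extension_cong:
  assumes "\<And>xs x. xs \<in> bar_basis G m \<Longrightarrow> x \<in> X \<Longrightarrow> D xs x = E xs x"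
  shows "linear_extension G m X D = linear_extension G m X E"
  unfolding linear_extension_def using assms by (intro restrict_ext sum.cong refl) auto

lemma linear_extension_eq_iff:
  assumes "finite (carrier G)"
  shows "linear_extension G m X D = linear_extension G m X E \<longleftrightarrow>
    (\<forall>xs\<in>bar_basis G m. \<forall>x\<in>X. D xs x = E xs x)"
proof
  assume "linear_extension G m X D = linear_extension G m X E"
  thus "\<forall>xs\<in>bar_basis G m. \<forall>x\<in>X. D xs x = E xs x"
    using linear_extension_unit[OF assms, of _ m _ X D] linear_extension_unit[OF assms, of _ m _ X E] by simp
qed (auto intro: linear_extension_cong)

lemma omit_nth_bar_basis: "xs \<in> bar_basis G (Suc m) \<Longrightarrow> i \<le> Suc m \<Longrightarrow> omit_nth i xs \<in> bar_basis G m"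
  using set_take_subset[of i xs] set_drop_subset[of "Suc i" xs]
  by (auto simp: bar_basis_def omit_nth_def)

definition codifferential :: "nat \<Rightarrow> ('g list \<Rightarrow> 'x \<Rightarrow> 'k::field) \<Rightarrow> ('g list \<Rightarrow> 'x \<Rightarrow> 'k)"
  where "codifferential m D xs x = (\<Sum>i\<le>Suc m. (-1) ^ i * D (omit_nth i xs) x)"

text \<open>
  The boundary in the bar module is given in coefficients, so this is the statement that precomposing
  with it is transposition: the double sum over tuples of length \<open>m + 1\<close> and \<open>m + 2\<close> is summed in the
  other order.
\<close>

lemma coboundary_linear_extension:
  fixes D :: "'g list \<Rightarrow> 'x \<Rightarrow> 'k::field"
  assumes fin: "finite (carrier G)"
  shows "coboundary G m (linear_extension G m X D) = linear_extension G (Suc m) X (codifferential m D)"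
proof
  fix f :: "'g list \<Rightarrow> 'k"
  show "coboundary G m (linear_extension G m X D) f = linear_extension G (Suc m) X (codifferential m D) f"
  proof (cases "f \<in> bar_basis G (Suc m) \<rightarrow>\<^sub>E UNIV")
    case True
    have "(\<Sum>ys\<in>bar_basis G m. bar_boundary G m f ys * D ys x)
        = (\<Sum>xs\<in>bar_basis G (Suc m). f xs * codifferential m D xs x)" for x
    proof -
      have "(\<Sum>ys\<in>bar_basis G m. bar_boundary G m f ys * D ys x)
         = (\<Sum>ys\<in>bar_basis G m. \<Sum>xs\<in>bar_basis G (Suc m). \<Sum>i\<le>Suc m.
             if omit_nth i xs = ys then (-1) ^ i * f xs * D ys x else 0)"
      proof (rule sum.cong[OF refl])
        fix ys assume ys: "ys \<in> bar_basis G m"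
        have "bar_boundary G m f ys * D ys x = (\<Sum>xs\<in>bar_basis G (Suc m). \<Sum>i\<le>Suc m.
            (if omit_nth i xs = ys then (-1) ^ i * f xs else 0) * D ys x)"
          using ys by (simp only: bar_boundary_def restrict_apply' sum_distrib_right)
        also have "\<dots> = (\<Sum>xs\<in>bar_basis G (Suc m). \<Sum>i\<le>Suc m.
            if omit_nth i xs = ys then (-1) ^ i * f xs * D ys x else 0)"
          by (intro sum.cong refl) simp
        finally show "bar_boundary G m f ys * D ys x = \<dots>" .
      qed
      also have "\<dots> = (\<Sum>xs\<in>bar_basis G (Suc m). \<Sum>i\<le>Suc m. \<Sum>ys\<in>bar_basis G m.
             if omit_nth i xs = ys then (-1) ^ i * f xs * D ys x else 0)"
        by (subst sum.swap, intro sum.cong refl, rule sum.swap)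
      also have "\<dots> = (\<Sum>xs\<in>bar_basis G (Suc m). f xs * codifferential m D xs x)"
      proof (rule sum.cong[OF refl])
        fix xs assume xs: "xs \<in> bar_basis G (Suc m)"
        have "(\<Sum>ys\<in>bar_basis G m. if omit_nth i xs = ys then (-1) ^ i * f xs * D ys x else 0)
           = (-1) ^ i * f xs * D (omit_nth i xs) x" if "i \<le> Suc m" for i
          using omit_nth_bar_basis[OF xs that] finite_bar_basis[OF fin, of m] by (simp add: sum.delta)
        thus "(\<Sum>i\<le>Suc m. \<Sum>ys\<in>bar_basis G m. if omit_nth i xs = ys then (-1) ^ i * f xs * D ys x else 0)
           = f xs * codifferential m D xs x"
          unfolding codifferential_def sum_distrib_left by (intro sum.cong refl) (simp add: mult_ac)
      qed
      finally show ?thesis .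
    qed
    moreover have "bar_boundary G m f \<in> bar_basis G m \<rightarrow>\<^sub>E UNIV" by (simp add: bar_boundary_def)
    ultimately show ?thesis using True
      by (simp add: coboundary_def linear_extension_def bar_module_def perm_rep_simps cong: restrict_cong)
  next
    case False
    thus ?thesis by (simp add: coboundary_def linear_extension_def bar_module_def perm_rep_simps)
  qed
qed

text \<open>
  A subspace \<open>S\<close> of the functions on a \<open>G\<close>-set \<open>X\<close> that is stable under \<open>G\<close>. Elements of \<open>S\<close> are
  extensional functions, hence the restrictions in the closure conditions.
\<close>

locale perm_subrep = group G for G :: "('g, 'm) monoid_scheme" (structure) +
  fixes X :: "'x set" and \<phi> :: "'g \<Rightarrow> 'x \<Rightarrow> 'x" and S :: "('x \<Rightarrow> 'k::field) set"
  assumes finite_carrier: "finite (carrier G)"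
    and phi_closed: "g \<in> carrier G \<Longrightarrow> x \<in> X \<Longrightarrow> \<phi> g x \<in> X"
    and phi_one: "x \<in> X \<Longrightarrow> \<phi> \<one> x = x"
    and phi_mult: "g \<in> carrier G \<Longrightarrow> h \<in> carrier G \<Longrightarrow> x \<in> X \<Longrightarrow> \<phi> (g \<otimes> h) x = \<phi> g (\<phi> h x)"
    and S_extensional: "v \<in> S \<Longrightarrow> v \<in> extensional X"
    and S_zero: "(\<lambda>x\<in>X. 0) \<in> S"
    and S_add: "v \<in> S \<Longrightarrow> w \<in> S \<Longrightarrow> (\<lambda>x\<in>X. v x + w x) \<in> S"
    and S_smult: "v \<in> S \<Longrightarrow> (\<lambda>x\<in>X. c * v x) \<in> S"
    and S_act: "g \<in> carrier G \<Longrightarrow> v \<in> S \<Longrightarrow> (\<lambda>x\<in>X. v (\<phi> (inv g) x)) \<in> S"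
begin

abbreviation N where "N \<equiv> (perm_rep G X \<phi> :: ('k, 'x \<Rightarrow> 'k, 'g) kG_module)\<lparr>carrier := S\<rparr>"

abbreviation P where "P m \<equiv> (bar_module G m :: ('k, 'g list \<Rightarrow> 'k, 'g) kG_module)"

lemma S_sum:
  assumes "finite I" "\<And>i. i \<in> I \<Longrightarrow> v i \<in> S"
  shows "(\<lambda>x\<in>X. \<Sum>i\<in>I. c i * v i x) \<in> S"
  using assms
proof (induction I rule: finite_induct)
  case empty
  show ?case unfolding sum.empty by (rule S_zero)
next
  case (insert i I)
  have "(\<lambda>x\<in>X. (\<lambda>x\<in>X. c i * v i x) x + (\<lambda>x\<in>X. \<Sum>i\<in>I. c i * v i x) x) \<in> S"
    using insert by (intro S_add S_smult) auto
  moreover have "(\<lambda>x\<in>X. (\<lambda>x\<in>X. c i * v i x) x + (\<lambda>x\<in>X. \<Sum>i\<in>I. c i * v i x) x)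
     = (\<lambda>x\<in>X. \<Sum>i\<in>insert i I. c i * v i x)"
    using insert.hyps by (auto simp: restrict_def)
  ultimately show ?case by (simp only:)
qed

text \<open>
  The values on tuples of a homomorphism of \<open>kG\<close>-modules from the bar module to \<open>S\<close>.
\<close>

definition equivariant_cochain :: "nat \<Rightarrow> ('g list \<Rightarrow> 'x \<Rightarrow> 'k) \<Rightarrow> bool"
  where "equivariant_cochain m D \<longleftrightarrow>
    (\<forall>xs\<in>bar_basis G m. restrict (D xs) X \<in> S) \<and>
    (\<forall>g\<in>carrier G. \<forall>xs\<in>bar_basis G m. \<forall>x\<in>X. D (map (\<lambda>h. g \<otimes> h) xs) x = D xs (\<phi> (inv g) x))"

lemma bar_basis_translate:
  assumes "g \<in> carrier G" "xs \<in> bar_basis G m"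
  shows "map (\<lambda>h. g \<otimes> h) xs \<in> bar_basis G m"
  using assms by (auto simp: bar_basis_def)

lemma translate_inv:
  assumes "g \<in> carrier G" "xs \<in> bar_basis G m"
  shows "map (\<lambda>h. inv g \<otimes> h) (map (\<lambda>h. g \<otimes> h) xs) = xs"
    and "map (\<lambda>h. g \<otimes> h) (map (\<lambda>h. inv g \<otimes> h) xs) = xs"
  using assms by (auto simp: bar_basis_def inv_solve_left' m_assoc[symmetric] intro!: map_idI)

lemma linear_extension_cochain:
  assumes D: "equivariant_cochain m D"
  shows "linear_extension G m X D \<in> carrier (cochains G N m)"
proof -
  let ?L = "linear_extension G m X D" and ?B = "bar_basis G m"
  have carrier: "carrier (P m) = ?B \<rightarrow>\<^sub>E UNIV" by (simp add: bar_module_def perm_rep_simps)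
  have fin: "finite ?B" using finite_bar_basis[OF finite_carrier] .
  have closed: "?L f \<in> S" if "f \<in> carrier (P m)" for f
  proof -
    have "(\<lambda>x\<in>X. \<Sum>xs\<in>?B. f xs * restrict (D xs) X x) \<in> S"
      by (rule S_sum[where v = "\<lambda>xs. restrict (D xs) X", OF fin]) (use D in \<open>simp add: equivariant_cochain_def\<close>)
    moreover have "(\<lambda>x\<in>X. \<Sum>xs\<in>?B. f xs * restrict (D xs) X x) = ?L f"
      using that by (auto simp: linear_extension_def carrier)
    ultimately show ?thesis by simp
  qed
  have hom: "?L \<in> LinearCombinations.module_hom class_ring (P m) N"
  proof -
    have "?L (f \<oplus>\<^bsub>P m\<^esub> h) = ?L f \<oplus>\<^bsub>N\<^esub> ?L h" if "f \<in> carrier (P m)" "h \<in> carrier (P m)" for f h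
      using that unfolding carrier
      by (intro ext) (simp add: linear_extension_def bar_module_def perm_rep_simps distrib_right sum.distrib)
    moreover have "?L (c \<odot>\<^bsub>P m\<^esub> f) = c \<odot>\<^bsub>N\<^esub> ?L f" if "f \<in> carrier (P m)" for c f
      using that unfolding carrier
      by (intro ext) (simp add: linear_extension_def bar_module_def perm_rep_simps sum_distrib_left mult.assoc)
    ultimately show ?thesis
      unfolding LinearCombinations.module_hom_def using closed by simp
  qed
  have act: "?L (act (P m) g f) = act N g (?L f)" if g: "g \<in> carrier G" and f: "f \<in> carrier (P m)" for g f
  proof -
    let ?t = "\<lambda>g. map (\<lambda>h. g \<otimes> h)"
    have "(\<Sum>xs\<in>?B. f (?t (inv g) xs) * D xs x) = (\<Sum>xs\<in>?B. f xs * D xs (\<phi> (inv g) x))" if x: "x \<in> X" for x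
    proof (rule sum.reindex_bij_witness[where i = "?t g" and j = "?t (inv g)"])
      fix xs assume xs: "xs \<in> ?B"
      have "D (?t g (?t (inv g) xs)) x = D (?t (inv g) xs) (\<phi> (inv g) x)"
        using D g x bar_basis_translate[OF _ xs, of "inv g"] unfolding equivariant_cochain_def by blast
      thus "f (?t (inv g) xs) * D (?t (inv g) xs) (\<phi> (inv g) x) = f (?t (inv g) xs) * D xs x"
        using translate_inv(2)[OF g xs] by simp
    next
      fix xs assume "xs \<in> ?B"
      thus "?t g (?t (inv g) xs) = xs" "?t (inv g) xs \<in> ?B" "?t (inv g) (?t g xs) = xs" "?t g xs \<in> ?B"
        using g translate_inv[OF g] bar_basis_translate[of _ xs m] by blast+
    qed
    moreover have "act (P m) g f = (\<lambda>xs\<in>?B. f (?t (inv g) xs))" by (simp add: bar_module_def perm_rep_simps)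
    moreover have "act N g (?L f) = (\<lambda>x\<in>X. \<Sum>xs\<in>?B. f xs * D xs (\<phi> (inv g) x))"
      using f phi_closed[of "inv g"] g by (intro ext) (simp add: perm_rep_simps linear_extension_def carrier)
    ultimately show ?thesis
      by (intro ext) (simp add: linear_extension_def)
  qed
  show ?thesis
  proof -
    have "?L \<in> extensional (carrier (P m))" unfolding linear_extension_def carrier by simp
    thus ?thesis using hom act by (simp add: cochains_def hom_space_def kG_hom_def)
  qed
qed

text \<open>
  A homomorphism is compared with the linear extension of its values on the basis by adding one tuple
  at a time to the support of the argument.
\<close>

lemma cochain_expansion:
  assumes F: "F \<in> LinearCombinations.module_hom class_ring (P m) N" and f: "f \<in> carrier (P m)" and x: "x \<in> X"
  shows "F f x = (\<Sum>xs\<in>bar_basis G m. f xs * F (bar_unit G m xs) x)"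
proof -
  let ?B = "bar_basis G m"
  have carrier: "carrier (P m) = ?B \<rightarrow>\<^sub>E UNIV" by (simp add: bar_module_def perm_rep_simps)
  have fin: "finite ?B" using finite_bar_basis[OF finite_carrier] .
  have add: "F (\<lambda>ys\<in>?B. u ys + w ys) x = F u x + F w x"
    if "u \<in> carrier (P m)" "w \<in> carrier (P m)" for u w
    using F that x by (simp add: LinearCombinations.module_hom_def bar_module_def perm_rep_simps)
  have smult: "F (\<lambda>ys\<in>?B. c * u ys) x = c * F u x" if "u \<in> carrier (P m)" for u c
    using F that x by (simp add: LinearCombinations.module_hom_def bar_module_def perm_rep_simps)
  have "F (\<lambda>ys\<in>?B. if ys \<in> A then f ys else 0) x = (\<Sum>xs\<in>A. f xs * F (bar_unit G m xs) x)"
    if "finite A" "A \<subseteq> ?B" for A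
    using that
  proof (induction A rule: finite_induct)
    case empty
    have "F (\<lambda>ys\<in>?B. 0 * f ys) x = 0 * F f x" by (rule smult[OF f])
    moreover have "(\<lambda>ys\<in>?B. if ys \<in> {} then f ys else 0) = (\<lambda>ys\<in>?B. 0 * f ys)" by auto
    ultimately show ?case by (simp only: sum.empty mult_zero_left)
  next
    case (insert a A)
    have 1: "bar_unit G m a \<in> carrier (P m)" by (simp add: carrier bar_unit_def)
    have 2: "(\<lambda>ys\<in>?B. if ys \<in> A then f ys else 0) \<in> carrier (P m)" by (simp add: carrier)
    have 3: "(\<lambda>ys\<in>?B. f a * bar_unit G m a ys) \<in> carrier (P m)" by (simp add: carrier)
    have "(\<lambda>ys\<in>?B. if ys \<in> insert a A then f ys else 0)
      = (\<lambda>ys\<in>?B. (\<lambda>ys\<in>?B. f a * bar_unit G m a ys) ys + (\<lambda>ys\<in>?B. if ys \<in> A then f ys else 0) ys)"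
      using insert.hyps by (auto simp: restrict_def bar_unit_def fun_eq_iff)
    hence "F (\<lambda>ys\<in>?B. if ys \<in> insert a A then f ys else 0) x
        = F (\<lambda>ys\<in>?B. f a * bar_unit G m a ys) x + F (\<lambda>ys\<in>?B. if ys \<in> A then f ys else 0) x"
      using add[OF 3 2] by (simp only:)
    also have "\<dots> = (\<Sum>xs\<in>insert a A. f xs * F (bar_unit G m xs) x)"
    proof -
      have "F (\<lambda>ys\<in>?B. if ys \<in> A then f ys else 0) x = (\<Sum>xs\<in>A. f xs * F (bar_unit G m xs) x)"
        using insert by blast
      thus ?thesis by (simp only: sum.insert[OF insert.hyps] smult[OF 1])
    qed
    finally show ?case .
  qed
  from this[OF fin subset_refl]
  have "F (\<lambda>ys\<in>?B. if ys \<in> ?B then f ys else 0) x = (\<Sum>xs\<in>?B. f xs * F (bar_unit G m xs) x)" .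
  thus ?thesis
  proof -
    have "(\<lambda>ys\<in>?B. if ys \<in> ?B then f ys else 0) = f"
      using f by (intro extensionalityI[of _ ?B]) (auto simp: carrier PiE_def)
    thus ?thesis using \<open>F (\<lambda>ys\<in>?B. if ys \<in> ?B then f ys else 0) x = _\<close> by (simp only:)
  qed
qed

lemma act_bar_unit:
  assumes "g \<in> carrier G" "xs \<in> bar_basis G m"
  shows "act (P m) g (bar_unit G m xs) = bar_unit G m (map (\<lambda>h. g \<otimes> h) xs)"
proof -
  have "map (\<lambda>h. inv g \<otimes> h) ys = xs \<longleftrightarrow> ys = map (\<lambda>h. g \<otimes> h) xs" if "ys \<in> bar_basis G m" for ys
    using translate_inv[OF assms(1)] that assms(2) by metis
  thus ?thesis using assms bar_basis_translate[of "inv g" _ m]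
    by (auto simp: bar_module_def perm_rep_simps bar_unit_def intro!: restrict_ext)
qed

lemma cochainE:
  assumes F: "F \<in> carrier (cochains G N m)"
  obtains D where "equivariant_cochain m D" "F = linear_extension G m X D"
proof
  let ?B = "bar_basis G m" and ?D = "\<lambda>xs. F (bar_unit G m xs)"
  have carrier: "carrier (P m) = ?B \<rightarrow>\<^sub>E UNIV" by (simp add: bar_module_def perm_rep_simps)
  have hom: "F \<in> LinearCombinations.module_hom class_ring (P m) N"
    and ext: "F \<in> extensional (carrier (P m))"
    and eq: "\<And>g f. g \<in> carrier G \<Longrightarrow> f \<in> carrier (P m) \<Longrightarrow> F (act (P m) g f) = act N g (F f)"
    using F by (auto simp: cochains_def hom_space_def kG_hom_def)
  have unit: "bar_unit G m xs \<in> carrier (P m)" for xs by (simp add: carrier bar_unit_def)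
  have closed: "F f \<in> S" if "f \<in> carrier (P m)" for f
    using hom that by (auto simp: LinearCombinations.module_hom_def)
  hence extS: "F f \<in> extensional X" if "f \<in> carrier (P m)" for f
    using that S_extensional by blast
  show "F = linear_extension G m X ?D"
  proof
    fix f
    show "F f = linear_extension G m X ?D f"
    proof (cases "f \<in> carrier (P m)")
      case True
      show ?thesis
      proof (rule extensionalityI[OF extS[OF True]])
        show "linear_extension G m X ?D f \<in> extensional X" using True by (simp add: linear_extension_def carrier)
        fix x assume "x \<in> X"
        thus "F f x = linear_extension G m X ?D f x"
          using True cochain_expansion[OF hom True, of x] by (simp add: linear_extension_def carrier)
      qed
    next
      case False
      thus ?thesis using ext by (simp add: linear_extension_def carrier extensional_def)
    qed
  qed
  show "equivariant_cochain m ?D"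
    unfolding equivariant_cochain_def
  proof (intro conjI ballI)
    fix xs assume xs: "xs \<in> ?B"
    show "restrict (?D xs) X \<in> S"
      using closed[OF unit] extS[OF unit] by (simp add: extensional_restrict)
    fix g x assume g: "g \<in> carrier G" and x: "x \<in> X"
    have "F (bar_unit G m (map (\<lambda>h. g \<otimes> h) xs)) = act N g (F (bar_unit G m xs))"
      using eq[OF g unit[of xs]] unfolding act_bar_unit[OF g xs] .
    thus "?D (map (\<lambda>h. g \<otimes> h) xs) x = ?D xs (\<phi> (inv g) x)"
      using x by (simp add: perm_rep_simps)
  qed
qed

end

section \<open>Degree one cohomology of a submodule of a permutation module\<close>

lemma bar_basis_0: "bar_basis G 0 = (\<lambda>g. [g]) ` carrier G"
  by (auto simp: bar_basis_def length_Suc_conv)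

lemma bar_basis_1: "xs \<in> bar_basis G 1 \<longleftrightarrow> (\<exists>g\<in>carrier G. \<exists>h\<in>carrier G. xs = [g, h])"
  by (auto simp: bar_basis_def length_Suc_conv)

lemma bar_basis_2: "xs \<in> bar_basis G 2 \<longleftrightarrow> (\<exists>g\<in>carrier G. \<exists>h\<in>carrier G. \<exists>k\<in>carrier G. xs = [g, h, k])"
  by (auto simp: bar_basis_def length_Suc_conv numeral_2_eq_2)

context perm_subrep
begin

definition difference :: "('x \<Rightarrow> 'k) \<Rightarrow> 'g list \<Rightarrow> 'x \<Rightarrow> 'k"
  where "difference v xs x = v (\<phi> (inv (xs ! 1)) x) - v (\<phi> (inv (xs ! 0)) x)"

text \<open>
  The cocycle \<open>g \<mapsto> g v - v\<close> of \<open>v\<close>, in homogeneous form: its value on \<open>(g, h)\<close> is \<open>h v - g v\<close>.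
\<close>

definition principal :: "('x \<Rightarrow> 'k) \<Rightarrow> ('g list \<Rightarrow> 'k) \<Rightarrow> ('x \<Rightarrow> 'k)"
  where "principal v = linear_extension G 1 X (difference v)"

text \<open>
  The functions whose class modulo \<open>S\<close> is fixed by \<open>G\<close>; \<open>v\<close> itself need not lie in \<open>S\<close>.
\<close>

definition almost_invariant :: "('x \<Rightarrow> 'k) \<Rightarrow> bool"
  where "almost_invariant v \<longleftrightarrow> (\<forall>g\<in>carrier G. (\<lambda>x\<in>X. v (\<phi> (inv g) x) - v x) \<in> S)"

definition invariant :: "('x \<Rightarrow> 'k) \<Rightarrow> bool"
  where "invariant v \<longleftrightarrow> (\<forall>g\<in>carrier G. \<forall>x\<in>X. v (\<phi> g x) = v x)"

lemma restrict_in_S: "v \<in> S \<Longrightarrow> restrict v X \<in> S"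
  using S_extensional by (simp add: extensional_restrict)

lemma restrict_add_in_S:
  assumes "restrict v X \<in> S" "restrict w X \<in> S"
  shows "(\<lambda>x\<in>X. v x + w x) \<in> S"
proof -
  have "(\<lambda>x\<in>X. restrict v X x + restrict w X x) = (\<lambda>x\<in>X. v x + w x)" by auto
  thus ?thesis using S_add[OF assms] by (simp only:)
qed

lemma restrict_smult_in_S:
  assumes "restrict v X \<in> S"
  shows "(\<lambda>x\<in>X. c * v x) \<in> S"
proof -
  have "(\<lambda>x\<in>X. c * restrict v X x) = (\<lambda>x\<in>X. c * v x)" by auto
  thus ?thesis using S_smult[OF assms, of c] by (simp only:)
qed

lemma restrict_diff_in_S:
  assumes "restrict v X \<in> S" "restrict w X \<in> S"
  shows "(\<lambda>x\<in>X. v x - w x) \<in> S"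
  using restrict_add_in_S[OF assms(1) restrict_smult_in_S[OF assms(2), of "-1"]] by simp

lemma almost_invariantD: "almost_invariant v \<Longrightarrow> g \<in> carrier G \<Longrightarrow> (\<lambda>x\<in>X. v (\<phi> (inv g) x) - v x) \<in> S"
  by (simp add: almost_invariant_def)

lemma S_almost_invariant: "v \<in> S \<Longrightarrow> almost_invariant v"
  unfolding almost_invariant_def
  by (intro ballI restrict_diff_in_S S_act restrict_in_S)

lemma almost_invariant_add:
  assumes "almost_invariant v" "almost_invariant w"
  shows "almost_invariant (\<lambda>x. v x + w x)"
  unfolding almost_invariant_def
proof
  fix g assume g: "g \<in> carrier G"
  show "(\<lambda>x\<in>X. v (\<phi> (inv g) x) + w (\<phi> (inv g) x) - (v x + w x)) \<in> S"
    using restrict_add_in_S[OF almost_invariantD[OF assms(1) g] almost_invariantD[OF assms(2) g]]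
    by (simp only: add_diff_add)
qed

lemma almost_invariant_smult:
  assumes "almost_invariant v"
  shows "almost_invariant (\<lambda>x. c * v x)"
  unfolding almost_invariant_def
proof
  fix g assume g: "g \<in> carrier G"
  show "(\<lambda>x\<in>X. c * v (\<phi> (inv g) x) - c * v x) \<in> S"
    using restrict_smult_in_S[OF almost_invariantD[OF assms g], of c]
    by (simp only: right_diff_distrib)
qed

lemma equivariant_difference:
  assumes v: "almost_invariant v"
  shows "equivariant_cochain 1 (difference v)"
  unfolding equivariant_cochain_def bar_basis_1
proof (intro conjI ballI)
  fix xs assume "xs \<in> bar_basis G 1"
  then obtain g h where gh: "g \<in> carrier G" "h \<in> carrier G" "xs = [g, h]" unfolding bar_basis_1 by blast
  have "(\<lambda>x\<in>X. (v (\<phi> (inv h) x) - v x) - (v (\<phi> (inv g) x) - v x)) \<in> S"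
    by (rule restrict_diff_in_S[OF almost_invariantD[OF v gh(2)] almost_invariantD[OF v gh(1)]])
  moreover have "(\<lambda>x\<in>X. (v (\<phi> (inv h) x) - v x) - (v (\<phi> (inv g) x) - v x)) = restrict (difference v xs) X"
    using gh by (auto simp: difference_def)
  ultimately show "restrict (difference v xs) X \<in> S" by (simp only:)
next
  fix a xs x assume a: "a \<in> carrier G" and xs: "xs \<in> bar_basis G 1" and x: "x \<in> X"
  obtain g h where gh: "g \<in> carrier G" "h \<in> carrier G" "xs = [g, h]" using xs unfolding bar_basis_1 by blast
  have "\<phi> (inv (a \<otimes> g)) x = \<phi> (inv g) (\<phi> (inv a) x)" if "g \<in> carrier G" for g
    using a that x by (simp add: inv_mult_group phi_mult)
  thus "difference v (map (\<lambda>h. a \<otimes> h) xs) x = difference v xs (\<phi> (inv a) x)"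
    using gh by (simp add: difference_def)
qed

lemma codifferential_difference: "codifferential 1 (difference v) [g, h, k] x = 0"
  by (simp add: codifferential_def omit_nth_def difference_def numeral_2_eq_2)

lemma zero_cochains: "\<zero>\<^bsub>cochains G N m\<^esub> = linear_extension G m X (\<lambda>_ _. 0)"
  by (simp add: cochains_def hom_space_def linear_extension_def bar_module_def perm_rep_simps)

lemma principal_cocycle:
  assumes "almost_invariant v"
  shows "principal v \<in> cocycles G N 1"
proof -
  have "codifferential 1 (difference v) xs x = 0" if "xs \<in> bar_basis G 2" for xs x
    using that codifferential_difference unfolding bar_basis_2 by blast
  hence "linear_extension G (Suc 1) X (codifferential 1 (difference v)) = linear_extension G (Suc 1) X (\<lambda>_ _. 0)"
    by (intro linear_extension_cong) (simp add: numeral_2_eq_2)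
  thus ?thesis
    using linear_extension_cochain[OF equivariant_difference[OF assms]]
    unfolding cocycles_def principal_def
    by (simp only: coboundary_linear_extension[OF finite_carrier] zero_cochains mem_Collect_eq simp_thms)
qed

text \<open>
  The values \<open>D [1, g]\<close> form an inhomogeneous cocycle. It becomes trivial in the whole function space,
  and equivariance carries this from the pairs \<open>(1, g)\<close> to all pairs.
\<close>

lemma cocycle_principal:
  assumes vanishing: "\<And>z. (\<And>g h x. g \<in> carrier G \<Longrightarrow> h \<in> carrier G \<Longrightarrow> x \<in> X \<Longrightarrow>
        z (g \<otimes> h) x = z g x + z h (\<phi> (inv g) x)) \<Longrightarrow>
      \<exists>v. \<forall>g\<in>carrier G. \<forall>x\<in>X. (z g x :: 'k) = v (\<phi> (inv g) x) - v x"
    and F: "F \<in> cocycles G N 1"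
  obtains v where "almost_invariant v" "F = principal v"
proof -
  obtain D where D: "equivariant_cochain 1 D" "F = linear_extension G 1 X D"
    using F cochainE unfolding cocycles_def by blast
  have trans: "D (map (\<lambda>h. g \<otimes> h) xs) x = D xs (\<phi> (inv g) x)"
    if "g \<in> carrier G" "xs \<in> bar_basis G 1" "x \<in> X" for g xs x
    using D(1) that unfolding equivariant_cochain_def by blast
  have mem: "[g, h] \<in> bar_basis G 1" if "g \<in> carrier G" "h \<in> carrier G" for g h
    using that unfolding bar_basis_1 by blast
  have "linear_extension G (Suc 1) X (codifferential 1 D) = linear_extension G (Suc 1) X (\<lambda>_ _. 0)"
    using F unfolding cocycles_def mem_Collect_eq D(2) coboundary_linear_extension[OF finite_carrier] zero_cochains
    by (rule conjunct2)
  hence "\<forall>xs\<in>bar_basis G 2. \<forall>x\<in>X. codifferential 1 D xs x = 0"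
    unfolding linear_extension_eq_iff[OF finite_carrier] by (simp add: numeral_2_eq_2)
  hence cocycle: "D [h, k] x - D [g, k] x + D [g, h] x = 0"
    if "g \<in> carrier G" "h \<in> carrier G" "k \<in> carrier G" "x \<in> X" for g h k x
  proof -
    have "[g, h, k] \<in> bar_basis G 2" using that unfolding bar_basis_2 by blast
    hence "codifferential 1 D [g, h, k] x = 0"
      using \<open>\<forall>xs\<in>bar_basis G 2. \<forall>x\<in>X. codifferential 1 D xs x = 0\<close> that(4) by blast
    thus ?thesis by (simp add: codifferential_def omit_nth_def numeral_2_eq_2)
  qed
  have "\<exists>v. \<forall>g\<in>carrier G. \<forall>x\<in>X. D [\<one>, g] x = v (\<phi> (inv g) x) - v x"
  proof (rule vanishing)
    fix g h x assume gh: "g \<in> carrier G" "h \<in> carrier G" "x \<in> X"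
    have "D [g, g \<otimes> h] x = D [\<one>, h] (\<phi> (inv g) x)"
      using trans[OF gh(1) mem[OF one_closed gh(2)] gh(3)] gh by simp
    thus "D [\<one>, g \<otimes> h] x = D [\<one>, g] x + D [\<one>, h] (\<phi> (inv g) x)"
      using cocycle[OF one_closed gh(1) m_closed[OF gh(1,2)] gh(3)] by (simp add: algebra_simps)
  qed
  then obtain v where v: "D [\<one>, g] x = v (\<phi> (inv g) x) - v x" if "g \<in> carrier G" "x \<in> X" for g x by blast
  have "D xs x = difference v xs x" if xs: "xs \<in> bar_basis G 1" and x: "x \<in> X" for xs x
  proof -
    obtain g h where gh: "g \<in> carrier G" "h \<in> carrier G" "xs = [g, h]" using xs unfolding bar_basis_1 by blast
    have "D [g, h] x = D [\<one>, inv g \<otimes> h] (\<phi> (inv g) x)"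
      using trans[OF gh(1) mem[OF one_closed, of "inv g \<otimes> h"] x] gh by (simp add: m_assoc[symmetric])
    also have "\<dots> = v (\<phi> (inv (inv g \<otimes> h)) (\<phi> (inv g) x)) - v (\<phi> (inv g) x)"
      using gh x by (intro v) (auto simp: phi_closed)
    also have "\<phi> (inv (inv g \<otimes> h)) (\<phi> (inv g) x) = \<phi> (inv h) x"
    proof -
      have "\<phi> (inv h \<otimes> g) (\<phi> (inv g) x) = \<phi> (inv h \<otimes> g \<otimes> inv g) x"
        using gh x by (intro phi_mult[symmetric]) auto
      thus ?thesis using gh by (simp add: inv_mult_group m_assoc)
    qed
    finally show ?thesis using gh by (simp add: difference_def)
  qed
  hence "F = principal v" unfolding D(2) principal_def by (intro linear_extension_cong)
  moreover have "almost_invariant v"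
    unfolding almost_invariant_def
  proof
    fix g assume g: "g \<in> carrier G"
    have "restrict (D [\<one>, g]) X \<in> S" using D(1) mem[OF one_closed g] unfolding equivariant_cochain_def by blast
    moreover have "restrict (D [\<one>, g]) X = (\<lambda>x\<in>X. v (\<phi> (inv g) x) - v x)" using v[OF g] by auto
    ultimately show "(\<lambda>x\<in>X. v (\<phi> (inv g) x) - v x) \<in> S" by (simp only:)
  qed
  ultimately show ?thesis using that by blast
qed

text \<open>
  An equivariant function on 1-tuples is determined by its value \<open>w \<in> S\<close> on the tuple \<open>(1)\<close>, and its
  coboundary is the cocycle of \<open>w\<close>.
\<close>

lemma coboundaries_principal: "coboundaries G N 1 = principal ` S"
proof (intro equalityI subsetI)
  fix F assume "F \<in> coboundaries G N 1"
  then obtain F0 where F0: "F0 \<in> carrier (cochains G N 0)" "F = coboundary G 0 F0"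
    by (auto simp: coboundaries_def)
  obtain D where D: "equivariant_cochain 0 D" "F0 = linear_extension G 0 X D" using cochainE[OF F0(1)] .
  let ?w = "restrict (D [\<one>]) X"
  have one: "[\<one>] \<in> bar_basis G 0" unfolding bar_basis_0 by auto
  have w: "?w \<in> S" using D(1) one unfolding equivariant_cochain_def by blast
  have Dg: "D [g] x = ?w (\<phi> (inv g) x)" if "g \<in> carrier G" "x \<in> X" for g x
  proof -
    have "D (map (\<lambda>h. g \<otimes> h) [\<one>]) x = D [\<one>] (\<phi> (inv g) x)"
      using D(1) one that unfolding equivariant_cochain_def by blast
    thus ?thesis using that phi_closed by simp
  qed
  have "F = linear_extension G (Suc 0) X (codifferential 0 D)"
    unfolding F0(2) D(2) by (rule coboundary_linear_extension[OF finite_carrier])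
  also have "\<dots> = principal ?w"
    unfolding principal_def One_nat_def[symmetric]
  proof (rule linear_extension_cong)
    fix xs x assume xs: "xs \<in> bar_basis G 1" and x: "x \<in> X"
    obtain g h where gh: "g \<in> carrier G" "h \<in> carrier G" "xs = [g, h]" using xs unfolding bar_basis_1 by blast
    thus "codifferential 0 D xs x = difference ?w xs x"
      using Dg[OF _ x] by (simp add: codifferential_def omit_nth_def difference_def)
  qed
  finally show "F \<in> principal ` S" using w by blast
next
  fix F assume "F \<in> principal ` S"
  then obtain w where w: "w \<in> S" "F = principal w" by blast
  define D where "D xs x = w (\<phi> (inv (xs ! 0)) x)" for xs x
  have "equivariant_cochain 0 D"
    unfolding equivariant_cochain_def
  proof (intro conjI ballI)
    fix xs assume "xs \<in> bar_basis G 0"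
    then obtain g where g: "g \<in> carrier G" "xs = [g]" unfolding bar_basis_0 by blast
    have "restrict (D xs) X = (\<lambda>x\<in>X. w (\<phi> (inv g) x))" using g by (auto simp: D_def)
    thus "restrict (D xs) X \<in> S" using S_act[OF g(1) w(1)] by (simp only:)
    fix a x assume a: "a \<in> carrier G" "x \<in> X"
    thus "D (map (\<lambda>h. a \<otimes> h) xs) x = D xs (\<phi> (inv a) x)"
      using g by (simp add: D_def inv_mult_group phi_mult)
  qed
  hence "linear_extension G 0 X D \<in> carrier (cochains G N 0)" by (rule linear_extension_cochain)
  moreover have "coboundary G 0 (linear_extension G 0 X D) = F"
    unfolding w(2) principal_def coboundary_linear_extension[OF finite_carrier] One_nat_def[symmetric]
  proof (rule linear_extension_cong)
    fix xs x assume xs: "xs \<in> bar_basis G 1" and x: "x \<in> X"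
    obtain g h where gh: "g \<in> carrier G" "h \<in> carrier G" "xs = [g, h]" using xs unfolding bar_basis_1 by blast
    thus "codifferential 0 D xs x = difference w xs x"
      by (simp add: codifferential_def omit_nth_def difference_def D_def)
  qed
  ultimately show "F \<in> coboundaries G N 1" by (auto simp: coboundaries_def)
qed

lemma principal_eq_iff: "principal v = principal w \<longleftrightarrow> invariant (\<lambda>x. v x - w x)"
proof -
  have "principal v = principal w \<longleftrightarrow>
     (\<forall>g\<in>carrier G. \<forall>h\<in>carrier G. \<forall>x\<in>X. difference v [g, h] x = difference w [g, h] x)"
    unfolding principal_def linear_extension_eq_iff[OF finite_carrier] Ball_def bar_basis_1 by blast
  also have "\<dots> \<longleftrightarrow> invariant (\<lambda>x. v x - w x)"
  proof
    assume *: "\<forall>g\<in>carrier G. \<forall>h\<in>carrier G. \<forall>x\<in>X. difference v [g, h] x = difference w [g, h] x"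
    show "invariant (\<lambda>x. v x - w x)"
      unfolding invariant_def
    proof (intro ballI)
      fix g x assume "g \<in> carrier G" "x \<in> X"
      thus "v (\<phi> g x) - w (\<phi> g x) = v x - w x"
        using *[rule_format, of \<one> "inv g" x] by (simp add: difference_def phi_one algebra_simps)
    qed
  next
    assume *: "invariant (\<lambda>x. v x - w x)"
    show "\<forall>g\<in>carrier G. \<forall>h\<in>carrier G. \<forall>x\<in>X. difference v [g, h] x = difference w [g, h] x"
    proof (intro ballI)
      fix g h x assume "g \<in> carrier G" "h \<in> carrier G" "x \<in> X"
      hence "v (\<phi> (inv g) x) - w (\<phi> (inv g) x) = v x - w x" "v (\<phi> (inv h) x) - w (\<phi> (inv h) x) = v x - w x"
        using * by (auto simp: invariant_def)
      hence "v (\<phi> (inv g) x) = v x - w x + w (\<phi> (inv g) x)" "v (\<phi> (inv h) x) = v x - w x + w (\<phi> (inv h) x)"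
        by (simp_all add: diff_eq_eq)
      thus "difference v [g, h] x = difference w [g, h] x"
        by (simp add: difference_def)
    qed
  qed
  finally show ?thesis .
qed

lemma principal_add: "principal v \<oplus>\<^bsub>cochains G N 1\<^esub> principal w = principal (\<lambda>x. v x + w x)"
proof
  fix f show "(principal v \<oplus>\<^bsub>cochains G N 1\<^esub> principal w) f = principal (\<lambda>x. v x + w x) f"
    by (simp add: cochains_def hom_space_def principal_def linear_extension_def bar_module_def perm_rep_simps
        difference_def fun_eq_iff sum.distrib[symmetric] algebra_simps)
qed

lemma principal_smult: "c \<odot>\<^bsub>cochains G N 1\<^esub> principal v = principal (\<lambda>x. c * v x)"
proof
  fix f show "(c \<odot>\<^bsub>cochains G N 1\<^esub> principal v) f = principal (\<lambda>x. c * v x) f"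
    by (simp add: cochains_def hom_space_def principal_def linear_extension_def bar_module_def perm_rep_simps
        difference_def fun_eq_iff sum_distrib_left algebra_simps)
qed

lemma principal_zero: "\<zero>\<^bsub>cochains G N 1\<^esub> = principal (\<lambda>_. 0)"
  unfolding zero_cochains principal_def by (rule linear_extension_cong) (simp add: difference_def)

end

text \<open>
  Here the first cohomology of the full function space is assumed to vanish, as an equation between
  functions on \<open>X\<close>.
\<close>

locale perm_subrep_H1 = perm_subrep +
  assumes vanishing: "\<And>z. (\<And>g h x. g \<in> carrier G \<Longrightarrow> h \<in> carrier G \<Longrightarrow> x \<in> X \<Longrightarrow>
        z (g \<otimes> h) x = z g x + z h (\<phi> (inv g) x)) \<Longrightarrow>
      \<exists>v. \<forall>g\<in>carrier G. \<forall>x\<in>X. (z g x :: 'd) = v (\<phi> (inv g) x) - v x"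
begin

abbreviation Z where "Z \<equiv> cochains G N 1\<lparr>carrier := cocycles G N 1\<rparr>"

lemma cocycles_principal: "cocycles G N 1 = principal ` {v. almost_invariant v}"
  using cocycle_principal[OF vanishing] principal_cocycle by blast

lemma Z_simps:
  "carrier Z = principal ` {v. almost_invariant v}"
  "principal v \<oplus>\<^bsub>Z\<^esub> principal w = principal (\<lambda>x. v x + w x)"
  "c \<odot>\<^bsub>Z\<^esub> principal v = principal (\<lambda>x. c * v x)"
  "\<zero>\<^bsub>Z\<^esub> = principal (\<lambda>_. 0)"
  using principal_add principal_smult principal_zero by (simp_all add: cocycles_principal del: One_nat_def)

lemma vectorspace_Z: "vectorspace class_ring Z"
proof (rule vectorspace.intro[OF _ class_field])
  note ops = Z_simps(2,3,4)
  have zero: "almost_invariant (\<lambda>_. 0)" using almost_invariant_smult[of _ 0] S_almost_invariant[OF S_zero] by simp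
  show "module class_ring Z"
  proof (rule module_criteria)
    show "cring (class_ring :: 'd ring)" using class_field[where 'a = 'd] unfolding field_def domain_def by blast
    show "\<zero>\<^bsub>Z\<^esub> \<in> carrier Z" unfolding Z_simps(1,4) using zero by blast
    show "\<forall>v w. v \<in> carrier Z \<and> w \<in> carrier Z \<longrightarrow> v \<oplus>\<^bsub>Z\<^esub> w \<in> carrier Z"
      unfolding Z_simps(1) using ops(1) almost_invariant_add by fastforce
    show "\<forall>c v. c \<in> carrier class_ring \<and> v \<in> carrier Z \<longrightarrow> c \<odot>\<^bsub>Z\<^esub> v \<in> carrier Z"
      unfolding Z_simps(1) using ops(2) almost_invariant_smult by fastforce
    show "\<forall>v\<in>carrier Z. \<exists>neg_v\<in>carrier Z. v \<oplus>\<^bsub>Z\<^esub> neg_v = \<zero>\<^bsub>Z\<^esub>"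
    proof
      fix F assume "F \<in> carrier Z"
      then obtain v where v: "almost_invariant v" "F = principal v" unfolding Z_simps(1) by blast
      have "principal (\<lambda>x. (-1) * v x) \<in> carrier Z" unfolding Z_simps(1) using almost_invariant_smult[OF v(1)] by blast
      moreover have "F \<oplus>\<^bsub>Z\<^esub> principal (\<lambda>x. (-1) * v x) = \<zero>\<^bsub>Z\<^esub>" unfolding v(2) ops by simp
      ultimately show "\<exists>neg_v\<in>carrier Z. F \<oplus>\<^bsub>Z\<^esub> neg_v = \<zero>\<^bsub>Z\<^esub>" by blast
    qed
    show "\<forall>v w. v \<in> carrier Z \<and> w \<in> carrier Z \<longrightarrow> v \<oplus>\<^bsub>Z\<^esub> w = w \<oplus>\<^bsub>Z\<^esub> v"
      unfolding Z_simps(1) by (auto simp only: ops add.commute)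
    show "\<forall>v w x. v \<in> carrier Z \<and> w \<in> carrier Z \<and> x \<in> carrier Z \<longrightarrow> v \<oplus>\<^bsub>Z\<^esub> w \<oplus>\<^bsub>Z\<^esub> x = v \<oplus>\<^bsub>Z\<^esub> (w \<oplus>\<^bsub>Z\<^esub> x)"
      unfolding Z_simps(1) by (auto simp only: ops add.assoc)
    show "\<forall>v\<in>carrier Z. v \<oplus>\<^bsub>Z\<^esub> \<zero>\<^bsub>Z\<^esub> = v"
      unfolding Z_simps(1) by (auto simp only: ops add_0_right)
    show "\<forall>a b v. a \<in> carrier class_ring \<and> b \<in> carrier class_ring \<and> v \<in> carrier Z \<longrightarrow>
        (a \<otimes>\<^bsub>class_ring\<^esub> b) \<odot>\<^bsub>Z\<^esub> v = a \<odot>\<^bsub>Z\<^esub> (b \<odot>\<^bsub>Z\<^esub> v)"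
      unfolding Z_simps(1) by (auto simp only: ops mult.assoc monoid.simps)
    show "\<forall>v\<in>carrier Z. \<one>\<^bsub>class_ring\<^esub> \<odot>\<^bsub>Z\<^esub> v = v"
      unfolding Z_simps(1) by (auto simp only: ops mult_1 monoid.simps)
    show "\<forall>a b v. a \<in> carrier class_ring \<and> b \<in> carrier class_ring \<and> v \<in> carrier Z \<longrightarrow>
        (a \<oplus>\<^bsub>class_ring\<^esub> b) \<odot>\<^bsub>Z\<^esub> v = a \<odot>\<^bsub>Z\<^esub> v \<oplus>\<^bsub>Z\<^esub> b \<odot>\<^bsub>Z\<^esub> v"
      unfolding Z_simps(1) by (auto simp only: ops distrib_right ring.simps)
    show "\<forall>a v w. a \<in> carrier class_ring \<and> v \<in> carrier Z \<and> w \<in> carrier Z \<longrightarrow>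
        a \<odot>\<^bsub>Z\<^esub> (v \<oplus>\<^bsub>Z\<^esub> w) = a \<odot>\<^bsub>Z\<^esub> v \<oplus>\<^bsub>Z\<^esub> a \<odot>\<^bsub>Z\<^esub> w"
      unfolding Z_simps(1) by (auto simp only: ops distrib_left)
  qed
qed

lemma principal_restrict: "principal (restrict v X) = principal v"
  unfolding principal_def
  by (rule linear_extension_cong, unfold bar_basis_1) (auto simp: difference_def phi_closed)

sublocale H: quotient_space Z "coboundaries G N 1"
proof (rule quotient_space.intro[OF vectorspace_Z], unfold_locales)
  show "w \<in> carrier Z" if "w \<in> coboundaries G N 1" for w
    using that S_almost_invariant unfolding coboundaries_principal Z_simps(1) by blast
  show "\<zero>\<^bsub>Z\<^esub> \<in> coboundaries G N 1"
    unfolding coboundaries_principal Z_simps(4) by (rule image_eqI, rule principal_restrict[symmetric], rule S_zero)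
  show "w \<oplus>\<^bsub>Z\<^esub> w' \<in> coboundaries G N 1" if ww: "w \<in> coboundaries G N 1" "w' \<in> coboundaries G N 1" for w w'
  proof -
    obtain v v' where v: "v \<in> S" "w = principal v" "v' \<in> S" "w' = principal v'"
      using ww unfolding coboundaries_principal by blast
    show ?thesis unfolding coboundaries_principal v(2,4) Z_simps(2)
      by (rule image_eqI, rule principal_restrict[symmetric], rule S_add[OF v(1,3)])
  qed
  show "c \<odot>\<^bsub>Z\<^esub> w \<in> coboundaries G N 1" if ww: "w \<in> coboundaries G N 1" for c w
  proof -
    obtain v where v: "v \<in> S" "w = principal v"
      using ww unfolding coboundaries_principal by blast
    show ?thesis unfolding coboundaries_principal v(2) Z_simps(3)
      by (rule image_eqI, rule principal_restrict[symmetric], rule S_smult[OF v(1)])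
  qed
qed

lemma principal_coboundary_iff:
  "principal v \<in> coboundaries G N 1 \<longleftrightarrow> (\<exists>w\<in>S. invariant (\<lambda>x. v x - w x))"
  unfolding coboundaries_principal image_iff principal_eq_iff ..

theorem has_dim_H1_0:
  assumes "\<And>v. almost_invariant v \<Longrightarrow> \<exists>w\<in>S. invariant (\<lambda>x. v x - w x)"
  shows "has_dim (group_cohomology G N 1) 0"
  unfolding group_cohomology_def
proof (rule H.has_dim_quotient_0)
  show "carrier Z \<subseteq> coboundaries G N 1"
    unfolding Z_simps(1) using assms principal_coboundary_iff by blast
qed

theorem has_dim_H1_1:
  assumes e: "almost_invariant e" "\<not> (\<exists>w\<in>S. invariant (\<lambda>x. e x - w x))"
    and "\<And>v. almost_invariant v \<Longrightarrow> \<exists>c. \<exists>w\<in>S. invariant (\<lambda>x. v x - c * e x - w x)"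
  shows "has_dim (group_cohomology G N 1) 1"
  unfolding group_cohomology_def
proof (rule H.has_dim_quotient_1)
  show "principal e \<in> carrier Z" unfolding Z_simps(1) using e(1) by blast
  show "principal e \<notin> coboundaries G N 1" using e(2) principal_coboundary_iff by blast
  fix F assume "F \<in> carrier Z"
  then obtain v where v: "almost_invariant v" "F = principal v" unfolding Z_simps(1) by blast
  then obtain c where c: "\<exists>w\<in>S. invariant (\<lambda>x. v x - c * e x - w x)" using assms(3) by blast
  have ce: "principal (\<lambda>x. c * e x) \<in> carrier Z" "principal (\<lambda>x. (-1) * (c * e x)) \<in> carrier Z"
    unfolding Z_simps(1) using almost_invariant_smult e(1) by blast+
  have "\<ominus>\<^bsub>Z\<^esub> principal (\<lambda>x. c * e x) = principal (\<lambda>x. (-1) * (c * e x))"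
    using ce by (intro H.V.minus_equality) (simp_all only: Z_simps, simp)
  hence "F \<ominus>\<^bsub>Z\<^esub> c \<odot>\<^bsub>Z\<^esub> principal e = principal (\<lambda>x. v x - c * e x)"
    unfolding v(2) a_minus_def Z_simps(3) by (simp only: Z_simps(2)) simp
  thus "\<exists>c. F \<ominus>\<^bsub>Z\<^esub> c \<odot>\<^bsub>Z\<^esub> principal e \<in> coboundaries G N 1"
    using c principal_coboundary_iff[of "\<lambda>x. v x - c * e x"] by (intro exI[of _ c]) (simp only:)
qed

end

section \<open>Cocycles on a transitive permutation module\<close>

text \<open>
  Shapiro's lemma in degree one. Evaluation at \<open>x0\<close> restricts a cocycle to an additive character of
  the stabilizer of \<open>x0\<close>. If this is zero, then \<open>z g x0\<close> depends only on the point that \<open>g\<close> moves to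
  \<open>x0\<close>, and as a function of that point it is the required \<open>v\<close>.
\<close>

lemma (in group) transitive_cocycle_is_principal:
  fixes \<phi> :: "'a \<Rightarrow> 'x \<Rightarrow> 'x" and z :: "'a \<Rightarrow> 'x \<Rightarrow> 'k::field"
  assumes closed: "\<And>g x. g \<in> carrier G \<Longrightarrow> x \<in> X \<Longrightarrow> \<phi> g x \<in> X"
    and one: "\<And>x. x \<in> X \<Longrightarrow> \<phi> \<one> x = x"
    and mult: "\<And>g h x. g \<in> carrier G \<Longrightarrow> h \<in> carrier G \<Longrightarrow> x \<in> X \<Longrightarrow> \<phi> (g \<otimes> h) x = \<phi> g (\<phi> h x)"
    and x0: "x0 \<in> X" "\<And>x. x \<in> X \<Longrightarrow> \<exists>g\<in>carrier G. \<phi> g x = x0"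
    and stabilizer: "\<And>\<chi> :: 'a \<Rightarrow> 'k. (\<And>g h. g \<in> carrier G \<Longrightarrow> h \<in> carrier G \<Longrightarrow> \<phi> g x0 = x0 \<Longrightarrow> \<phi> h x0 = x0 \<Longrightarrow>
        \<chi> (g \<otimes> h) = \<chi> g + \<chi> h) \<Longrightarrow> (\<And>g. g \<in> carrier G \<Longrightarrow> \<phi> g x0 = x0 \<Longrightarrow> \<chi> g = 0)"
    and z: "\<And>g h x. g \<in> carrier G \<Longrightarrow> h \<in> carrier G \<Longrightarrow> x \<in> X \<Longrightarrow> z (g \<otimes> h) x = z g x + z h (\<phi> (inv g) x)"
  shows "\<exists>v. \<forall>g\<in>carrier G. \<forall>x\<in>X. z g x = v (\<phi> (inv g) x) - v x"
proof -
  have inv_fix: "\<phi> (inv g) x0 = x" if "g \<in> carrier G" "x \<in> X" "\<phi> g x = x0" for g x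
  proof -
    have "\<phi> (inv g) (\<phi> g x) = \<phi> (inv g \<otimes> g) x" using that by (intro mult[symmetric]) auto
    thus ?thesis using that one by simp
  qed
  have stab0: "z h x0 = 0" if h: "h \<in> carrier G" "\<phi> h x0 = x0" for h
  proof (rule stabilizer[of "\<lambda>h. z h x0"])
    fix g h assume gh: "g \<in> carrier G" "h \<in> carrier G" "\<phi> g x0 = x0" "\<phi> h x0 = x0"
    show "z (g \<otimes> h) x0 = z g x0 + z h x0"
      using z[OF gh(1,2) x0(1)] inv_fix[OF gh(1) x0(1) gh(3)] by simp
  qed (use h in auto)
  define r where "r x = (SOME g. g \<in> carrier G \<and> \<phi> g x = x0)" for x
  have r: "r x \<in> carrier G" "\<phi> (r x) x = x0" if "x \<in> X" for x
    using someI_ex[of "\<lambda>g. g \<in> carrier G \<and> \<phi> g x = x0"] x0(2)[OF that] unfolding r_def by blast+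
  have indep: "z g x0 = z (r x) x0" if g: "g \<in> carrier G" "x \<in> X" "\<phi> g x = x0" for g x
  proof -
    \<comment> \<open>two group elements that move \<open>x\<close> to \<open>x0\<close> differ by this element of the stabilizer\<close>
    let ?h = "g \<otimes> inv (r x)"
    have h: "?h \<in> carrier G" using g r by auto
    have "\<phi> ?h x0 = \<phi> g (\<phi> (inv (r x)) x0)" using g r x0 by (intro mult) auto
    also have "\<dots> = x0" using inv_fix[OF r(1)[OF g(2)] g(2) r(2)[OF g(2)]] g(3) by simp
    finally have hx: "\<phi> ?h x0 = x0" .
    have "g = ?h \<otimes> r x" using g r by (simp add: m_assoc)
    hence "z g x0 = z ?h x0 + z (r x) (\<phi> (inv ?h) x0)" using z[OF h r(1)[OF g(2)] x0(1)] by simp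
    thus ?thesis using stab0[OF h hx] inv_fix[OF h x0(1) hx] by simp
  qed
  show ?thesis
  proof (intro exI[of _ "\<lambda>x. z (r x) x0"] ballI)
    fix g x assume g: "g \<in> carrier G" and x: "x \<in> X"
    have y: "\<phi> (inv g) x \<in> X" using g x closed by auto
    have "\<phi> (r x \<otimes> g) (\<phi> (inv g) x) = \<phi> (r x) (\<phi> g (\<phi> (inv g) x))" using g r(1)[OF x] y by (intro mult) auto
    also have "\<phi> g (\<phi> (inv g) x) = \<phi> (g \<otimes> inv g) x" using g x by (intro mult[symmetric]) auto
    also have "\<dots> = x" using g x one by simp
    finally have "\<phi> (r x \<otimes> g) (\<phi> (inv g) x) = x0" using r(2)[OF x] by simp
    hence "z (r (\<phi> (inv g) x)) x0 = z (r x \<otimes> g) x0"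
      using g r(1)[OF x] y by (intro indep[symmetric]) auto
    also have "\<dots> = z (r x) x0 + z g (\<phi> (inv (r x)) x0)" using g r(1)[OF x] x0(1) by (intro z)
    also have "\<phi> (inv (r x)) x0 = x" using inv_fix[OF r(1)[OF x] x r(2)[OF x]] .
    finally show "z g x = z (r (\<phi> (inv g) x)) x0 - z (r x) x0" by simp
  qed
qed

text \<open>
  Transpositions generate the permutations of \<open>A\<close>, and a character doubles to zero on each of them.
\<close>

lemma additive_character_permutes:
  fixes \<chi> :: "('a \<Rightarrow> 'a) \<Rightarrow> 'k::field"
  assumes "finite A" "(2::'k) \<noteq> 0"
    and add: "\<And>g h. g permutes A \<Longrightarrow> h permutes A \<Longrightarrow> \<chi> (g \<circ> h) = \<chi> g + \<chi> h"
    and "\<pi> permutes A"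
  shows "\<chi> \<pi> = 0"
proof -
  have "\<chi> id = \<chi> id + \<chi> id" using add[OF permutes_id permutes_id] unfolding id_o .
  hence id: "\<chi> id = 0" by (simp only: add_cancel_right_right)
  have tr: "\<chi> (transpose x y) = 0" if "x \<in> A" "y \<in> A" for x y
  proof -
    have t: "transpose x y permutes A" using that by (rule permutes_swap_id)
    have "\<chi> (transpose x y) + \<chi> (transpose x y) = 0"
      using add[OF t t] id by (simp only: transpose_comp_involutory)
    hence "2 * \<chi> (transpose x y) = 0" by (simp only: mult_2)
    thus ?thesis using assms(2) by simp
  qed
  show ?thesis using assms(4,1)
  proof (induction rule: permutes_induct)
    case (swap x y \<pi>)
    have "\<chi> (transpose x y \<circ> \<pi>) = \<chi> (transpose x y) + \<chi> \<pi>"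
      using swap by (intro add permutes_swap_id)
    also have "\<dots> = 0" using swap tr by simp
    finally show ?case .
  qed (rule id)
qed

lemma permutes_split:
  assumes "\<pi> permutes V" "B \<subseteq> V" "\<pi> ` B = B"
  obtains \<sigma> \<tau> where "\<sigma> permutes B" "\<tau> permutes V - B" "\<pi> = \<sigma> \<circ> \<tau>"
proof
  define \<sigma> where "\<sigma> x = (if x \<in> B then \<pi> x else x)" for x
  define \<tau> where "\<tau> x = (if x \<in> V - B then \<pi> x else x)" for x
  have inj: "inj_on \<pi> C" for C using permutes_inj_on[OF assms(1)] .
  have im: "\<pi> ` (V - B) = V - B"
    using image_set_diff[OF permutes_inj[OF assms(1)], of V B] permutes_image[OF assms(1)] assms(3) by simp
  have "bij_betw \<sigma> B B" "bij_betw \<tau> (V - B) (V - B)"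
    using inj im assms(3) by (auto simp: bij_betw_def \<sigma>_def \<tau>_def inj_on_def)
  note bij = this
  show "\<sigma> permutes B" by (rule bij_imp_permutes[OF bij(1)]) (simp add: \<sigma>_def)
  show "\<tau> permutes V - B" by (rule bij_imp_permutes[OF bij(2)]) (auto simp: \<tau>_def)
  show "\<pi> = \<sigma> \<circ> \<tau>"
  proof
    fix x
    have "\<pi> x \<in> V - B" if "x \<in> V - B" using im that by blast
    thus "\<pi> x = (\<sigma> \<circ> \<tau>) x"
      using permutes_not_in[OF assms(1), of x] assms(2) by (auto simp: \<sigma>_def \<tau>_def)
  qed
qed

section \<open>Sums over subsets of a given size\<close>

definition subset_sum :: "'a set \<Rightarrow> nat \<Rightarrow> ('a set \<Rightarrow> 'k::comm_ring_1) \<Rightarrow> 'k"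
  where "subset_sum W s g = (\<Sum>T | T \<subseteq> W \<and> card T = s. g T)"

lemma subset_sum_cong:
  assumes "W = W'" "s = s'" "\<And>T. T \<subseteq> W \<Longrightarrow> card T = s \<Longrightarrow> g T = h T"
  shows "subset_sum W s g = subset_sum W' s' h"
  unfolding subset_sum_def using assms by (intro sum.cong) auto

lemma subset_sum_add: "subset_sum W s (\<lambda>T. g T + h T) = subset_sum W s g + subset_sum W s h"
  by (simp add: subset_sum_def sum.distrib)

lemma subset_sum_diff: "subset_sum W s (\<lambda>T. g T - h T) = subset_sum W s g - subset_sum W s h"
  by (simp add: subset_sum_def sum_subtractf)

lemma subset_sum_mult: "subset_sum W s (\<lambda>T. c * g T) = c * subset_sum W s g"
  by (simp add: subset_sum_def sum_distrib_left)

lemma subset_sum_0 [simp]: "finite W \<Longrightarrow> subset_sum W 0 g = g {}"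
proof -
  assume "finite W"
  hence "{T. T \<subseteq> W \<and> card T = 0} = {{}}" by (auto simp: finite_subset)
  thus ?thesis by (simp add: subset_sum_def)
qed

lemma subset_sum_top: "finite W \<Longrightarrow> s = card W \<Longrightarrow> subset_sum W s g = g W"
proof -
  assume "finite W" "s = card W"
  hence "{T. T \<subseteq> W \<and> card T = s} = {W}" by (auto dest: card_subset_eq)
  thus ?thesis by (simp add: subset_sum_def)
qed

lemma subset_sum_const: "finite W \<Longrightarrow> subset_sum W s (\<lambda>_. c) = of_nat (card W choose s) * c"
  by (simp add: subset_sum_def n_subsets)

text \<open>
  Subsets are split by membership of \<open>v\<close>. All inductions on the ground set below rest on this.
\<close>

lemma subset_sum_insert:
  assumes "finite W" "v \<notin> W"
  shows "subset_sum (insert v W) (Suc s) g =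
    subset_sum W (Suc s) g + subset_sum W s (\<lambda>T. g (insert v T))"
proof -
  have eq: "{T. T \<subseteq> insert v W \<and> card T = Suc s} =
      {T. T \<subseteq> W \<and> card T = Suc s} \<union> insert v ` {T. T \<subseteq> W \<and> card T = s}" (is "?L = ?A \<union> ?B")
  proof (intro equalityI subsetI)
    fix T assume T: "T \<in> ?L"
    show "T \<in> ?A \<union> ?B"
    proof (cases "v \<in> T")
      case True
      hence "T = insert v (T - {v})" "T - {v} \<subseteq> W" "card (T - {v}) = s" using T by auto
      thus ?thesis by blast
    qed (use T in auto)
  next
    fix T assume "T \<in> ?A \<union> ?B"
    thus "T \<in> ?L" using assms by (auto simp: card_insert_if finite_subset)
  qed
  have inj: "inj_on (insert v) {T. T \<subseteq> W \<and> card T = s}"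
    using assms(2) by (auto simp: inj_on_def insert_ident)
  have fin: "finite ?A" "finite ?B" using assms(1) by auto
  have "?A \<inter> ?B = {}" using assms(2) by auto
  thus ?thesis unfolding subset_sum_def eq
    by (subst sum.union_disjoint[OF fin]) (simp_all add: sum.reindex[OF inj])
qed

lemma sum_Pow_insert:
  assumes "finite I" "u \<notin> I"
  shows "(\<Sum>K\<in>Pow (insert u I). h K) = (\<Sum>K\<in>Pow I. h K + h (insert u K))"
proof -
  have inj: "inj_on (insert u) (Pow I)" using assms(2) by (auto simp: inj_on_def insert_ident)
  have "Pow I \<inter> insert u ` Pow I = {}" using assms(2) by auto
  thus ?thesis unfolding Pow_insert using assms(1)
    by (subst sum.union_disjoint) (auto simp: sum.reindex[OF inj] sum.distrib)
qed

text \<open>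
  Inclusion and exclusion: the sets that avoid \<open>I\<close> are counted through the sets that contain given
  parts of \<open>I\<close>.
\<close>

lemma subset_sum_avoiding:
  fixes g :: "'a set \<Rightarrow> 'k::comm_ring_1"
  assumes "finite I" "I \<subseteq> V" "finite V" "card I \<le> m"
  shows "subset_sum (V - I) m g =
    (\<Sum>K\<in>Pow I. (-1) ^ card K * subset_sum (V - K) (m - card K) (\<lambda>T. g (K \<union> T)))"
  using assms
proof (induction I arbitrary: V g m rule: finite_induct)
  case (insert u I)
  then obtain m' where m: "m = Suc m'" "card I \<le> m'" by (cases m) auto
  have split: "subset_sum (V - K) (m - card K) (\<lambda>T. g (K \<union> T))
      = subset_sum (V - {u} - K) (m - card K) (\<lambda>T. g (K \<union> T))
        + subset_sum (V - {u} - K) (m' - card K) (\<lambda>T. g (insert u (K \<union> T)))"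
    if "K \<in> Pow I" for K
  proof -
    have "card K \<le> m'" using that m(2) insert.hyps(1) by (meson PowD card_mono le_trans)
    hence "m - card K = Suc (m' - card K)" using m by simp
    moreover have "V - K = insert u (V - {u} - K)" using that insert.hyps insert.prems by auto
    ultimately show ?thesis using insert.prems(2) subset_sum_insert[of "V - {u} - K" u "m' - card K" "\<lambda>T. g (K \<union> T)"]
      by simp
  qed
  have "subset_sum (V - {u} - I) m g + subset_sum (V - {u} - I) m' (\<lambda>T. g (insert u T)) = subset_sum (V - I) m g"
  proof -
    have "V - I = insert u (V - {u} - I)" using insert.hyps insert.prems by auto
    thus ?thesis using insert.prems(2) subset_sum_insert[of "V - {u} - I" u m' g] m by simp
  qed
  also have "\<dots> = (\<Sum>K\<in>Pow I. (-1) ^ card K * subset_sum (V - K) (m - card K) (\<lambda>T. g (K \<union> T)))"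
    using insert.IH[of V m g] insert.prems m by simp
  finally have "subset_sum (V - insert u I) m g =
     (\<Sum>K\<in>Pow I. (-1) ^ card K * subset_sum (V - K) (m - card K) (\<lambda>T. g (K \<union> T)))
     - subset_sum (V - {u} - I) m' (\<lambda>T. g (insert u T))"
    by (simp add: Diff_insert2[of V u I] algebra_simps)
  also have "subset_sum (V - {u} - I) m' (\<lambda>T. g (insert u T)) =
     (\<Sum>K\<in>Pow I. (-1) ^ card K * subset_sum (V - {u} - K) (m' - card K) (\<lambda>T. g (insert u (K \<union> T))))"
    using insert.IH[of "V - {u}" m' "\<lambda>T. g (insert u T)"] insert.prems insert.hyps m by auto
  also have "(\<Sum>K\<in>Pow I. (-1) ^ card K * subset_sum (V - K) (m - card K) (\<lambda>T. g (K \<union> T))) - \<dots>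
     = (\<Sum>K\<in>Pow (insert u I). (-1) ^ card K * subset_sum (V - K) (m - card K) (\<lambda>T. g (K \<union> T)))"
    unfolding sum_Pow_insert[OF insert.hyps(1,2)] sum_subtractf[symmetric]
  proof (rule sum.cong[OF refl])
    fix K assume K: "K \<in> Pow I"
    hence "finite K" "u \<notin> K" using insert.hyps by (auto simp: finite_subset)
    hence c: "card (insert u K) = Suc (card K)" by simp
    have d: "V - insert u K = V - {u} - K" "m - Suc (card K) = m' - card K" using m by auto
    show "(- 1) ^ card K * subset_sum (V - K) (m - card K) (\<lambda>T. g (K \<union> T)) -
         (- 1) ^ card K * subset_sum (V - {u} - K) (m' - card K) (\<lambda>T. g (insert u (K \<union> T))) =
         (- 1) ^ card K * subset_sum (V - K) (m - card K) (\<lambda>T. g (K \<union> T)) +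
         (- 1) ^ card (insert u K) * subset_sum (V - insert u K) (m - card (insert u K)) (\<lambda>T. g (insert u K \<union> T))"
      unfolding c d by simp
  qed
  finally show ?case .
qed simp

lemma alternating_binomial_convolution:
  assumes "b \<le> m"
  shows "(\<Sum>t\<le>s. (-1) ^ t * of_nat (b choose t) * of_nat ((m - t) choose (s - t)))
    = (of_nat ((m - b) choose s) :: 'k::comm_ring_1)"
  using assms
proof (induction b arbitrary: m s)
  case 0
  have "(\<Sum>t\<le>s. (-1) ^ t * of_nat (0 choose t) * of_nat ((m - t) choose (s - t)))
     = (\<Sum>t\<in>{0}. (-1) ^ t * of_nat (0 choose t) * of_nat ((m - t) choose (s - t)) :: 'k)"
    by (rule sum.mono_neutral_right) (auto simp: binomial_eq_0)
  thus ?case by simp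
next
  case (Suc b)
  then obtain m' where m: "m = Suc m'" "b \<le> m'" by (cases m) auto
  show ?case
  proof (cases s)
    case (Suc s')
    have "(\<Sum>t\<le>s. (-1) ^ t * of_nat (Suc b choose t) * of_nat ((m - t) choose (s - t)) :: 'k)
      = of_nat (m choose s) + (\<Sum>t\<le>s'. (-1) ^ Suc t * of_nat (Suc b choose Suc t) * of_nat ((m' - t) choose (s' - t)))"
      unfolding Suc sum.atMost_Suc_shift m by simp
    also have "(\<Sum>t\<le>s'. (-1) ^ Suc t * of_nat (Suc b choose Suc t) * of_nat ((m' - t) choose (s' - t)) :: 'k)
      = (\<Sum>t\<le>s'. (-1) ^ Suc t * of_nat (b choose Suc t) * of_nat ((m' - t) choose (s' - t)))
       - (\<Sum>t\<le>s'. (-1) ^ t * of_nat (b choose t) * of_nat ((m' - t) choose (s' - t)))"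
      unfolding sum_subtractf[symmetric] by (intro sum.cong refl) (simp add: algebra_simps)
    also have "(of_nat (m choose s) :: 'k) + \<dots> =
      (\<Sum>t\<le>s. (-1) ^ t * of_nat (b choose t) * of_nat ((m - t) choose (s - t)))
       - (\<Sum>t\<le>s'. (-1) ^ t * of_nat (b choose t) * of_nat ((m' - t) choose (s' - t)))"
      unfolding Suc sum.atMost_Suc_shift m by simp
    also have "\<dots> = of_nat ((m - b) choose s) - of_nat ((m' - b) choose s')"
      using Suc.IH[of m s] Suc.IH[of m' s'] m by simp
    also have "\<dots> = of_nat ((m - Suc b) choose s)"
      using m Suc by (simp add: Suc_diff_le)
    finally show ?thesis .
  qed simp
qed

section \<open>Signed designs and their consistency conditions\<close>

text \<open>
  The values \<open>x I\<close> for \<open>card I < b\<close> are meant to be sums of one function over the \<open>b\<close>-sets that contain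
  \<open>I\<close>. Summing over the sets between \<open>I\<close> and the \<open>b\<close>-sets counts each \<open>b\<close>-set with a binomial
  multiplicity, and this gives the condition.
\<close>

definition consistent :: "'a set \<Rightarrow> nat \<Rightarrow> ('a set \<Rightarrow> 'k::comm_ring_1) \<Rightarrow> bool"
  where "consistent V b x \<longleftrightarrow> (\<forall>I s. I \<subseteq> V \<longrightarrow> card I + s < b \<longrightarrow>
    subset_sum (V - I) s (\<lambda>T. x (I \<union> T)) = of_nat ((b - card I) choose s) * x I)"

text \<open>
  The function \<open>f\<close> on \<open>b\<close>-subsets of \<open>V\<close> has the prescribed covering sums \<open>x\<close>. For \<open>x = 0\<close> these are
  the functions in the kernel of all maps from \<open>b\<close>-subsets to smaller subsets.
\<close>

definition design :: "'a set \<Rightarrow> nat \<Rightarrow> ('a set \<Rightarrow> 'k::comm_ring_1) \<Rightarrow> ('a set \<Rightarrow> 'k) \<Rightarrow> bool"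
  where "design V b x f \<longleftrightarrow> (\<forall>I. I \<subseteq> V \<longrightarrow> card I < b \<longrightarrow>
    subset_sum (V - I) (b - card I) (\<lambda>T. f (I \<union> T)) = x I)"

text \<open>
  If \<open>x\<close> is the family of covering sums of a function, this is its sum over the \<open>b\<close>-sets that contain \<open>J\<close>
  and avoid \<open>K\<close>, by inclusion and exclusion; it makes sense as soon as \<open>J \<union> K\<close> has fewer than \<open>b\<close>
  elements.
\<close>

definition avoid_sum :: "('a set \<Rightarrow> 'k::comm_ring_1) \<Rightarrow> 'a set \<Rightarrow> 'a set \<Rightarrow> 'k"
  where "avoid_sum x J K = (\<Sum>I\<in>Pow K. (-1) ^ card I * x (J \<union> I))"

lemma avoid_sum_insert:
  assumes "finite K" "u \<notin> K"
  shows "avoid_sum x J (insert u K) = avoid_sum x J K - avoid_sum x (insert u J) K"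
  unfolding avoid_sum_def sum_Pow_insert[OF assms] sum_subtractf[symmetric]
proof (rule sum.cong[OF refl])
  fix L assume "L \<in> Pow K"
  hence "finite L" "u \<notin> L" using assms by (auto simp: finite_subset)
  thus "(-1) ^ card L * x (J \<union> L) + (-1) ^ card (insert u L) * x (J \<union> insert u L) =
         (-1) ^ card L * x (J \<union> L) - (-1) ^ card L * x (insert u J \<union> L)" by simp
qed

lemma avoid_sum_Un:
  assumes "finite U" "finite K" "U \<inter> K = {}"
  shows "avoid_sum x J (K \<union> U) = (\<Sum>T\<in>Pow U. (-1) ^ card T * avoid_sum x (J \<union> T) K)"
  using assms(1,3)
proof (induction U arbitrary: J rule: finite_induct)
  case (insert u U)
  have "avoid_sum x J (K \<union> insert u U) = avoid_sum x J (K \<union> U) - avoid_sum x (insert u J) (K \<union> U)"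
    using avoid_sum_insert[of "K \<union> U" u x J] insert assms(2) by simp
  also have "\<dots> = (\<Sum>T\<in>Pow (insert u U). (-1) ^ card T * avoid_sum x (J \<union> T) K)"
  proof -
    have "(-1) ^ card T * avoid_sum x (J \<union> T) K + (-1) ^ card (insert u T) * avoid_sum x (J \<union> insert u T) K
       = (-1) ^ card T * avoid_sum x (J \<union> T) K - (-1) ^ card T * avoid_sum x (insert u J \<union> T) K"
      if "T \<in> Pow U" for T
    proof -
      have "finite T" "u \<notin> T" using that insert.hyps finite_subset by blast+
      thus ?thesis by simp
    qed
    thus ?thesis using insert.IH[of J] insert.IH[of "insert u J"] insert.prems
      unfolding sum_Pow_insert[OF insert.hyps(1,2)] by (simp add: sum_subtractf)
  qed
  finally show ?case .
qed simp

text \<open>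
  The consistency condition passes from sets that contain \<open>J\<close> to sets that contain \<open>J\<close> and avoid \<open>K\<close>,
  by induction on \<open>K\<close> with Pascal's rule.
\<close>

lemma avoid_sum_consistent:
  fixes x :: "'a set \<Rightarrow> 'k::comm_ring_1"
  assumes "finite V" "consistent V b x" "finite K"
    and "J \<union> K \<subseteq> V" "J \<inter> K = {}" "card J + card K + s < b"
  shows "subset_sum (V - J - K) s (\<lambda>T. avoid_sum x (J \<union> T) K) =
    of_nat ((b - card J) choose s) * avoid_sum x J K"
  using assms(3-)
proof (induction K arbitrary: J s rule: finite_induct)
  case empty
  thus ?case using assms(2) by (simp add: avoid_sum_def consistent_def)
next
  case (insert u K)
  have fJ: "finite J" "u \<notin> J" using insert.prems assms(1) by (auto intro: finite_subset)
  define W where "W = V - J - insert u K"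
  have W: "finite W" "u \<notin> W" "V - J - K = insert u W" "V - insert u J - K = W"
    using assms(1) insert by (auto simp: W_def)
  have "subset_sum W s (\<lambda>T. avoid_sum x (J \<union> T) (insert u K))
    = subset_sum W s (\<lambda>T. avoid_sum x (J \<union> T) K) - subset_sum W s (\<lambda>T. avoid_sum x (insert u J \<union> T) K)"
    unfolding subset_sum_diff[symmetric] by (simp add: avoid_sum_insert[OF insert.hyps(1,2)])
  moreover have "subset_sum W s (\<lambda>T. avoid_sum x (insert u J \<union> T) K)
     = of_nat ((b - Suc (card J)) choose s) * avoid_sum x (insert u J) K"
    using insert.IH[of "insert u J" s] insert.prems insert.hyps fJ W by auto
  moreover have "subset_sum W s (\<lambda>T. avoid_sum x (J \<union> T) K)
     = of_nat ((b - card J) choose s) * avoid_sum x J K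
      - (of_nat ((b - card J) choose s) - of_nat ((b - Suc (card J)) choose s)) * avoid_sum x (insert u J) K"
  proof (cases s)
    case 0
    thus ?thesis using W by simp
  next
    case (Suc s')
    have "subset_sum (insert u W) s (\<lambda>T. avoid_sum x (J \<union> T) K)
      = subset_sum W s (\<lambda>T. avoid_sum x (J \<union> T) K) + subset_sum W s' (\<lambda>T. avoid_sum x (insert u J \<union> T) K)"
      using subset_sum_insert[OF W(1,2), of s' "\<lambda>T. avoid_sum x (J \<union> T) K"] Suc by simp
    moreover have "subset_sum (insert u W) s (\<lambda>T. avoid_sum x (J \<union> T) K)
       = of_nat ((b - card J) choose s) * avoid_sum x J K"
      using insert.IH[of J s] insert.prems insert.hyps W by auto
    moreover have "subset_sum W s' (\<lambda>T. avoid_sum x (insert u J \<union> T) K)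
       = of_nat ((b - Suc (card J)) choose s') * avoid_sum x (insert u J) K"
      using insert.IH[of "insert u J" s'] insert.prems insert.hyps fJ W Suc by auto
    moreover have "(b - card J) choose s = ((b - Suc (card J)) choose s') + ((b - Suc (card J)) choose s)"
    proof -
      have "b - card J = Suc (b - Suc (card J))" using insert.prems by simp
      thus ?thesis using Suc by (metis binomial_Suc_Suc)
    qed
    ultimately show ?thesis by (simp add: algebra_simps)
  qed
  ultimately have "subset_sum W s (\<lambda>T. avoid_sum x (J \<union> T) (insert u K))
     = of_nat ((b - card J) choose s) * (avoid_sum x J K - avoid_sum x (insert u J) K)"
    by (simp add: algebra_simps)
  thus ?case using W_def by (simp add: avoid_sum_insert[OF insert.hyps(1,2)])
qed

lemma subset_sum_subset_sum:
  fixes h :: "'a set \<Rightarrow> 'k::comm_ring_1"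
  assumes "finite W"
  shows "subset_sum W s (\<lambda>U. \<Sum>T\<in>Pow U. h T)
    = (\<Sum>t\<le>s. of_nat ((card W - t) choose (s - t)) * subset_sum W t h)"
proof -
  let ?U = "{U. U \<subseteq> W \<and> card U = s}"
  have fin: "finite ?U" using assms by auto
  have "subset_sum W s (\<lambda>U. \<Sum>T\<in>Pow U. h T) = (\<Sum>U\<in>?U. \<Sum>T\<in>Pow W. if T \<subseteq> U then h T else 0)"
    unfolding subset_sum_def
  proof (rule sum.cong[OF refl])
    fix U assume "U \<in> ?U"
    hence "Pow W \<inter> {T. T \<subseteq> U} = Pow U" by auto
    thus "(\<Sum>T\<in>Pow U. h T) = (\<Sum>T\<in>Pow W. if T \<subseteq> U then h T else 0)"
      using assms by (simp add: sum.If_cases)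
  qed
  also have "\<dots> = (\<Sum>T\<in>Pow W. \<Sum>U\<in>?U. if T \<subseteq> U then h T else 0)" by (rule sum.swap)
  also have "\<dots> = (\<Sum>T\<in>Pow W. if card T \<le> s then of_nat ((card W - card T) choose (s - card T)) * h T else 0)"
  proof (rule sum.cong[OF refl])
    fix T assume T: "T \<in> Pow W"
    hence fT: "finite T" using assms finite_subset by auto
    have "(\<Sum>U\<in>?U. if T \<subseteq> U then h T else 0) = of_nat (card {U \<in> ?U. T \<subseteq> U}) * h T"
      using fin by (simp add: sum.If_cases Int_def)
    also have "\<dots> = (if card T \<le> s then of_nat ((card W - card T) choose (s - card T)) * h T else 0)"
    proof (cases "card T \<le> s")
      case True
      have "bij_betw (\<lambda>A. T \<union> A) {A. A \<subseteq> W - T \<and> card A = s - card T} {U \<in> ?U. T \<subseteq> U}"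
      proof (rule bij_betwI[where g = "\<lambda>U. U - T"])
        show "(\<lambda>A. T \<union> A) \<in> {A. A \<subseteq> W - T \<and> card A = s - card T} \<rightarrow> {U \<in> ?U. T \<subseteq> U}"
        proof
          fix A assume A: "A \<in> {A. A \<subseteq> W - T \<and> card A = s - card T}"
          hence "finite A" "T \<inter> A = {}" using assms finite_subset by blast+
          thus "T \<union> A \<in> {U \<in> ?U. T \<subseteq> U}" using A T fT True by (auto simp: card_Un_disjoint)
        qed
        show "(\<lambda>U. U - T) \<in> {U \<in> ?U. T \<subseteq> U} \<rightarrow> {A. A \<subseteq> W - T \<and> card A = s - card T}"
          using fT by (auto simp: card_Diff_subset)
      qed auto
      hence "card {U \<in> ?U. T \<subseteq> U} = card {A. A \<subseteq> W - T \<and> card A = s - card T}"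
        by (rule bij_betw_same_card[symmetric])
      also have "\<dots> = (card W - card T) choose (s - card T)"
        using assms T fT by (simp add: n_subsets card_Diff_subset)
      finally show ?thesis using True by simp
    next
      case False
      hence "{U \<in> ?U. T \<subseteq> U} = {}" using assms by (auto dest: card_mono finite_subset)
      thus ?thesis using False by (simp only:) simp
    qed
    finally show "(\<Sum>U\<in>?U. if T \<subseteq> U then h T else 0) =
       (if card T \<le> s then of_nat ((card W - card T) choose (s - card T)) * h T else 0)" .
  qed
  also have "\<dots> = (\<Sum>T\<in>Pow W. \<Sum>t\<le>s. if card T = t then of_nat ((card W - t) choose (s - t)) * h T else 0)"
    by (intro sum.cong refl) (simp add: sum.delta)
  also have "\<dots> = (\<Sum>t\<le>s. \<Sum>T\<in>Pow W. if card T = t then of_nat ((card W - t) choose (s - t)) * h T else 0)"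
    by (rule sum.swap)
  also have "\<dots> = (\<Sum>t\<le>s. of_nat ((card W - t) choose (s - t)) * subset_sum W t h)"
    using assms by (intro sum.cong refl)
      (simp add: sum.If_cases subset_sum_def sum_distrib_left Int_def Pow_def)
  finally show ?thesis .
qed

lemma subset_sum_complement:
  assumes "finite W" "s + r = card W"
  shows "subset_sum W s g = subset_sum W r (\<lambda>T. g (W - T))"
  unfolding subset_sum_def
proof (rule sum.reindex_bij_betw[symmetric, where h = "\<lambda>T. W - T", simplified])
  show "bij_betw (\<lambda>T. W - T) {T. T \<subseteq> W \<and> card T = r} {T. T \<subseteq> W \<and> card T = s}"
    by (rule bij_betwI[where g = "\<lambda>T. W - T"])
      (use assms in \<open>auto simp: card_Diff_subset rev_finite_subset double_diff\<close>)
qed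

text \<open>
  If \<open>card V = 2 b - 1\<close>, then a \<open>b\<close>-set is the only \<open>b\<close>-set that avoids its complement, which has
  \<open>b - 1\<close> elements. So the value of the design at \<open>B\<close> must be the number \<open>avoid_sum x {} (V - B)\<close>. To
  see that this choice works, the numbers \<open>avoid_sum x {} K\<close> with \<open>card K < b\<close> are shown to be the
  covering sums of their restriction to \<open>(b - 1)\<close>-sets; inclusion and exclusion then recovers \<open>x\<close>.
\<close>

lemma design_exists_middle:
  fixes x :: "'a set \<Rightarrow> 'k::comm_ring_1"
  assumes V: "finite V" "card V + 1 = 2 * b" and x: "consistent V b x"
  shows "design V b x (\<lambda>B. avoid_sum x {} (V - B))"
  unfolding design_def
proof (intro allI impI)
  let ?G = "avoid_sum x {}"
  fix I assume I: "I \<subseteq> V" "card I < b"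
  have fI: "finite I" using I V finite_subset by auto
  have top: "subset_sum (V - K) (b - 1 - card K) (\<lambda>U. ?G (K \<union> U)) = ?G K" if K: "K \<subseteq> V" "card K < b" for K
  proof -
    define s where "s = b - 1 - card K"
    have fK: "finite K" using K V finite_subset by auto
    have cW: "card (V - K) = s + b" using K V fK by (simp add: card_Diff_subset s_def)
    have "subset_sum (V - K) s (\<lambda>U. ?G (K \<union> U))
       = subset_sum (V - K) s (\<lambda>U. \<Sum>T\<in>Pow U. (-1) ^ card T * avoid_sum x T K)"
    proof (rule subset_sum_cong[OF refl refl])
      fix U assume U: "U \<subseteq> V - K"
      have "finite U" using U V finite_subset by blast
      moreover have "U \<inter> K = {}" using U by blast
      ultimately show "?G (K \<union> U) = (\<Sum>T\<in>Pow U. (-1) ^ card T * avoid_sum x T K)"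
        using avoid_sum_Un[of U K x "{}"] fK by simp
    qed
    also have "\<dots> = (\<Sum>t\<le>s. of_nat ((s + b - t) choose (s - t)) * subset_sum (V - K) t (\<lambda>T. (-1) ^ card T * avoid_sum x T K))"
      using V by (simp add: subset_sum_subset_sum cW)
    also have "\<dots> = (\<Sum>t\<le>s. (-1) ^ t * of_nat (b choose t) * of_nat ((s + b - t) choose (s - t))) * ?G K"
      unfolding sum_distrib_right
    proof (rule sum.cong[OF refl])
      fix t assume t: "t \<in> {..s}"
      have "subset_sum (V - K) t (\<lambda>T. (-1) ^ card T * avoid_sum x T K)
         = (-1) ^ t * subset_sum (V - {} - K) t (\<lambda>T. avoid_sum x ({} \<union> T) K)"
        unfolding subset_sum_mult[symmetric] by (rule subset_sum_cong) auto
      also have "subset_sum (V - {} - K) t (\<lambda>T. avoid_sum x ({} \<union> T) K) = of_nat (b choose t) * ?G K"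
        using avoid_sum_consistent[OF V(1) x fK, of "{}" t] K t by (simp add: s_def)
      finally show "of_nat ((s + b - t) choose (s - t)) * subset_sum (V - K) t (\<lambda>T. (-1) ^ card T * avoid_sum x T K)
         = (-1) ^ t * of_nat (b choose t) * of_nat ((s + b - t) choose (s - t)) * ?G K"
        by (simp add: mult_ac)
    qed
    also have "\<dots> = ?G K" by (simp add: alternating_binomial_convolution)
    finally show ?thesis by (simp add: s_def)
  qed
  have "subset_sum (V - I) (b - card I) (\<lambda>T. ?G (V - (I \<union> T))) = subset_sum (V - I) (b - 1) ?G"
  proof -
    have "b - card I + (b - 1) = card (V - I)" using V I fI by (simp add: card_Diff_subset)
    hence "subset_sum (V - I) (b - card I) (\<lambda>T. ?G (V - I - T))
        = subset_sum (V - I) (b - 1) (\<lambda>T. ?G (V - I - (V - I - T)))"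
      using V by (intro subset_sum_complement) auto
    also have "\<dots> = subset_sum (V - I) (b - 1) ?G"
      by (intro subset_sum_cong refl) (simp add: double_diff)
    finally show ?thesis by (simp add: Diff_Un Diff_eq Int_assoc inf_left_commute)
  qed
  also have "\<dots> = (\<Sum>K\<in>Pow I. (-1) ^ card K * subset_sum (V - K) (b - 1 - card K) (\<lambda>T. ?G (K \<union> T)))"
    using I V fI by (intro subset_sum_avoiding) auto
  also have "\<dots> = (\<Sum>K\<in>Pow I. (-1) ^ card K * ?G K)"
  proof (intro sum.cong refl)
    fix K assume K: "K \<in> Pow I"
    hence "card K \<le> card I" using fI by (auto intro: card_mono)
    thus "(- 1) ^ card K * subset_sum (V - K) (b - 1 - card K) (\<lambda>T. ?G (K \<union> T)) = (- 1) ^ card K * ?G K"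
      using top[of K] K I by auto
  qed
  also have "\<dots> = x I"
    using inclusion_exclusion_symmetric[of ?G x I] fI by (simp add: avoid_sum_def)
  finally show "subset_sum (V - I) (b - card I) (\<lambda>T. ?G (V - (I \<union> T))) = x I" .
qed

text \<open>
  Induction on \<open>V\<close>. For a new point \<open>v\<close>, the values of \<open>f\<close> on sets that contain \<open>v\<close> form a design for
  \<open>b - 1\<close>, which is constructed first; the values on sets that avoid \<open>v\<close> then have to be a design for
  what is left, and the remainder is consistent by Pascal's rule. The bound \<open>2 b \<le> card V + 1\<close> is
  inherited except at the boundary \<open>card V = 2 b - 1\<close>, which is the preceding lemma.
\<close>

lemma consistent_extends:
  fixes x :: "'a set \<Rightarrow> 'k::comm_ring_1"
  assumes "finite V" "2 * b \<le> card V + 1" "consistent V b x"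
  shows "\<exists>f. design V b x f"
  using assms
proof (induction V arbitrary: b x rule: finite_induct)
  case empty
  hence "b = 0" by simp
  thus ?case by (auto simp: design_def)
next
  case (insert v V)
  consider "b = 0" | "2 * b = card (insert v V) + 1" | b' where "b = Suc b'" "2 * b \<le> card V + 1"
    using insert.prems insert.hyps by (cases b) force+
  thus ?case
  proof cases
    case 1
    thus ?thesis by (auto simp: design_def)
  next
    case 2
    thus ?thesis using design_exists_middle[of "insert v V" b x] insert by auto
  next
    case 3
    have fin: "finite I" if "I \<subseteq> V" for I using that insert.hyps finite_subset by blast
    have cons: "subset_sum (insert v V - I) s (\<lambda>T. x (I \<union> T)) = of_nat ((b - card I) choose s) * x I"
      if "I \<subseteq> insert v V" "card I + s < b" for I s
      using insert.prems that by (simp add: consistent_def)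
    have consz: "consistent V b' (\<lambda>I. x (insert v I))"
      unfolding consistent_def
    proof (intro allI impI)
      fix I s assume I: "I \<subseteq> V" "card I + s < b'"
      have "insert v V - insert v I = V - I" "card (insert v I) = Suc (card I)" 
        using I insert.hyps fin[OF I(1)] by (auto simp: card_insert_if)
      thus "subset_sum (V - I) s (\<lambda>T. x (insert v (I \<union> T))) = of_nat ((b' - card I) choose s) * x (insert v I)"
        using cons[of "insert v I" s] I 3 by auto
    qed
    then obtain g where g: "design V b' (\<lambda>I. x (insert v I)) g"
      using insert.IH[of b' "\<lambda>I. x (insert v I)"] 3 by auto
    \<comment> \<open>\<open>z I\<close> is the covering sum at \<open>insert v I\<close>, including the top level, where it is the value of the design itself\<close>
    define z where "z I = (if card I = b' then g I else x (insert v I))" for I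
    have z: "subset_sum (V - I) s (\<lambda>T. z (I \<union> T)) = of_nat ((b' - card I) choose s) * z I"
      if I: "I \<subseteq> V" "card I + s < b" for I s
    proof (cases "card I = b'")
      case True
      thus ?thesis using I 3 insert.hyps by simp
    next
      case False
      hence lt: "card I < b'" using I 3 by simp
      have cT: "card (I \<union> T) = card I + s" if "T \<subseteq> V - I" "card T = s" for T
        using that fin[OF I(1)] fin[of T] by (subst card_Un_disjoint) auto
      show ?thesis
      proof (cases "card I + s = b'")
        case True
        have "subset_sum (V - I) s (\<lambda>T. z (I \<union> T)) = subset_sum (V - I) (b' - card I) (\<lambda>T. g (I \<union> T))"
          using True by (intro subset_sum_cong) (auto simp: z_def cT)
        also have "\<dots> = x (insert v I)" using g I lt by (auto simp: design_def)
        finally show ?thesis using True lt by (auto simp: z_def)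
      next
        case False
        have "subset_sum (V - I) s (\<lambda>T. z (I \<union> T)) = subset_sum (V - I) s (\<lambda>T. x (insert v (I \<union> T)))"
          using False by (intro subset_sum_cong) (auto simp: z_def cT)
        also have "\<dots> = of_nat ((b' - card I) choose s) * x (insert v I)"
          using consz I False 3 by (auto simp: consistent_def)
        finally show ?thesis using lt by (auto simp: z_def)
      qed
    qed
    have "consistent V b (\<lambda>I. x I - z I)"
      unfolding consistent_def
    proof (intro allI impI)
      fix I s assume I: "I \<subseteq> V" "card I + s < b"
      have vI: "insert v V - I = insert v (V - I)" using I insert.hyps by auto
      have cb: "of_nat ((b - card I) choose s) * x I - of_nat ((b' - card I) choose s) * z I
         - (if s = 0 then 0 else of_nat ((b' - card I) choose (s - 1)) * z I)
         = of_nat ((b - card I) choose s) * (x I - z I)"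
      proof (cases s)
        case (Suc s')
        have "b - card I = Suc (b' - card I)" using 3 I Suc by simp
        thus ?thesis using Suc by (simp add: algebra_simps)
      qed (simp add: algebra_simps)
      have "subset_sum (V - I) s (\<lambda>T. x (I \<union> T)) = of_nat ((b - card I) choose s) * x I
         - (if s = 0 then 0 else of_nat ((b' - card I) choose (s - 1)) * z I)"
      proof (cases s)
        case 0
        thus ?thesis using insert.hyps by simp
      next
        case (Suc s')
        have "subset_sum (V - I) s' (\<lambda>T. x (insert v (I \<union> T))) = subset_sum (V - I) s' (\<lambda>T. z (I \<union> T))"
        proof (rule subset_sum_cong[OF refl refl])
          fix T assume "T \<subseteq> V - I" "card T = s'"
          hence "card (I \<union> T) = card I + s'" using fin[OF I(1)] fin[of T] by (subst card_Un_disjoint) auto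
          thus "x (insert v (I \<union> T)) = z (I \<union> T)" using I 3 Suc by (simp add: z_def)
        qed
        thus ?thesis using subset_sum_insert[of "V - I" v s' "\<lambda>T. x (I \<union> T)"] insert.hyps Suc
          cons[of I s] I vI z[of I s'] by (auto simp: algebra_simps)
      qed
      thus "subset_sum (V - I) s (\<lambda>T. x (I \<union> T) - z (I \<union> T)) = of_nat ((b - card I) choose s) * (x I - z I)"
        unfolding subset_sum_diff using z[OF I] cb by (simp add: algebra_simps)
    qed
    then obtain y where y: "design V b (\<lambda>I. x I - z I) y"
      using insert.IH[of b "\<lambda>I. x I - z I"] 3 by auto
    define f where "f B = (if v \<in> B then g (B - {v}) else y B)" for B
    have "design (insert v V) b x f"
      unfolding design_def
    proof (intro allI impI)
      fix I assume I: "I \<subseteq> insert v V" "card I < b"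
      show "subset_sum (insert v V - I) (b - card I) (\<lambda>T. f (I \<union> T)) = x I"
      proof (cases "v \<in> I")
        case True
        define I' where "I' = I - {v}"
        have I': "I' \<subseteq> V" "I = insert v I'" "v \<notin> I'" using True I by (auto simp: I'_def)
        have c: "card I = Suc (card I')" using I' fin[OF I'(1)] by simp
        have "subset_sum (insert v V - I) (b - card I) (\<lambda>T. f (I \<union> T))
           = subset_sum (V - I') (b' - card I') (\<lambda>T. g (I' \<union> T))"
        proof (rule subset_sum_cong)
          fix T assume "T \<subseteq> insert v V - I"
          hence "I \<union> T - {v} = I' \<union> T" using I' by auto
          thus "f (I \<union> T) = g (I' \<union> T)" using True by (simp add: f_def)
        qed (use I' insert.hyps 3 c in auto)
        also have "\<dots> = x I" using g I' c I 3 by (auto simp: design_def)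
        finally show ?thesis .
      next
        case False
        hence I': "I \<subseteq> V" using I by auto
        have e: "insert v V - I = insert v (V - I)" "b - card I = Suc (b' - card I)" using False I 3 by auto
        have "subset_sum (insert v V - I) (b - card I) (\<lambda>T. f (I \<union> T))
           = subset_sum (V - I) (b - card I) (\<lambda>T. f (I \<union> T)) + subset_sum (V - I) (b' - card I) (\<lambda>T. f (insert v (I \<union> T)))"
          using subset_sum_insert[of "V - I" v "b' - card I" "\<lambda>T. f (I \<union> T)"] insert.hyps e by simp
        also have "subset_sum (V - I) (b - card I) (\<lambda>T. f (I \<union> T)) = subset_sum (V - I) (b - card I) (\<lambda>T. y (I \<union> T))"
        proof (rule subset_sum_cong[OF refl refl])
          fix T assume "T \<subseteq> V - I"
          hence "v \<notin> I \<union> T" using False insert.hyps by auto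
          thus "f (I \<union> T) = y (I \<union> T)" by (simp add: f_def)
        qed
        also have "\<dots> = x I - z I" using y I I' by (auto simp: design_def)
        also have "subset_sum (V - I) (b' - card I) (\<lambda>T. f (insert v (I \<union> T))) = subset_sum (V - I) (b' - card I) (\<lambda>T. z (I \<union> T))"
        proof (rule subset_sum_cong[OF refl refl])
          fix T assume T: "T \<subseteq> V - I" "card T = b' - card I"
          hence "insert v (I \<union> T) - {v} = I \<union> T" using False insert.hyps by auto
          moreover have "card (I \<union> T) = b'" using fin[OF I'] fin[of T] T I 3 by (subst card_Un_disjoint) auto
          ultimately show "f (insert v (I \<union> T)) = z (I \<union> T)" by (simp add: f_def z_def)
        qed
        also have "\<dots> = z I" using z[of I "b' - card I"] I' I 3 by simp
        finally show ?thesis by simp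
      qed
    qed
    thus ?thesis by blast
  qed
qed

section \<open>The kernel of all covering sums\<close>

text \<open>
  The data of a polytabloid of shape \<open>(a, b)\<close>: the \<open>b\<close> columns of length two, with upper entries \<open>u j\<close> and
  lower entries \<open>w j\<close>.
\<close>

definition pairing :: "'a set \<Rightarrow> nat \<Rightarrow> (nat \<Rightarrow> 'a) \<Rightarrow> (nat \<Rightarrow> 'a) \<Rightarrow> bool"
  where "pairing V b u w \<longleftrightarrow> inj_on u {..<b} \<and> inj_on w {..<b} \<and>
    u ` {..<b} \<inter> w ` {..<b} = {} \<and> u ` {..<b} \<subseteq> V \<and> w ` {..<b} \<subseteq> V"

text \<open>
  The coefficient of the tabloid with second row \<open>B\<close> in the polytabloid: each column contributes a factor
  that is \<open>1\<close>, \<open>-1\<close> or \<open>0\<close> according to whether only its lower entry, only its upper entry, or not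
  exactly one of its entries lies in \<open>B\<close>.
\<close>

definition pair_product :: "nat \<Rightarrow> (nat \<Rightarrow> 'a) \<Rightarrow> (nat \<Rightarrow> 'a) \<Rightarrow> 'a set \<Rightarrow> 'k::comm_ring_1"
  where "pair_product b u w B = (\<Prod>j<b. of_bool (w j \<in> B) - of_bool (u j \<in> B))"

text \<open>
  The span of the pair products, generated one summand at a time.
\<close>

inductive pair_span :: "'a set \<Rightarrow> nat \<Rightarrow> ('a set \<Rightarrow> 'k::comm_ring_1) \<Rightarrow> bool" for V b where
  zero: "pair_span V b (\<lambda>_. 0)"
| step: "pair_span V b h \<Longrightarrow> pairing V b u w \<Longrightarrow> pair_span V b (\<lambda>B. h B + c * pair_product b u w B)"

lemma pairing_mono: "pairing V b u w \<Longrightarrow> V \<subseteq> V' \<Longrightarrow> pairing V' b u w"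
  by (auto simp: pairing_def)

lemma pair_span_mono: "pair_span V b h \<Longrightarrow> V \<subseteq> V' \<Longrightarrow> pair_span V' b h"
  by (induction rule: pair_span.induct) (auto intro: pair_span.intros pairing_mono)

lemma pair_span_add: "pair_span V b h \<Longrightarrow> pair_span V b g \<Longrightarrow> pair_span V b (\<lambda>B. g B + h B)"
proof (induction rule: pair_span.induct)
  case (step h u w c)
  thus ?case using pair_span.step[of V b "\<lambda>B. g B + h B" u w c] by (simp add: add.assoc)
qed simp

lemma inj_on_choice_pairing:
  assumes "pairing V b u w" "\<And>j. j < b \<Longrightarrow> s j = u j \<or> s j = w j"
  shows "inj_on s {..<b}"
proof (rule inj_onI)
  fix i j assume ij: "i \<in> {..<b}" "j \<in> {..<b}" "s i = s j"
  have "u i \<noteq> w j" "w i \<noteq> u j" using assms(1) ij by (auto simp: pairing_def disjoint_iff)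
  thus "i = j" using assms(2)[of i] assms(2)[of j] ij assms(1) by (auto simp: pairing_def inj_on_def)
qed

text \<open>
  A nonzero product picks one element of \<open>B\<close> from each of the \<open>b\<close> pairs, and these are all of \<open>B\<close>.
\<close>

lemma pair_product_support:
  assumes "pairing V b u w" "finite B" "card B = b" "pair_product b u w B \<noteq> (0::'k::field)"
  shows "B \<subseteq> u ` {..<b} \<union> w ` {..<b}"
proof -
  define s where "s j = (if w j \<in> B then w j else u j)" for j
  have nz: "(w j \<in> B) \<noteq> (u j \<in> B)" if "j < b" for j
  proof -
    have "of_bool (w j \<in> B) - of_bool (u j \<in> B) \<noteq> (0::'k)"
      using assms(4) that by (simp add: pair_product_def)
    thus ?thesis by auto
  qed
  have "inj_on s {..<b}" using inj_on_choice_pairing[OF assms(1), of s] by (auto simp: s_def)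
  hence "card (s ` {..<b}) = b" by (simp add: card_image)
  moreover have "s ` {..<b} \<subseteq> B" using nz by (auto simp: s_def)
  ultimately have "s ` {..<b} = B" using assms(2,3) by (intro card_subset_eq) auto
  thus ?thesis by (auto simp: s_def)
qed

lemma pair_span_support:
  assumes "pair_span V b h" "finite B" "card B = b" "\<not> B \<subseteq> V"
  shows "h B = (0::'k::field)"
  using assms
proof (induction rule: pair_span.induct)
  case (step h u w c)
  hence "pair_product b u w B = (0::'k)"
    using pair_product_support[OF step.hyps(2), of B] unfolding pairing_def by blast
  thus ?case using step by simp
qed simp

text \<open>
  Since \<open>I\<close> has fewer than \<open>b\<close> elements, it misses one of the \<open>b\<close> disjoint pairs. Exchanging the two
  entries of this pair permutes the \<open>b\<close>-sets that contain \<open>I\<close> and changes the sign of the product, so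
  the sum equals its negative.
\<close>

lemma pair_product_kernel:
  assumes V: "finite V" and two: "(2::'k::field) \<noteq> 0" and p: "pairing V b u w"
  shows "design V b (\<lambda>_. 0) (pair_product b u w :: _ \<Rightarrow> 'k)"
  unfolding design_def
proof (intro allI impI)
  let ?P = "pair_product b u w :: _ \<Rightarrow> 'k"
  fix I assume I: "I \<subseteq> V" "card I < b"
  have fI: "finite I" using I V finite_subset by auto
  have "\<exists>j<b. u j \<notin> I \<and> w j \<notin> I"
  proof (rule ccontr)
    assume "\<not> ?thesis"
    hence *: "u j \<in> I \<or> w j \<in> I" if "j < b" for j using that by blast
    define s where "s j = (if w j \<in> I then w j else u j)" for j
    have "inj_on s {..<b}" using inj_on_choice_pairing[OF p, of s] by (auto simp: s_def)
    hence "card (s ` {..<b}) = b" by (simp add: card_image)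
    moreover have "s ` {..<b} \<subseteq> I" using * by (auto simp: s_def)
    ultimately have "b \<le> card I" using card_mono[OF fI, of "s ` {..<b}"] by simp
    thus False using I by simp
  qed
  then obtain j where j: "j < b" "u j \<notin> I" "w j \<notin> I" by blast
  define \<tau> where "\<tau> = transpose (u j) (w j)"
  have inv: "\<tau> (\<tau> x) = x" for x by (simp add: \<tau>_def)
  have mem: "x \<in> \<tau> ` B \<longleftrightarrow> \<tau> x \<in> B" for x B
    using inv by (metis image_iff)
  have uw: "u j \<in> V" "w j \<in> V" "u j \<noteq> w j" using p j by (auto simp: pairing_def)
  have neg: "?P (\<tau> ` B) = - ?P B" for B
  proof -
    have "?P (\<tau> ` B) = (of_bool (w j \<in> \<tau> ` B) - of_bool (u j \<in> \<tau> ` B)) *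
        (\<Prod>i\<in>{..<b}-{j}. of_bool (w i \<in> \<tau> ` B) - of_bool (u i \<in> \<tau> ` B))"
      unfolding pair_product_def using j by (subst prod.remove[of _ j]) auto
    also have "(\<Prod>i\<in>{..<b}-{j}. of_bool (w i \<in> \<tau> ` B) - of_bool (u i \<in> \<tau> ` B) :: 'k)
        = (\<Prod>i\<in>{..<b}-{j}. of_bool (w i \<in> B) - of_bool (u i \<in> B))"
    proof (rule prod.cong[OF refl])
      fix i assume i: "i \<in> {..<b} - {j}"
      hence "w i \<noteq> w j" "u i \<noteq> u j" "w i \<noteq> u j" "u i \<noteq> w j"
        using p j by (auto simp: pairing_def inj_on_def disjoint_iff)
      hence "\<tau> (w i) = w i" "\<tau> (u i) = u i" by (simp_all add: \<tau>_def transpose_apply_other)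
      thus "of_bool (w i \<in> \<tau> ` B) - of_bool (u i \<in> \<tau> ` B) = (of_bool (w i \<in> B) - of_bool (u i \<in> B) :: 'k)"
        by (simp add: mem)
    qed
    also have "of_bool (w j \<in> \<tau> ` B) - of_bool (u j \<in> \<tau> ` B) = - (of_bool (w j \<in> B) - of_bool (u j \<in> B) :: 'k)"
      unfolding mem by (simp add: \<tau>_def)
    finally show ?thesis
      unfolding pair_product_def using j by (simp add: prod.remove[of "{..<b}" j])
  qed
  have \<tau>I: "\<tau> ` I = I"
  proof -
    have "\<tau> x = x" if "x \<in> I" for x using that j by (auto simp: \<tau>_def transpose_def)
    thus ?thesis by auto
  qed
  have inj: "inj_on \<tau> A" for A by (rule inj_on_inverseI[of _ \<tau>]) (simp add: inv)
  let ?X = "{T. T \<subseteq> V - I \<and> card T = b - card I}"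
  have \<tau>V: "\<tau> x \<in> V - I" if "x \<in> V - I" for x using that uw j by (auto simp: \<tau>_def transpose_def)
  have "\<tau> ` T \<in> ?X" if "T \<in> ?X" for T
    using that \<tau>V inj[of T] by (auto simp: card_image)
  hence "bij_betw ((`) \<tau>) ?X ?X"
    by (intro bij_betwI[where g = "(`) \<tau>"]) (simp_all add: image_image inv)
  hence "(\<Sum>T\<in>?X. ?P (I \<union> T)) = (\<Sum>T\<in>?X. ?P (I \<union> \<tau> ` T))"
    by (rule sum.reindex_bij_betw[symmetric])
  also have "\<dots> = (\<Sum>T\<in>?X. - ?P (I \<union> T))"
    using neg \<tau>I by (intro sum.cong refl) (simp add: image_Un flip: neg)
  finally have "2 * (\<Sum>T\<in>?X. ?P (I \<union> T)) = 0" by (simp add: sum_negf)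
  thus "subset_sum (V - I) (b - card I) (\<lambda>T. ?P (I \<union> T)) = 0"
    using two by (simp add: subset_sum_def)
qed

lemma pair_span_kernel:
  assumes "finite V" "(2::'k::field) \<noteq> 0" "pair_span V b (h :: _ \<Rightarrow> 'k)"
  shows "design V b (\<lambda>_. 0) h"
  using assms(3)
proof (induction rule: pair_span.induct)
  case (step h u w c)
  thus ?case using pair_product_kernel[OF assms(1,2) step.hyps(2)]
    by (simp add: design_def subset_sum_add subset_sum_mult)
qed (simp add: design_def subset_sum_def)

text \<open>
  One column is added to each product, with the new point as its lower entry and an unused point as its
  upper entry.
\<close>

lemma pair_span_lift:
  assumes "pair_span V b h" "finite V" "2 * b < card V" "v \<notin> V"
  shows "\<exists>h'. pair_span (insert v V) (Suc b) h' \<and>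
    (\<forall>B. B \<subseteq> V \<longrightarrow> card B = b \<longrightarrow> h' (insert v B) = (h B :: 'k::field))"
  using assms(1)
proof (induction rule: pair_span.induct)
  case zero
  show ?case using pair_span.zero by blast
next
  case (step h u w c)
  then obtain h' where h': "pair_span (insert v V) (Suc b) h'"
    "\<And>B. B \<subseteq> V \<Longrightarrow> card B = b \<Longrightarrow> h' (insert v B) = h B" by blast
  have p: "inj_on u {..<b}" "inj_on w {..<b}" "u ` {..<b} \<inter> w ` {..<b} = {}" "u ` {..<b} \<subseteq> V" "w ` {..<b} \<subseteq> V"
    using step.hyps(2) by (auto simp: pairing_def)
  have "card (u ` {..<b} \<union> w ` {..<b}) \<le> 2 * b"
    using card_Un_le[of "u ` {..<b}" "w ` {..<b}"] card_image_le[of "{..<b}" u] card_image_le[of "{..<b}" w] by simp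
  hence "\<not> V \<subseteq> u ` {..<b} \<union> w ` {..<b}"
    using assms(3) card_mono[of "u ` {..<b} \<union> w ` {..<b}" V] by auto
  then obtain z where z: "z \<in> V" "z \<notin> u ` {..<b} \<union> w ` {..<b}" by blast
  define u' where "u' = u(b := z)"
  define w' where "w' = w(b := v)"
  have im: "u' ` {..<Suc b} = insert z (u ` {..<b})" "w' ` {..<Suc b} = insert v (w ` {..<b})"
    by (auto simp: u'_def w'_def lessThan_Suc)
  have "inj_on u' {..<Suc b}" "inj_on w' {..<Suc b}"
    using p z assms(4) by (auto simp: lessThan_Suc u'_def w'_def inj_on_def)
  hence "pairing (insert v V) (Suc b) u' w'"
    using p z assms(4) by (auto simp: pairing_def im)
  hence 1: "pair_span (insert v V) (Suc b) (\<lambda>B. h' B + c * pair_product (Suc b) u' w' B)"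
    by (rule pair_span.step[OF h'(1)])
  have "pair_product (Suc b) u' w' (insert v B) = (pair_product b u w B :: 'k)" if B: "B \<subseteq> V" "card B = b" for B
  proof -
    have "z \<noteq> v" using z assms(4) by auto
    have "(\<Prod>j<b. of_bool (w' j \<in> insert v B) - of_bool (u' j \<in> insert v B)) = (pair_product b u w B :: 'k)"
      unfolding pair_product_def
    proof (rule prod.cong[OF refl])
      fix j assume j: "j \<in> {..<b}"
      hence "w j \<noteq> v" "u j \<noteq> v" using p assms(4) by auto
      thus "of_bool (w' j \<in> insert v B) - of_bool (u' j \<in> insert v B) = (of_bool (w j \<in> B) - of_bool (u j \<in> B) :: 'k)"
        using j by (simp add: u'_def w'_def)
    qed
    hence "pair_product (Suc b) u' w' (insert v B) = pair_product b u w B * (1 - of_bool (z \<in> B) :: 'k)"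
      using \<open>z \<noteq> v\<close> by (simp add: pair_product_def[of "Suc b"] u'_def[of] w'_def)
    moreover have "pair_product b u w B = (0::'k)" if "z \<in> B"
      using that z pair_product_support[OF step.hyps(2), of B] B assms(2) finite_subset by blast
    ultimately show ?thesis by (cases "z \<in> B") auto
  qed
  thus ?case using 1 h'(2) by (intro exI[of _ "\<lambda>B. h' B + c * pair_product (Suc b) u' w' B"]) simp
qed

text \<open>
  For \<open>card V = 2 b - 1\<close> the kernel is zero, because \<open>B\<close> is the only \<open>b\<close>-set that avoids \<open>V - B\<close>.
\<close>

lemma design_zero_middle:
  fixes f :: "'a set \<Rightarrow> 'k::comm_ring_1"
  assumes V: "finite V" "card V + 1 = 2 * b" and f: "design V b (\<lambda>_. 0) f" and B: "B \<subseteq> V" "card B = b"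
  shows "f B = 0"
proof -
  have fB: "finite B" using B V finite_subset by auto
  have c: "card (V - B) = b - 1" "b > 0" using V B fB by (auto simp: card_Diff_subset)
  have "f B = subset_sum (V - (V - B)) b f"
    using B fB by (simp add: double_diff subset_sum_top)
  also have "\<dots> = (\<Sum>K\<in>Pow (V - B). (-1) ^ card K * subset_sum (V - K) (b - card K) (\<lambda>T. f (K \<union> T)))"
    using V c by (intro subset_sum_avoiding) auto
  also have "\<dots> = 0"
  proof (intro sum.neutral ballI)
    fix K assume K: "K \<in> Pow (V - B)"
    hence "card K \<le> b - 1" using card_mono[of "V - B" K] V c by auto
    thus "(-1) ^ card K * subset_sum (V - K) (b - card K) (\<lambda>T. f (K \<union> T)) = 0"
      using f K c by (auto simp: design_def)
  qed
  finally show ?thesis .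
qed

lemma design_zero_restrict:
  fixes f :: "'a set \<Rightarrow> 'k::comm_ring_1"
  assumes "finite V" "v \<notin> V" "design (insert v V) b (\<lambda>_. 0) f"
    and "\<And>B. B \<subseteq> V \<Longrightarrow> Suc (card B) = b \<Longrightarrow> f (insert v B) = 0"
  shows "design V b (\<lambda>_. 0) f"
  unfolding design_def
proof (intro allI impI)
  fix I assume I: "I \<subseteq> V" "card I < b"
  define s where "s = b - Suc (card I)"
  have s: "b - card I = Suc s" using I by (simp add: s_def)
  have e: "insert v V - I = insert v (V - I)" using I assms by auto
  have fI: "finite I" using I assms finite_subset by auto
  have "subset_sum (V - I) s (\<lambda>T. f (I \<union> insert v T)) = subset_sum (V - I) s (\<lambda>T. 0)"
  proof (rule subset_sum_cong[OF refl refl])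
    fix T assume T: "T \<subseteq> V - I" "card T = s"
    hence "finite T" using assms finite_subset by blast
    hence "Suc (card (I \<union> T)) = b" using T fI s by (subst card_Un_disjoint) auto
    thus "f (I \<union> insert v T) = 0" using assms(4)[of "I \<union> T"] T I by auto
  qed
  hence "subset_sum (V - I) s (\<lambda>T. f (I \<union> insert v T)) = 0" by (simp add: subset_sum_def)
  moreover have "subset_sum (insert v V - I) (b - card I) (\<lambda>T. f (I \<union> T)) = 0"
    using assms(3) I by (auto simp: design_def)
  ultimately show "subset_sum (V - I) (b - card I) (\<lambda>T. f (I \<union> T)) = 0"
    using subset_sum_insert[of "V - I" v s "\<lambda>T. f (I \<union> T)"] assms I by (simp add: e s)
qed

lemma design_zero_cofactor:
  fixes f :: "'a set \<Rightarrow> 'k::comm_ring_1"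
  assumes "finite V" "v \<notin> V" "design (insert v V) (Suc b) (\<lambda>_. 0) f"
  shows "design V b (\<lambda>_. 0) (\<lambda>B. f (insert v B))"
  unfolding design_def
proof (intro allI impI)
  fix I assume I: "I \<subseteq> V" "card I < b"
  have "finite I" "v \<notin> I" using I assms finite_subset by auto
  hence "card (insert v I) = Suc (card I)" "insert v V - insert v I = V - I" using assms(2) by auto
  thus "subset_sum (V - I) (b - card I) (\<lambda>T. f (insert v (I \<union> T))) = 0"
    using assms(3)[unfolded design_def, rule_format, of "insert v I"] I by auto
qed

text \<open>
  James' kernel intersection theorem for two rows, by induction on \<open>V\<close>. For a new point \<open>v\<close>, the values
  on the sets that contain \<open>v\<close> lie in the kernel for \<open>b - 1\<close>; a combination of pair products with the
  same values on these sets is subtracted, and the rest is a kernel element for the smaller set.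
\<close>

lemma kernel_pair_span:
  fixes f :: "'a set \<Rightarrow> 'k::field"
  assumes "finite V" "2 * b \<le> card V + 1" "(2::'k) \<noteq> 0" "design V b (\<lambda>_. 0) f"
  shows "\<exists>h. pair_span V b h \<and> (\<forall>B. B \<subseteq> V \<longrightarrow> card B = b \<longrightarrow> f B = h B)"
  using assms(1,2,4)
proof (induction V arbitrary: b f rule: finite_induct)
  case empty
  hence b: "b = 0" by simp
  have "pairing {} 0 (\<lambda>_. undefined :: 'a) (\<lambda>_. undefined)" by (simp add: pairing_def)
  from pair_span.step[OF pair_span.zero this, of "f {}"] show ?case
    unfolding b by (intro exI[of _ "\<lambda>B. 0 + f {} * pair_product 0 (\<lambda>_. undefined) (\<lambda>_. undefined) B"])
      (auto simp: pair_product_def)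
next
  case (insert v V)
  consider "b = 0" | "2 * b = card (insert v V) + 1" | b' where "b = Suc b'" "2 * b \<le> card V + 1"
    using insert.prems insert.hyps by (cases b) force+
  thus ?case
  proof cases
    case 1
    have "pairing (insert v V) 0 (\<lambda>_. v) (\<lambda>_. v)" by (simp add: pairing_def)
    from pair_span.step[OF pair_span.zero this, of "f {}"] show ?thesis
      unfolding 1 using insert.hyps(1) by (intro exI[of _ "\<lambda>B. 0 + f {} * pair_product 0 (\<lambda>_. v) (\<lambda>_. v) B"])
        (auto simp: pair_product_def finite_subset)
  next
    case 2
    have "f B = 0" if "B \<subseteq> insert v V" "card B = b" for B
      using 2 that insert by (intro design_zero_middle[of "insert v V" b]) auto
    thus ?thesis using pair_span.zero by blast
  next
    case 3
    have "\<exists>h. pair_span V b' h \<and> (\<forall>B. B \<subseteq> V \<longrightarrow> card B = b' \<longrightarrow> f (insert v B) = h B)"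
      using design_zero_cofactor[of V v b' f] insert.prems insert.hyps 3 by (intro insert.IH) auto
    then obtain h where h: "pair_span V b' h" "\<And>B. B \<subseteq> V \<Longrightarrow> card B = b' \<Longrightarrow> f (insert v B) = h B"
      by blast
    obtain h' where h': "pair_span (insert v V) b h'"
      "\<And>B. B \<subseteq> V \<Longrightarrow> card B = b' \<Longrightarrow> h' (insert v B) = h B"
      using pair_span_lift[OF h(1) insert.hyps(1) _ insert.hyps(2)] 3 by auto
    define g where "g B = f B - h' B" for B
    have "design (insert v V) b (\<lambda>_. 0) h'"
      using h'(1) insert.hyps assms(3) by (intro pair_span_kernel) auto
    hence "design (insert v V) b (\<lambda>_. 0) g"
      using insert.prems by (simp add: g_def design_def subset_sum_diff)
    hence "design V b (\<lambda>_. 0) g"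
      using insert.hyps 3 h h' by (intro design_zero_restrict[of V v]) (auto simp: g_def)
    then obtain k where k: "pair_span V b k" "\<And>B. B \<subseteq> V \<Longrightarrow> card B = b \<Longrightarrow> g B = k B"
      using insert.IH[of b g] 3 by blast
    have "f B = k B + h' B" if B: "B \<subseteq> insert v V" "card B = b" for B
    proof (cases "v \<in> B")
      case True
      have fB: "finite B" using B insert.hyps finite_subset by auto
      have "k B = 0" using True insert.hyps B fB by (intro pair_span_support[OF k(1)]) auto
      moreover have "f (insert v (B - {v})) = h' (insert v (B - {v}))"
        proof -
        have "B - {v} \<subseteq> V" "card (B - {v}) = b'" using True B 3 fB by auto
        thus ?thesis using h(2)[of "B - {v}"] h'(2)[of "B - {v}"] by simp
      qed
      ultimately show ?thesis using True by (simp add: insert_absorb)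
    next
      case False
      thus ?thesis using k(2)[of B] B by (auto simp: g_def algebra_simps)
    qed
    moreover have "pair_span (insert v V) b (\<lambda>B. k B + h' B)"
      using h'(1) pair_span_mono[OF k(1)] by (intro pair_span_add) auto
    ultimately show ?thesis by blast
  qed
qed

section \<open>Binomial coefficients modulo a prime\<close>

lemma prime_power_choose_eq_0:
  assumes "prime p" "CHAR('k::field) = p" "0 < k" "k < p ^ v"
  shows "of_nat ((p ^ v) choose k) = (0::'k)"
proof (rule ccontr)
  assume "of_nat ((p ^ v) choose k) \<noteq> (0::'k)"
  hence "\<not> p dvd ((p ^ v) choose k)" using assms(2) by (simp add: of_nat_eq_0_iff_char_dvd)
  hence co: "coprime (p ^ v) ((p ^ v) choose k)"
    using assms(1) by (simp add: prime_imp_coprime)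
  obtain k' where k: "k = Suc k'" using assms(3) by (cases k) auto
  obtain q' where q: "p ^ v = Suc q'" using assms(4) by (cases "p ^ v") auto
  have "p ^ v dvd k * ((p ^ v) choose k)" unfolding k q binomial_absorption by (rule dvd_triv_left)
  hence "p ^ v dvd k" using co by (simp add: coprime_dvd_mult_left_iff)
  thus False using assms(3,4) by (auto dest: dvd_imp_le)
qed

text \<open>
  In characteristic \<open>p\<close> the power \<open>(1 + X) ^ (p ^ v)\<close> is \<open>1 + X ^ (p ^ v)\<close>; here this is used through
  Vandermonde's identity and induction on \<open>x\<close>.
\<close>

lemma choose_multiple_prime_power:
  assumes "prime p" "CHAR('k::field) = p"
  shows "of_nat ((x * p ^ v) choose m) =
    (if p ^ v dvd m then of_nat (x choose (m div p ^ v)) else 0 :: 'k)"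
proof (induction x arbitrary: m)
  case 0
  have "p ^ v > 0" using assms(1) by (simp add: prime_gt_0_nat)
  thus ?case by (cases "m = 0") (auto simp: binomial_eq_0 dvd_div_eq_0_iff)
next
  case (Suc x)
  let ?q = "p ^ v"
  have q: "?q > 0" using assms(1) by (simp add: prime_gt_0_nat)
  have "of_nat ((Suc x * ?q) choose m) = (\<Sum>k\<le>m. of_nat (?q choose k) * of_nat ((x * ?q) choose (m - k)) :: 'k)"
    using vandermonde[of ?q "x * ?q" m] by (simp add: algebra_simps flip: of_nat_mult of_nat_sum)
  also have "\<dots> = (\<Sum>k\<in>{0, ?q} \<inter> {..m}. of_nat (?q choose k) * of_nat ((x * ?q) choose (m - k)))"
  proof (rule sum.mono_neutral_right)
    show "\<forall>i\<in>{..m} - {0, ?q} \<inter> {..m}. of_nat (?q choose i) * of_nat ((x * ?q) choose (m - i)) = (0::'k)"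
    proof
      fix i assume i: "i \<in> {..m} - {0, ?q} \<inter> {..m}"
      hence "of_nat (?q choose i) = (0::'k)"
        using prime_power_choose_eq_0[OF assms, of i v] by (cases "i < ?q") (auto simp: binomial_eq_0)
      thus "of_nat (?q choose i) * of_nat ((x * ?q) choose (m - i)) = (0::'k)" by simp
    qed
  qed auto
  also have "\<dots> = of_nat ((x * ?q) choose m) + (if ?q \<le> m then of_nat ((x * ?q) choose (m - ?q)) else 0)"
    using q by (cases "?q \<le> m") auto
  also have "\<dots> = (if ?q dvd m then of_nat (Suc x choose (m div ?q)) else 0)"
  proof (cases "?q dvd m")
    case True
    then obtain y where m: "m = ?q * y" by blast
    show ?thesis
    proof (cases y)
      case (Suc y')
      have "m - ?q = ?q * y'" using m Suc by simp
      thus ?thesis using q Suc m by (simp add: Suc.IH)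
    qed (use q m in \<open>simp add: Suc.IH\<close>)
  next
    case False
    hence "\<not> ?q dvd m - ?q" if "?q \<le> m" using that by (metis dvd_diffD1 dvd_refl dvd_diff_nat le_imp_diff_is_add dvd_add)
    thus ?thesis using False by (simp add: Suc.IH)
  qed
  finally show ?case .
qed

theorem Lucas_prime_power:
  assumes "prime p" "CHAR('k::field) = p" "r < p ^ v" "s < p ^ v"
  shows "of_nat ((x * p ^ v + r) choose (y * p ^ v + s)) = (of_nat (x choose y) * of_nat (r choose s) :: 'k)"
proof -
  let ?q = "p ^ v" and ?m = "y * p ^ v + s"
  have q: "?q > 0" using assms(1) by (simp add: prime_gt_0_nat)
  have "of_nat ((x * ?q + r) choose ?m) = (\<Sum>k\<le>?m. of_nat ((x * ?q) choose k) * of_nat (r choose (?m - k)) :: 'k)"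
    using vandermonde[of "x * ?q" r ?m] by (simp flip: of_nat_mult of_nat_sum)
  also have "\<dots> = (\<Sum>k\<in>{y * ?q}. of_nat ((x * ?q) choose k) * of_nat (r choose (?m - k)))"
  proof (rule sum.mono_neutral_right)
    show "\<forall>i\<in>{..?m} - {y * ?q}. of_nat ((x * ?q) choose i) * of_nat (r choose (?m - i)) = (0::'k)"
    proof
      fix i assume i: "i \<in> {..?m} - {y * ?q}"
      show "of_nat ((x * ?q) choose i) * of_nat (r choose (?m - i)) = (0::'k)"
      proof (cases "?q dvd i")
        case True
        then obtain z where z: "i = ?q * z" by blast
        have "z < y"
        proof (rule ccontr)
          assume "\<not> z < y"
          hence "z \<ge> Suc y" using i z by (cases "z = y") auto
          hence "?q * Suc y \<le> i" unfolding z by (rule mult_le_mono2)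
          thus False using i assms(4) by (simp add: mult.commute)
        qed
        hence "?q * Suc z \<le> ?q * y" by (intro mult_le_mono2) simp
        hence "i + ?q \<le> ?m" using z by (simp add: mult.commute)
        hence "r < ?m - i" using assms(3) by simp
        thus ?thesis by (simp add: binomial_eq_0)
      qed (simp add: choose_multiple_prime_power[OF assms(1,2)])
    qed
  qed auto
  also have "\<dots> = of_nat (x choose y) * of_nat (r choose s)"
    using q by (simp add: choose_multiple_prime_power[OF assms(1,2)])
  finally show ?thesis .
qed

lemma p_val_eq:
  assumes "prime p" "\<not> p dvd c"
  shows "p_val p (c * p ^ v) = v"
  unfolding p_val_def
proof (rule Least_equality)
  have "p > 0" using assms(1) by (simp add: prime_gt_0_nat)
  thus "p_digit p (c * p ^ v) v \<noteq> 0" using assms(2) by (simp add: p_digit_def dvd_eq_mod_eq_0)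
  fix i assume i: "p_digit p (c * p ^ v) i \<noteq> 0"
  show "v \<le> i"
  proof (rule ccontr)
    assume "\<not> v \<le> i"
    then obtain e where "v = Suc (i + e)" by (metis less_iff_Suc_add not_le)
    hence "c * p ^ v = (c * p ^ e * p) * p ^ i" by (simp add: power_add mult_ac)
    hence "c * p ^ v div p ^ i = c * p ^ e * p"
      using \<open>p > 0\<close> by (simp only:) (rule nonzero_mult_div_cancel_right, simp)
    thus False using i by (simp add: p_digit_def)
  qed
qed

lemma p_length_eq:
  assumes "prime p" "p ^ \<alpha> \<le> x" "x < p ^ Suc \<alpha>"
  shows "p_length p x = \<alpha>"
  unfolding p_length_def
proof (rule Greatest_equality)
  have p: "p > 0" using assms(1) by (simp add: prime_gt_0_nat)
  have "x div p ^ \<alpha> < p" using assms(3) p by (simp add: less_mult_imp_div_less)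
  moreover have "x div p ^ \<alpha> > 0" using assms(2) p by (simp add: div_greater_zero_iff)
  ultimately show "p_digit p x \<alpha> \<noteq> 0" by (simp add: p_digit_def)
  fix i assume i: "p_digit p x i \<noteq> 0"
  show "i \<le> \<alpha>"
  proof (rule ccontr)
    assume "\<not> i \<le> \<alpha>"
    hence "p ^ Suc \<alpha> \<le> p ^ i" using p by (intro power_increasing) auto
    hence "x div p ^ i = 0" using assms(3) by simp
    thus False using i by (simp add: p_digit_def)
  qed
qed

lemma leading_prime_power:
  assumes "prime p" "(x::nat) > 0"
  obtains \<alpha> where "p ^ \<alpha> \<le> x" "x < p ^ Suc \<alpha>"
proof -
  have "p \<ge> 2" using assms(1) by (simp add: prime_ge_2_nat)
  from ex_power_ivl1[OF this, of x] assms(2) that show ?thesis by auto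
qed

section \<open>The linear system for the design parameters\<close>

text \<open>
  The conditions on the parameters of a design, for \<open>d j = c (b - j)\<close> where \<open>c i\<close> is the covering sum of a
  set of size \<open>i\<close>.
\<close>

definition weight_solution :: "nat \<Rightarrow> nat \<Rightarrow> (nat \<Rightarrow> 'k::field) \<Rightarrow> bool"
  where "weight_solution a b d \<longleftrightarrow> (\<forall>l j. 1 \<le> l \<longrightarrow> l \<le> j \<longrightarrow> j \<le> b \<longrightarrow>
    of_nat ((a + j) choose (j - l)) * d l = of_nat (j choose l) * d j)"

lemma weight_solutionD:
  "weight_solution a b d \<Longrightarrow> 1 \<le> l \<Longrightarrow> l \<le> j \<Longrightarrow> j \<le> b \<Longrightarrow>
    of_nat ((a + j) choose (j - l)) * d l = of_nat (j choose l) * d j"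
  by (simp add: weight_solution_def)

lemma weight_solution_diff:
  "weight_solution a b d \<Longrightarrow> weight_solution a b e \<Longrightarrow> weight_solution a b (\<lambda>j. d j - c * e j)"
  unfolding weight_solution_def by (simp add: right_diff_distrib mult.left_commute[of _ c])

text \<open>
  These are the parameters of the constant function \<open>1\<close>.
\<close>

lemma weight_solution_trivial: "weight_solution a b (\<lambda>j. of_nat ((a + j) choose j))"
  unfolding weight_solution_def
proof (intro allI impI)
  fix l j :: nat assume "1 \<le> l" "l \<le> j" "j \<le> b"
  have "((a + j) choose (j - l)) * ((a + l) choose l) = (j choose l) * ((a + j) choose j)"
  proof -
    have "((a + j) choose (a + l)) * ((a + l) choose a) = ((a + j) choose a) * ((a + j - a) choose (a + l - a))"
      using \<open>l \<le> j\<close> by (intro choose_mult) auto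
    moreover have "(a + j) choose (a + l) = (a + j) choose (j - l)"
      using \<open>l \<le> j\<close> by (subst binomial_symmetric) auto
    moreover have "(a + l) choose a = (a + l) choose l" "(a + j) choose a = (a + j) choose j"
      by (subst binomial_symmetric; simp)+
    ultimately show ?thesis by (simp add: mult.commute)
  qed
  thus "of_nat ((a + j) choose (j - l)) * of_nat ((a + l) choose l) = (of_nat (j choose l) * of_nat ((a + j) choose j) :: 'a)"
    by (metis of_nat_mult)
qed

context
  fixes p :: nat
  assumes p: "prime p" and char: "CHAR('k::field) = p"
begin

lemma of_nat_neq_0:
  assumes "0 < x" "x < p" shows "of_nat x \<noteq> (0::'k)"
  using assms by (auto simp: of_nat_eq_0_iff_char_dvd char dest: dvd_imp_le)

lemma leading_choose_neq_0:
  assumes "p ^ \<alpha> \<le> j" "j < p ^ Suc \<alpha>"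
  shows "of_nat (j choose p ^ \<alpha>) \<noteq> (0::'k)"
proof -
  let ?q = "p ^ \<alpha>"
  have q: "?q > 0" using p by (simp add: prime_gt_0_nat)
  have "of_nat ((j div ?q * ?q + j mod ?q) choose (1 * ?q + 0)) = (of_nat (j div ?q choose 1) * of_nat (j mod ?q choose 0) :: 'k)"
    using q by (intro Lucas_prime_power p char) auto
  hence "of_nat (j choose ?q) = (of_nat (j div ?q) :: 'k)"
    by (simp only: div_mult_mod_eq mult_1 add_0_right choose_one binomial_n_0 of_nat_1 mult_1_right)
  moreover have "j div ?q < p" using assms q by (simp add: less_mult_imp_div_less)
  moreover have "j div ?q > 0" using assms q by (simp add: div_greater_zero_iff)
  ultimately show ?thesis using of_nat_neq_0 by simp
qed

text \<open>
  If \<open>p ^ \<alpha>\<close> is the largest power of \<open>p\<close> that is at most \<open>j\<close>, then \<open>j choose p ^ \<alpha>\<close> is modulo \<open>p\<close> the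
  leading digit of \<open>j\<close>. It is invertible, so the condition for \<open>l = p ^ \<alpha>\<close> expresses \<open>d j\<close> through \<open>d (p ^ \<alpha>)\<close>.
\<close>

lemma weight_solution_0:
  fixes d :: "nat \<Rightarrow> 'k"
  assumes "weight_solution a b d" "\<And>s. p ^ s \<le> b \<Longrightarrow> d (p ^ s) = 0" "1 \<le> j" "j \<le> b"
  shows "d j = 0"
proof -
  obtain \<alpha> where \<alpha>: "p ^ \<alpha> \<le> j" "j < p ^ Suc \<alpha>" using leading_prime_power[OF p, of j] assms by auto
  have "p ^ \<alpha> \<ge> 1" using p by (simp add: prime_gt_0_nat Suc_leI)
  hence "of_nat (j choose p ^ \<alpha>) * d j = 0"
    using weight_solutionD[OF assms(1), of "p ^ \<alpha>" j] assms \<alpha> by auto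
  thus ?thesis using leading_choose_neq_0[OF \<alpha>] by simp
qed

lemma choose_below_multiple:
  assumes "p ^ v dvd a + 1" "1 \<le> j" "j \<le> p ^ v" "s < p ^ v"
  shows "of_nat ((a + j) choose s) = (of_nat ((j - 1) choose s) :: 'k)"
proof -
  obtain c where c: "a + 1 = c * p ^ v" using assms(1) by (metis dvdE mult.commute)
  have "a + j = c * p ^ v + (j - 1)" using c assms(2) by simp
  thus ?thesis using Lucas_prime_power[OF p char, of "j - 1" v s c 0] assms by simp
qed

text \<open>
  The condition for \<open>l = p ^ s\<close> and \<open>j = p ^ (s + 1)\<close>: the coefficient of \<open>d j\<close> vanishes, and that of \<open>d l\<close>
  is \<open>1\<close> because \<open>a + j\<close> ends in \<open>s + 1\<close> digits \<open>p - 1\<close>.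
\<close>

lemma weight_solution_low_power:
  fixes d :: "nat \<Rightarrow> 'k"
  assumes "weight_solution a b d" "p ^ Suc s dvd a + 1" "p ^ Suc s \<le> b"
  shows "d (p ^ s) = 0"
proof -
  let ?q = "p ^ s"
  have q: "?q > 0" "p > 1" using p prime_gt_1_nat[OF p] by (simp_all add: prime_gt_0_nat)
  have lt: "?q < p ^ Suc s" using q by simp
  have "of_nat ((a + p ^ Suc s) choose (p ^ Suc s - ?q)) * d ?q = of_nat (p ^ Suc s choose ?q) * d (p ^ Suc s)"
    using weight_solutionD[OF assms(1), of ?q "p ^ Suc s"] lt assms q by simp
  also have "of_nat (p ^ Suc s choose ?q) = (0::'k)"
    using prime_power_choose_eq_0[OF p char, of ?q "Suc s"] lt q by simp
  finally have "of_nat ((a + p ^ Suc s) choose (p ^ Suc s - ?q)) * d ?q = 0" by simp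
  moreover have "of_nat ((a + p ^ Suc s) choose (p ^ Suc s - ?q)) = (of_nat ((p ^ Suc s - 1) choose (p ^ Suc s - ?q)) :: 'k)"
    using q lt by (intro choose_below_multiple[OF assms(2)]) auto
  moreover have "of_nat ((p ^ Suc s - 1) choose (p ^ Suc s - ?q)) = (1::'k)"
  proof -
    have "p ^ Suc s = (p - 1) * ?q + ?q" using q by (simp add: algebra_simps)
    hence "p ^ Suc s - 1 = (p - 1) * ?q + (?q - 1)" "p ^ Suc s - ?q = (p - 1) * ?q + 0" using q by linarith+
    thus ?thesis using Lucas_prime_power[OF p char, of "?q - 1" s 0 "p - 1" "p - 1"] q by simp
  qed
  ultimately show ?thesis by simp
qed

lemma trivial_solution_James:
  assumes "p ^ v dvd a + 1" "b < p ^ v" "1 \<le> j" "j \<le> b"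
  shows "of_nat ((a + j) choose j) = (0::'k)"
  using choose_below_multiple[OF assms(1), of j j] assms by (simp add: binomial_eq_0)

text \<open>
  Since \<open>p ^ v\<close> divides \<open>a + 1\<close> and exceeds \<open>b\<close>, the coefficient of \<open>d l\<close> may be replaced by
  \<open>(j - 1) choose (l - 1)\<close>, and \<open>l (j choose l) = j ((j - 1) choose (l - 1))\<close>. So \<open>d j = 1 / j\<close> is
  formally a solution; multiplied by \<open>p ^ \<alpha>\<close>, only the terms with \<open>p ^ \<alpha>\<close> dividing \<open>j\<close> survive modulo \<open>p\<close>.
\<close>

lemma James_solution:
  assumes v: "p ^ v dvd a + 1" "b < p ^ v" and \<alpha>: "b < p ^ Suc \<alpha>"
  shows "weight_solution a b (\<lambda>j. if p ^ \<alpha> dvd j then inverse (of_nat (j div p ^ \<alpha>)) else (0::'k))"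
    (is "weight_solution a b ?d")
  unfolding weight_solution_def
proof (intro allI impI)
  fix l j :: nat assume lj: "1 \<le> l" "l \<le> j" "j \<le> b"
  let ?q = "p ^ \<alpha>"
  have q: "?q > 0" using p by (simp add: prime_gt_0_nat)
  have red: "of_nat ((a + j) choose (j - l)) = (of_nat ((j - 1) choose (l - 1)) :: 'k)"
  proof -
    have "of_nat ((a + j) choose (j - l)) = (of_nat ((j - 1) choose (j - l)) :: 'k)"
      using lj v by (intro choose_below_multiple) auto
    also have "(j - 1) choose (j - l) = (j - 1) choose (l - 1)"
      using lj by (subst binomial_symmetric) auto
    finally show ?thesis .
  qed
  have "of_nat ((j - 1) choose (l - 1)) * ?d l = of_nat (j choose l) * ?d j"
  proof (cases "?q dvd l")
    case False
    show ?thesis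
    proof (cases "?q dvd j")
      case True
      have "of_nat (j choose l) = (0::'k)"
        using choose_multiple_prime_power[OF p char, of "j div ?q" \<alpha> l] False True by simp
      thus ?thesis using False by simp
    qed (use False in simp)
  next
    case True
    then obtain y where y: "l = y * ?q" by (metis dvdE mult.commute)
    have y0: "y > 0" using y lj by (cases y) auto
    show ?thesis
    proof (cases "?q dvd j")
      case True
      then obtain x where x: "j = x * ?q" by (metis dvdE mult.commute)
      have "y * ?q \<le> x * ?q" "x * ?q < p * ?q" using x y lj le_less_trans[OF lj(3) \<alpha>] by (simp_all only: power_Suc)
      hence xy: "y \<le> x" "x < p" using q by (simp_all only: mult_le_cancel2 mult_less_cancel2)
      have nz: "of_nat x \<noteq> (0::'k)" "of_nat y \<noteq> (0::'k)" using xy y0 of_nat_neq_0 by auto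
      have "l * (j choose l) = j * ((j - 1) choose (l - 1))"
        using lj by (intro times_binomial_minus1_eq) simp
      hence "?q * (y * (j choose l)) = ?q * (x * ((j - 1) choose (l - 1)))"
        unfolding x y by (simp add: mult_ac)
      hence "y * (j choose l) = x * ((j - 1) choose (l - 1))" using q p by auto
      hence "of_nat y * of_nat (j choose l) = (of_nat x * of_nat ((j - 1) choose (l - 1)) :: 'k)"
        by (metis of_nat_mult)
      thus ?thesis using nz q x y by (simp add: field_simps)
    next
      case False
      define x r where "x = j div ?q" and "r = j mod ?q"
      have r: "0 < r" "r < ?q" using False q by (auto simp: x_def r_def dvd_eq_mod_eq_0)
      have jr: "j = x * ?q + r" unfolding x_def r_def by (rule div_mult_mod_eq[symmetric])
      obtain y' where y': "y = Suc y'" using y0 by (cases y) auto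
      have "j - 1 = x * ?q + (r - 1)" "l - 1 = y' * ?q + (?q - 1)" using r jr y y' q by auto
      hence "of_nat ((j - 1) choose (l - 1)) = (of_nat (x choose y') * of_nat ((r - 1) choose (?q - 1)) :: 'k)"
        using r q by (simp only:) (rule Lucas_prime_power[OF p char], auto)
      also have "(r - 1) choose (?q - 1) = 0" using r by (intro binomial_eq_0) auto
      finally show ?thesis using False by simp
    qed
  qed
  thus "of_nat ((a + j) choose (j - l)) * ?d l = of_nat (j choose l) * ?d j"
    unfolding red .
qed

lemma trivial_solution_at_val:
  assumes "a + 1 = c * p ^ v" "\<not> p dvd c"
  shows "of_nat ((a + p ^ v) choose p ^ v) \<noteq> (0::'k)"
proof -
  have q: "p ^ v > 0" using p by (simp add: prime_gt_0_nat)
  have "a + p ^ v = c * p ^ v + (p ^ v - 1)" using assms(1) q by linarith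
  hence "of_nat ((a + p ^ v) choose p ^ v) = (of_nat c :: 'k)"
    using Lucas_prime_power[OF p char, of "p ^ v - 1" v 0 c 1] q by simp
  thus ?thesis using assms(2) by (simp add: of_nat_eq_0_iff_char_dvd char)
qed

text \<open>
  The conditions for \<open>j = p ^ s + p ^ v\<close> with \<open>l = p ^ v\<close> and with \<open>l = p ^ s\<close>. The first gives \<open>d j = 0\<close>;
  in the second, the coefficient of \<open>d (p ^ s)\<close> is the last nonzero digit of \<open>a + 1\<close>.
\<close>

lemma weight_solution_high_power:
  fixes d :: "nat \<Rightarrow> 'k"
  assumes d: "weight_solution a b d" "d (p ^ v) = 0" and c: "a + 1 = c * p ^ v" "\<not> p dvd c"
    and s: "v < s" "p ^ s + p ^ v \<le> b"
  shows "d (p ^ s) = 0"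
proof -
  let ?q = "p ^ v" and ?j = "p ^ s + p ^ v"
  obtain e where e: "s = v + Suc e" using s(1) by (metis add_Suc_right less_iff_Suc_add)
  have q: "?q > 0" "p ^ s > 0" using p by (simp_all add: prime_gt_0_nat)
  have pe: "of_nat (p * p ^ e) = (0::'k)" by (simp add: of_nat_eq_0_iff_char_dvd char)
  have j: "?j = (p * p ^ e + 1) * ?q + 0" by (simp add: e power_add mult_ac)
  have "of_nat (?j choose (1 * ?q + 0)) = (of_nat ((p * p ^ e + 1) choose 1) * of_nat (0 choose 0) :: 'k)"
    unfolding j using q by (intro Lucas_prime_power[OF p char]) auto
  hence jq: "of_nat (?j choose ?q) = (1::'k)" using pe by simp
  have "of_nat ((a + ?j) choose (?j - ?q)) * d ?q = of_nat (?j choose ?q) * d ?j"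
    using q s by (intro weight_solutionD[OF d(1)]) auto
  hence "d ?j = 0" using d(2) jq by simp
  moreover have "of_nat ((a + ?j) choose (?j - p ^ s)) * d (p ^ s) = of_nat (?j choose p ^ s) * d ?j"
    using q s by (intro weight_solutionD[OF d(1)]) auto
  moreover have "of_nat ((a + ?j) choose ?q) \<noteq> (0::'k)"
  proof -
    have "p ^ s = p * p ^ e * ?q" using e by (simp add: power_add mult_ac)
    hence "a + ?j = (c + p * p ^ e) * ?q + (?q - 1)" using c(1) q unfolding add_mult_distrib by linarith
    hence "of_nat ((a + ?j) choose ?q) = (of_nat (c + p * p ^ e) :: 'k)"
      using Lucas_prime_power[OF p char, of "?q - 1" v 0 "c + p * p ^ e" 1] q by simp
    also have "\<dots> = of_nat c" using pe by simp
    finally show ?thesis using c(2) by (simp add: of_nat_eq_0_iff_char_dvd char)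
  qed
  ultimately show ?thesis by simp
qed

text \<open>
  For \<open>l = p ^ \<beta>\<close> and \<open>j = p ^ \<beta> + r\<close> with \<open>0 < r < p ^ v\<close>, the last \<open>v\<close> digits of \<open>a + j\<close> represent \<open>r - 1\<close>,
  hence \<open>(a + j) choose r\<close> vanishes.
\<close>

lemma pointed_solution:
  assumes c: "p ^ v dvd a + 1" and b: "b < p ^ \<beta> + p ^ v" "v < \<beta>"
  shows "weight_solution a b (\<lambda>j. if j = p ^ \<beta> then 1 else (0::'k))" (is "weight_solution a b ?d")
  unfolding weight_solution_def
proof (intro allI impI)
  fix l j :: nat assume lj: "1 \<le> l" "l \<le> j" "j \<le> b"
  let ?q = "p ^ v"
  obtain x where x: "a + 1 = x * ?q" using c by (metis dvdE mult.commute)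
  obtain e where e: "\<beta> = v + Suc e" using b(2) by (metis add_Suc_right less_iff_Suc_add)
  consider "l = p ^ \<beta>" "j = p ^ \<beta>" | "l = p ^ \<beta>" "j > p ^ \<beta>" | "l < p ^ \<beta>" "j = p ^ \<beta>" | "l \<noteq> p ^ \<beta>" "j \<noteq> p ^ \<beta>"
    using lj by linarith
  thus "of_nat ((a + j) choose (j - l)) * ?d l = of_nat (j choose l) * ?d j"
  proof cases
    case 2
    define r where "r = j - p ^ \<beta>"
    have r: "0 < r" "r < ?q" using 2 lj b by (auto simp: r_def)
    have "a + j = (x + p * p ^ e) * ?q + (r - 1)" using x e r 2 by (simp add: r_def algebra_simps power_add)
    hence "of_nat ((a + j) choose r) = (of_nat ((r - 1) choose r) :: 'k)"
      using Lucas_prime_power[OF p char, of "r - 1" v r "x + p * p ^ e" 0] r by simp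
    thus ?thesis using 2 r by (simp add: r_def binomial_eq_0)
  next
    case 3
    thus ?thesis using lj prime_power_choose_eq_0[OF p char, of l \<beta>] by simp
  qed auto
qed

text \<open>
  Let \<open>v\<close> be the \<open>p\<close>-adic valuation of \<open>a + 1\<close>. If the partition is James, the trivial solution is zero,
  and every solution vanishes at all powers of \<open>p\<close> up to \<open>b\<close> except possibly the largest. Otherwise the
  trivial solution is nonzero at \<open>p ^ v\<close>, and a multiple of it is subtracted so that the value there
  becomes zero. What is left vanishes at all powers \<open>p ^ s\<close> except possibly at those with
  \<open>p ^ s \<le> b < p ^ s + p ^ v\<close> and \<open>s > v\<close>, and such an \<open>s\<close> exists exactly for pointed partitions.
\<close>

theorem weight_solutions:
  fixes a b :: nat
  assumes "b > 0"
  defines "d0 \<equiv> \<lambda>j. of_nat ((a + j) choose j) :: 'k"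
  shows "if James_partition p a b \<or> pointed_partition p a b
    then \<exists>d. weight_solution a b d \<and> (\<forall>c. \<exists>j\<in>{1..b}. d j \<noteq> c * d0 j) \<and>
      (\<forall>e. weight_solution a b e \<longrightarrow> (\<exists>c c'. \<forall>j\<in>{1..b}. e j = c * d j + c' * d0 j))
    else \<forall>e. weight_solution a b e \<longrightarrow> (\<exists>c'. \<forall>j\<in>{1..b}. e j = c' * d0 j)"
proof -
  have "p > 1" using prime_gt_1_nat[OF p] .
  obtain c v where c: "a + 1 = c * p ^ v" "\<not> p dvd c"
    using prime_power_canonical[OF p, of "a + 1"] by auto
  have v: "p_val p (a + 1) = v" unfolding c(1) by (rule p_val_eq[OF p c(2)])
  obtain \<alpha> where \<alpha>: "p ^ \<alpha> \<le> b" "b < p ^ Suc \<alpha>" using leading_prime_power[OF p assms(1)] .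
  have len: "p_length p b = \<alpha>" by (rule p_length_eq[OF p \<alpha>])
  have dvd: "p ^ s dvd a + 1" if "s \<le> v" for s
    using that c(1) by (simp add: le_imp_power_dvd)
  have triv: "weight_solution a b d0" unfolding d0_def by (rule weight_solution_trivial)
  have le: "s \<le> \<alpha>" if "p ^ s \<le> b" for s
    using that \<alpha>(2) \<open>p > 1\<close> by (metis less_Suc_eq_le order.strict_trans1 power_less_imp_less_exp)
  show ?thesis
  proof (cases "James_partition p a b")
    case True
    hence av: "\<alpha> < v" using v by (simp add: James_partition_def len)
    have bv: "b < p ^ v" using \<alpha>(2) av \<open>p > 1\<close> by (meson Suc_leI less_le_trans power_increasing less_imp_le)
    let ?d = "\<lambda>j. if p ^ \<alpha> dvd j then inverse (of_nat (j div p ^ \<alpha>)) else (0::'k)"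
    have d: "weight_solution a b ?d" using James_solution[OF dvd[of v] bv \<alpha>(2)] by simp
    have d1: "?d (p ^ \<alpha>) = 1" using \<open>p > 1\<close> by simp
    have d00: "d0 j = 0" if "j \<in> {1..b}" for j
      using trivial_solution_James[OF dvd[of v] bv] that by (auto simp: d0_def)
    have mem: "p ^ \<alpha> \<in> {1..b}" using \<alpha> \<open>p > 1\<close> by (simp add: Suc_leI)
    have "e j = e (p ^ \<alpha>) * ?d j + 0 * d0 j" if e: "weight_solution a b e" and j: "j \<in> {1..b}" for e j
    proof -
      have w: "weight_solution a b (\<lambda>j. e j - e (p ^ \<alpha>) * ?d j)" by (rule weight_solution_diff[OF e d])
      have "e j - e (p ^ \<alpha>) * ?d j = 0"
      proof (rule weight_solution_0[OF w])
        fix s assume s: "p ^ s \<le> b"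
        show "e (p ^ s) - e (p ^ \<alpha>) * ?d (p ^ s) = 0"
        proof (cases "s = \<alpha>")
          case False
          hence "s < \<alpha>" using le[OF s] by simp
          hence "p ^ Suc s \<le> p ^ \<alpha>" using \<open>p > 1\<close> by (intro power_increasing) auto
          hence "p ^ Suc s \<le> b" using \<alpha>(1) by (rule le_trans)
          moreover have "p ^ Suc s dvd a + 1" using \<open>s < \<alpha>\<close> av by (intro dvd) simp
          ultimately show ?thesis by (intro weight_solution_low_power[OF w])
        next
          case True
          show ?thesis unfolding True d1 by simp
        qed
      qed (use j in auto)
      thus ?thesis by simp
    qed
    moreover have "\<exists>j\<in>{1..b}. ?d j \<noteq> c * d0 j" for c
      using mem d00[OF mem] d1 by (intro bexI[OF _ mem]) simp
    ultimately show ?thesis using True d by (simp only: if_True simp_thms) blast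
  next
    case False
    hence va: "v \<le> \<alpha>" using v by (simp add: James_partition_def len)
    have vb: "p ^ v \<le> b" using va \<alpha>(1) \<open>p > 1\<close> by (meson le_trans less_imp_le power_increasing)
    have d0v: "d0 (p ^ v) \<noteq> 0" unfolding d0_def by (rule trivial_solution_at_val[OF c])
    have powers: "e (p ^ s) - e (p ^ v) / d0 (p ^ v) * d0 (p ^ s) = 0"
      if e: "weight_solution a b e" and s: "p ^ s \<le> b" "v < s \<Longrightarrow> p ^ s + p ^ v \<le> b" for e s
    proof -
      let ?e = "\<lambda>j. e j - e (p ^ v) / d0 (p ^ v) * d0 j"
      have w: "weight_solution a b ?e" by (rule weight_solution_diff[OF e triv])
      have v0: "?e (p ^ v) = 0" using d0v by simp
      consider "s < v" | "s = v" | "v < s" by linarith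
      thus ?thesis
      proof cases
        case 1
        have "p ^ Suc s \<le> p ^ v" using 1 \<open>p > 1\<close> by (intro power_increasing) auto
        thus ?thesis using weight_solution_low_power[OF w, of s] dvd[of "Suc s"] 1 vb by simp
      next
        case 3
        thus ?thesis using weight_solution_high_power[OF w v0 c 3] s by simp
      qed (use v0 in simp)
    qed
    show ?thesis
    proof (cases "pointed_partition p a b")
      case pt: True
      then obtain \<beta> b' where \<beta>: "b = p ^ \<beta> + b'" "b' < p ^ v" "p ^ v < p ^ \<beta>"
        unfolding pointed_partition_def v by blast
      have v\<beta>: "v < \<beta>" using \<beta>(3) \<open>p > 1\<close> by simp
      let ?d = "\<lambda>j. if j = p ^ \<beta> then 1 else (0::'k)"
      have d: "weight_solution a b ?d" using \<beta> v\<beta> by (intro pointed_solution dvd) auto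
      have "\<exists>j\<in>{1..b}. ?d j \<noteq> x * d0 j" for x
      proof (cases "x = 0")
        case True
        thus ?thesis using \<beta> \<open>p > 1\<close> by (intro bexI[of _ "p ^ \<beta>"]) (auto simp: Suc_leI)
      next
        case False
        thus ?thesis using \<beta> \<open>p > 1\<close> d0v vb by (intro bexI[of _ "p ^ v"]) (auto simp: Suc_leI)
      qed
      moreover have "\<exists>x y. \<forall>j\<in>{1..b}. e j = x * ?d j + y * d0 j" if e: "weight_solution a b e" for e
      proof -
        let ?y = "e (p ^ v) / d0 (p ^ v)"
        let ?x = "e (p ^ \<beta>) - ?y * d0 (p ^ \<beta>)"
        have w: "weight_solution a b (\<lambda>j. e j - ?y * d0 j - ?x * ?d j)"
          by (intro weight_solution_diff e triv d)
        have "e j - ?y * d0 j - ?x * ?d j = 0" if j: "j \<in> {1..b}" for j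
        proof (rule weight_solution_0[OF w])
          fix s assume s: "p ^ s \<le> b"
          show "e (p ^ s) - ?y * d0 (p ^ s) - ?x * ?d (p ^ s) = 0"
          proof (cases "s = \<beta>")
            case False
            have "p ^ s + p ^ v \<le> b" if "v < s"
            proof -
              have "b < p ^ Suc \<beta>"
              proof -
                have "b < 2 * p ^ \<beta>" using \<beta> by simp
                also have "\<dots> \<le> p ^ Suc \<beta>" using \<open>p > 1\<close> by simp
                finally show ?thesis .
              qed
              hence "p ^ s < p ^ Suc \<beta>" using s by simp
              hence "s < Suc \<beta>" using \<open>p > 1\<close> by (simp only: power_strict_increasing_iff)
              hence "s < \<beta>" using False by simp
              hence "p ^ Suc s \<le> p ^ \<beta>" using \<open>p > 1\<close> by (intro power_increasing) auto
              moreover have "2 * p ^ s \<le> p ^ Suc s" using \<open>p > 1\<close> by simp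
              moreover have "p ^ v \<le> p ^ s" using that \<open>p > 1\<close> by (intro power_increasing) auto
              ultimately show ?thesis using \<beta> by linarith
            qed
            hence "e (p ^ s) - ?y * d0 (p ^ s) = 0" by (intro powers[OF e s]) 
            thus ?thesis using False \<open>p > 1\<close> by simp
          qed simp
        qed (use j in auto)
        thus ?thesis by (intro exI[of _ ?x] exI[of _ ?y] ballI) (simp add: algebra_simps)
      qed
      ultimately show ?thesis using pt d by (simp only: if_True simp_thms) blast
    next
      case npt: False
      have "\<exists>y. \<forall>j\<in>{1..b}. e j = y * d0 j" if e: "weight_solution a b e" for e
      proof -
        let ?y = "e (p ^ v) / d0 (p ^ v)"
        have w: "weight_solution a b (\<lambda>j. e j - ?y * d0 j)"
          by (intro weight_solution_diff e triv)
        have "e j - ?y * d0 j = 0" if j: "j \<in> {1..b}" for j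
        proof (rule weight_solution_0[OF w])
          fix s assume s: "p ^ s \<le> b"
          have "p ^ s + p ^ v \<le> b" if "v < s"
          proof (rule ccontr)
            assume "\<not> p ^ s + p ^ v \<le> b"
            hence "b = p ^ s + (b - p ^ s)" "b - p ^ s < p ^ v" "p ^ v < p ^ s" using s that \<open>p > 1\<close> by auto
            thus False using npt unfolding pointed_partition_def v by blast
          qed
          thus "e (p ^ s) - ?y * d0 (p ^ s) = 0" by (intro powers[OF e s])
        qed (use j in auto)
        thus ?thesis by (intro exI[of _ ?y] ballI) simp
      qed
      thus ?thesis using False npt by simp
    qed
  qed
qed

end

section \<open>Designs that count subsets by their size\<close>

text \<open>
  Each set of size \<open>t + r\<close> is counted once for each of its subsets of size \<open>t\<close>.
\<close>

lemma subset_sum_nested: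
  fixes f :: "'a set \<Rightarrow> 'k::comm_ring_1"
  assumes "finite W"
  shows "subset_sum W t (\<lambda>T. subset_sum (W - T) r (\<lambda>U. f (T \<union> U)))
    = of_nat ((t + r) choose t) * subset_sum W (t + r) f"
  using assms
proof (induction W arbitrary: t r f rule: finite_induct)
  case empty
  have "{T. T \<subseteq> ({}::'a set) \<and> card T = s} = (if s = 0 then {{}} else {})" for s by auto
  thus ?case by (auto simp: subset_sum_def)
next
  case (insert v W)
  show ?case
  proof (cases t)
    case 0
    thus ?thesis using insert.hyps by simp
  next
    case t: (Suc t')
    show ?thesis
    proof (cases r)
      case 0
      have "subset_sum (insert v W) t (\<lambda>T. subset_sum (insert v W - T) 0 (\<lambda>U. f (T \<union> U))) = subset_sum (insert v W) t f"
        using insert.hyps by (intro subset_sum_cong) auto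
      thus ?thesis using 0 by simp
    next
      case r: (Suc r')
      have "subset_sum (insert v W) t (\<lambda>T. subset_sum (insert v W - T) r (\<lambda>U. f (T \<union> U)))
        = subset_sum W t (\<lambda>T. subset_sum (insert v W - T) r (\<lambda>U. f (T \<union> U)))
          + subset_sum W t' (\<lambda>T. subset_sum (insert v W - insert v T) r (\<lambda>U. f (insert v T \<union> U)))"
        unfolding t by (rule subset_sum_insert[OF insert.hyps(1,2)])
      also have "subset_sum W t (\<lambda>T. subset_sum (insert v W - T) r (\<lambda>U. f (T \<union> U)))
        = subset_sum W t (\<lambda>T. subset_sum (W - T) r (\<lambda>U. f (T \<union> U)) + subset_sum (W - T) r' (\<lambda>U. f (insert v (T \<union> U))))"
      proof (rule subset_sum_cong[OF refl refl])
        fix T assume T: "T \<subseteq> W"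
        hence "insert v W - T = insert v (W - T)" using insert.hyps by auto
        thus "subset_sum (insert v W - T) r (\<lambda>U. f (T \<union> U))
          = subset_sum (W - T) r (\<lambda>U. f (T \<union> U)) + subset_sum (W - T) r' (\<lambda>U. f (insert v (T \<union> U)))"
          using subset_sum_insert[of "W - T" v r' "\<lambda>U. f (T \<union> U)"] insert.hyps r by simp
      qed
      also have "\<dots> = of_nat ((t + r) choose t) * subset_sum W (t + r) f
          + of_nat ((t + r') choose t) * subset_sum W (t + r') (\<lambda>B. f (insert v B))"
        unfolding subset_sum_add insert.IH using insert.IH[of t r' "\<lambda>B. f (insert v B)"] by simp
      also have "subset_sum W t' (\<lambda>T. subset_sum (insert v W - insert v T) r (\<lambda>U. f (insert v T \<union> U)))
        = subset_sum W t' (\<lambda>T. subset_sum (W - T) r (\<lambda>U. f (insert v (T \<union> U))))"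
        using insert.hyps by (intro subset_sum_cong) auto
      also have "\<dots> = of_nat ((t' + r) choose t') * subset_sum W (t' + r) (\<lambda>B. f (insert v B))"
        by (rule insert.IH)
      also have "of_nat ((t + r) choose t) * subset_sum W (t + r) f
          + of_nat ((t + r') choose t) * subset_sum W (t + r') (\<lambda>B. f (insert v B))
          + of_nat ((t' + r) choose t') * subset_sum W (t' + r) (\<lambda>B. f (insert v B))
        = of_nat ((t + r) choose t) * subset_sum (insert v W) (t + r) f"
        using subset_sum_insert[OF insert.hyps(1,2), of "t' + r" f] t r
        by (simp add: algebra_simps)
      finally show ?thesis .
    qed
  qed
qed

lemma design_consistent:
  assumes V: "finite V" and f: "design V b x f"
  shows "consistent V b x"
  unfolding consistent_def
proof (intro allI impI)
  fix I s assume I: "I \<subseteq> V" "card I + s < b"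
  have fI: "finite I" using I V finite_subset by blast
  define r where "r = b - card I - s"
  have "subset_sum (V - I) s (\<lambda>T. x (I \<union> T))
     = subset_sum (V - I) s (\<lambda>T. subset_sum (V - I - T) r (\<lambda>U. f (I \<union> (T \<union> U))))"
  proof (rule subset_sum_cong[OF refl refl])
    fix T assume T: "T \<subseteq> V - I" "card T = s"
    hence "finite T" using V finite_subset by blast
    hence "card (I \<union> T) = card I + s" using T fI by (subst card_Un_disjoint) auto
    thus "x (I \<union> T) = subset_sum (V - I - T) r (\<lambda>U. f (I \<union> (T \<union> U)))"
      using f[unfolded design_def, rule_format, of "I \<union> T"] I T by (auto simp: r_def Diff_Un Un_assoc Diff_eq Int_assoc)
  qed
  also have "\<dots> = of_nat ((s + r) choose s) * subset_sum (V - I) (s + r) (\<lambda>B. f (I \<union> B))"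
    using V by (intro subset_sum_nested) auto
  also have "s + r = b - card I" using I by (simp add: r_def)
  also have "subset_sum (V - I) (b - card I) (\<lambda>B. f (I \<union> B)) = x I" using f I by (auto simp: design_def)
  finally show "subset_sum (V - I) s (\<lambda>T. x (I \<union> T)) = of_nat ((b - card I) choose s) * x I" .
qed

lemma subset_sum_permute:
  assumes "\<pi> permutes V" "I \<subseteq> V"
  shows "subset_sum (V - I) s (\<lambda>T. f (\<pi> ` (I \<union> T))) = subset_sum (V - \<pi> ` I) s (\<lambda>T. f (\<pi> ` I \<union> T))"
proof -
  have inj: "inj_on \<pi> A" for A using permutes_inj_on[OF assms(1)] .
  have im: "\<pi> ` (V - I) = V - \<pi> ` I"
    using image_set_diff[OF permutes_inj[OF assms(1)], of V I] permutes_image[OF assms(1)] by simp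
  have "bij_betw ((`) \<pi>) {T. T \<subseteq> V - I \<and> card T = s} {T. T \<subseteq> V - \<pi> ` I \<and> card T = s}"
    unfolding bij_betw_def
  proof
    show "inj_on ((`) \<pi>) {T. T \<subseteq> V - I \<and> card T = s}"
      using inj_image_eq_iff[OF permutes_inj[OF assms(1)]] by (auto simp: inj_on_def)
    show "(`) \<pi> ` {T. T \<subseteq> V - I \<and> card T = s} = {T. T \<subseteq> V - \<pi> ` I \<and> card T = s}"
    proof (intro equalityI subsetI)
      fix T assume T: "T \<in> {T. T \<subseteq> V - \<pi> ` I \<and> card T = s}"
      then obtain S where S: "S \<subseteq> V - I" "T = \<pi> ` S" unfolding im[symmetric] by (auto simp: subset_image_iff)
      thus "T \<in> (`) \<pi> ` {T. T \<subseteq> V - I \<and> card T = s}" using T by (auto simp: card_image[OF inj])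
    qed (auto simp: card_image[OF inj] im[symmetric])
  qed
  from sum.reindex_bij_betw[OF this, of "\<lambda>T. f (\<pi> ` I \<union> T)"] show ?thesis
    by (simp add: subset_sum_def image_Un)
qed

lemma permutes_transitive_subsets:
  assumes "finite V" "I \<subseteq> V" "J \<subseteq> V" "card I = card J"
  obtains \<pi> where "\<pi> permutes V" "\<pi> ` I = J"
proof -
  have fin: "finite I" "finite J" using assms finite_subset by blast+
  have "card (V - I) = card (V - J)" using assms fin by (simp add: card_Diff_subset)
  then obtain g where g: "bij_betw g (V - I) (V - J)" using assms(1) finite_same_card_bij[of "V - I" "V - J"] by auto
  obtain f where f: "bij_betw f I J" using fin assms(4) finite_same_card_bij[of I J] by auto
  define \<pi> where "\<pi> x = (if x \<in> I then f x else if x \<in> V then g x else x)" for x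
  have fI: "bij_betw \<pi> I J" using f by (rule bij_betw_cong[THEN iffD1, rotated]) (simp add: \<pi>_def)
  have gI: "bij_betw \<pi> (V - I) (V - J)" using g by (rule bij_betw_cong[THEN iffD1, rotated]) (simp add: \<pi>_def)
  have "bij_betw \<pi> (I \<union> (V - I)) (J \<union> (V - J))" by (rule bij_betw_combine[OF fI gI]) auto
  moreover have "I \<union> (V - I) = V" "J \<union> (V - J) = V" using assms by auto
  ultimately have "\<pi> permutes V" using assms(2) by (intro bij_imp_permutes) (auto simp: \<pi>_def)
  moreover have "\<pi> ` I = J" using fI by (simp add: bij_betw_def)
  ultimately show ?thesis using that by blast
qed

lemma design_const:
  assumes "finite V"
  shows "design V b (\<lambda>I. of_nat ((card V - card I) choose (b - card I)) * c) (\<lambda>_. c)"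
  unfolding design_def
proof (intro allI impI)
  fix I assume "I \<subseteq> V" "card I < b"
  moreover hence "finite I" using assms finite_subset by blast
  ultimately show "subset_sum (V - I) (b - card I) (\<lambda>T. c) = of_nat ((card V - card I) choose (b - card I)) * c"
    using assms by (simp add: subset_sum_const card_Diff_subset)
qed

lemma design_add:
  assumes "design V b x f" "design V b y g"
  shows "design V b (\<lambda>I. x I + c * y I) (\<lambda>B. f B + c * g B)"
  using assms by (simp add: design_def subset_sum_add subset_sum_mult)

lemma design_cong:
  assumes "finite V" "\<And>I. I \<subseteq> V \<Longrightarrow> card I < b \<Longrightarrow> x I = y I" "\<And>B. B \<subseteq> V \<Longrightarrow> card B = b \<Longrightarrow> f B = g B"
  shows "design V b x f \<longleftrightarrow> design V b y g"
proof -
  have "subset_sum (V - I) (b - card I) (\<lambda>T. f (I \<union> T)) = subset_sum (V - I) (b - card I) (\<lambda>T. g (I \<union> T))"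
    if I: "I \<subseteq> V" "card I < b" for I
  proof (rule subset_sum_cong[OF refl refl])
    fix T assume T: "T \<subseteq> V - I" "card T = b - card I"
    have "finite I" "finite T" using I T assms(1) finite_subset by blast+
    hence "card (I \<union> T) = b" using I T by (subst card_Un_disjoint) auto
    thus "f (I \<union> T) = g (I \<union> T)" using I T by (intro assms(3)) auto
  qed
  thus ?thesis using assms(2) unfolding design_def by metis
qed

text \<open>
  The covering sums of \<open>f\<close> are unchanged under all permutations if and only if they are constant on the
  orbits, and the orbits are the subsets of each size.
\<close>

lemma design_almost_invariant_iff:
  fixes f :: "'a set \<Rightarrow> 'k::comm_ring_1"
  assumes V: "finite V" and bV: "b \<le> card V"
  shows "(\<forall>\<pi>. \<pi> permutes V \<longrightarrow> design V b (\<lambda>_. 0) (\<lambda>B. f (\<pi> ` B) - f B)) \<longleftrightarrow>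
    (\<exists>c. design V b (\<lambda>I. c (card I)) f)"
proof -
  define \<rho> where "\<rho> I = subset_sum (V - I) (b - card I) (\<lambda>T. f (I \<union> T))" for I
  have card: "card (\<pi> ` I) = card I" if "\<pi> permutes V" for \<pi> I
    using permutes_inj_on[OF that] by (simp add: card_image)
  have key: "design V b (\<lambda>_. 0) (\<lambda>B. f (\<pi> ` B) - f B) \<longleftrightarrow> (\<forall>I. I \<subseteq> V \<longrightarrow> card I < b \<longrightarrow> \<rho> (\<pi> ` I) = \<rho> I)"
    if \<pi>: "\<pi> permutes V" for \<pi>
    unfolding design_def subset_sum_diff \<rho>_def
    using subset_sum_permute[OF \<pi>, where f = f] card[OF \<pi>] by auto
  show ?thesis
  proof
    assume *: "\<forall>\<pi>. \<pi> permutes V \<longrightarrow> design V b (\<lambda>_. 0) (\<lambda>B. f (\<pi> ` B) - f B)"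
    have "\<exists>I. I \<subseteq> V \<and> card I = i" if "i < b" for i
      using obtain_subset_with_card_n[of i V] that bV by (metis le_trans less_imp_le)
    then obtain K where K: "\<And>i. i < b \<Longrightarrow> K i \<subseteq> V \<and> card (K i) = i" by metis
    have "\<rho> I = \<rho> (K (card I))" if I: "I \<subseteq> V" "card I < b" for I
    proof -
      obtain \<pi> where "\<pi> permutes V" "\<pi> ` K (card I) = I"
        using permutes_transitive_subsets[OF V, of "K (card I)" I] K[OF I(2)] I by auto
      thus ?thesis using * key[of \<pi>] K[OF I(2)] I by metis
    qed
    thus "\<exists>c. design V b (\<lambda>I. c (card I)) f"
      by (intro exI[of _ "\<lambda>i. \<rho> (K i)"]) (auto simp: design_def \<rho>_def)
  next
    assume "\<exists>c. design V b (\<lambda>I. c (card I)) f"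
    then obtain c where c: "\<And>I. I \<subseteq> V \<Longrightarrow> card I < b \<Longrightarrow> \<rho> I = c (card I)" by (auto simp: design_def \<rho>_def)
    show "\<forall>\<pi>. \<pi> permutes V \<longrightarrow> design V b (\<lambda>_. 0) (\<lambda>B. f (\<pi> ` B) - f B)"
    proof (intro allI impI)
      fix \<pi> assume \<pi>: "\<pi> permutes V"
      have "\<pi> ` I \<subseteq> V" if "I \<subseteq> V" for I using permutes_image[OF \<pi>] that by blast
      thus "design V b (\<lambda>_. 0) (\<lambda>B. f (\<pi> ` B) - f B)" unfolding key[OF \<pi>] using c card[OF \<pi>] by simp
    qed
  qed
qed

text \<open>
  For a family that depends only on the size, the sums in the consistency condition are binomial
  coefficients. The change of variable \<open>j = b - i\<close> makes \<open>n - i = a + j\<close> and removes \<open>b\<close> from the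
  coefficients.
\<close>

lemma consistent_weight_solution_iff:
  fixes c :: "nat \<Rightarrow> 'k::field"
  assumes "finite V" "card V = a + b" "b \<le> a"
  shows "consistent V b (\<lambda>I. c (card I)) \<longleftrightarrow> weight_solution a b (\<lambda>j. c (b - j))"
proof -
  have "consistent V b (\<lambda>I. c (card I)) \<longleftrightarrow>
    (\<forall>i s. i + s < b \<longrightarrow> of_nat ((a + b - i) choose s) * c (i + s) = of_nat ((b - i) choose s) * c i)"
  proof -
    have eq: "subset_sum (V - I) s (\<lambda>T. c (card (I \<union> T))) = of_nat ((a + b - card I) choose s) * c (card I + s)"
      if I: "I \<subseteq> V" for I s
    proof -
      have fI: "finite I" using I assms(1) finite_subset by blast
      have "subset_sum (V - I) s (\<lambda>T. c (card (I \<union> T))) = subset_sum (V - I) s (\<lambda>T. c (card I + s))"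
      proof (rule subset_sum_cong[OF refl refl])
        fix T assume T: "T \<subseteq> V - I" "card T = s"
        hence "finite T" using assms(1) finite_subset by blast
        thus "c (card (I \<union> T)) = c (card I + s)" using T fI by (subst card_Un_disjoint) auto
      qed
      thus ?thesis using assms I fI by (simp add: subset_sum_const card_Diff_subset)
    qed
    have ex: "\<exists>I. I \<subseteq> V \<and> card I = i" if "i < b" for i
      using obtain_subset_with_card_n[of i V] that assms(2) by auto
    show ?thesis
    proof
      assume *: "consistent V b (\<lambda>I. c (card I))"
      show "\<forall>i s. i + s < b \<longrightarrow> of_nat ((a + b - i) choose s) * c (i + s) = of_nat ((b - i) choose s) * c i"
      proof (intro allI impI)
        fix i s assume ib: "i + s < b"
        obtain I where I: "I \<subseteq> V" "card I = i" using ex[of i] ib by auto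
        have "subset_sum (V - I) s (\<lambda>T. c (card (I \<union> T))) = of_nat ((b - card I) choose s) * c (card I)"
          using * I ib by (simp add: consistent_def)
        thus "of_nat ((a + b - i) choose s) * c (i + s) = of_nat ((b - i) choose s) * c i"
          unfolding eq[OF I(1)] I(2) .
      qed
    next
      assume *: "\<forall>i s. i + s < b \<longrightarrow> of_nat ((a + b - i) choose s) * c (i + s) = of_nat ((b - i) choose s) * c i"
      show "consistent V b (\<lambda>I. c (card I))"
        unfolding consistent_def using * eq by simp
    qed
  qed
  also have "\<dots> \<longleftrightarrow> weight_solution a b (\<lambda>j. c (b - j))"
  proof
    assume *: "\<forall>i s. i + s < b \<longrightarrow> of_nat ((a + b - i) choose s) * c (i + s) = of_nat ((b - i) choose s) * c i"
    show "weight_solution a b (\<lambda>j. c (b - j))"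
      unfolding weight_solution_def
    proof (intro allI impI)
      fix l j :: nat assume lj: "1 \<le> l" "l \<le> j" "j \<le> b"
      have "b - j + (j - l) < b" "b - j + (j - l) = b - l" "a + b - (b - j) = a + j" "b - (b - j) = j"
        using lj by auto
      moreover have "j choose (j - l) = j choose l" by (rule binomial_symmetric[symmetric]) (use lj in simp)
      ultimately show "of_nat ((a + j) choose (j - l)) * c (b - l) = of_nat (j choose l) * c (b - j)"
        using *[rule_format, of "b - j" "j - l"] by simp
    qed
  next
    assume *: "weight_solution a b (\<lambda>j. c (b - j))"
    show "\<forall>i s. i + s < b \<longrightarrow> of_nat ((a + b - i) choose s) * c (i + s) = of_nat ((b - i) choose s) * c i"
    proof (intro allI impI)
      fix i s assume ib: "i + s < b"
      have "a + b - i = a + (b - i)" "b - i - (b - i - s) = s" "b - (b - i - s) = i + s" "b - (b - i) = i"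
        using ib by auto
      moreover have "(b - i) choose (b - i - s) = (b - i) choose s"
        by (rule binomial_symmetric[symmetric]) (use ib in simp)
      ultimately show "of_nat ((a + b - i) choose s) * c (i + s) = of_nat ((b - i) choose s) * c i"
        using weight_solutionD[OF *, of "b - i - s" "b - i"] ib by simp
    qed
  qed
  finally show ?thesis .
qed

theorem constant_design_iff:
  fixes c :: "nat \<Rightarrow> 'k::field"
  assumes "finite V" "card V = a + b" "b \<le> a"
  shows "(\<exists>f. design V b (\<lambda>I. c (card I)) f) \<longleftrightarrow> weight_solution a b (\<lambda>j. c (b - j))"
  unfolding consistent_weight_solution_iff[OF assms, symmetric]
proof
  assume "\<exists>f. design V b (\<lambda>I. c (card I)) f"
  thus "consistent V b (\<lambda>I. c (card I))" using design_consistent[OF assms(1)] by blast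
next
  assume "consistent V b (\<lambda>I. c (card I))"
  thus "\<exists>f. design V b (\<lambda>I. c (card I)) f"
    using assms by (intro consistent_extends) auto
qed

section \<open>Tabloids with two rows\<close>

definition second_row :: "nat \<Rightarrow> tableau \<Rightarrow> nat set"
  where "second_row b t = (\<lambda>j. t (1, j)) ` {..<b}"

text \<open>
  A tabloid of shape \<open>(a, b)\<close>, described as the set of all tableaux with a given second row.
\<close>

definition row_tabloid :: "nat \<Rightarrow> nat \<Rightarrow> nat set \<Rightarrow> tableau set"
  where "row_tabloid a b B = {t \<in> tableaux [a, b]. second_row b t = B}"

lemma diagram_two_rows: "diagram [a, b] = Pair 0 ` {..<a} \<union> Pair 1 ` {..<b}"
  by (auto simp: diagram_def less_Suc_eq nth_Cons split: nat.splits)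

lemma tableaux_two_rows:
  "t \<in> tableaux [a, b] \<longleftrightarrow> bij_betw t (diagram [a, b]) {1..a + b} \<and> (\<forall>x. x \<notin> diagram [a, b] \<longrightarrow> t x = 0)"
  by (simp add: tableaux_def)

lemma second_row_diagram: "second_row b t = t ` {x \<in> diagram [a, b]. fst x = 1}"
  by (auto simp: second_row_def diagram_two_rows image_iff)

lemma second_row_subset:
  assumes "t \<in> tableaux [a, b]"
  shows "second_row b t \<subseteq> {1..a + b}" "card (second_row b t) = b"
proof -
  have bij: "bij_betw t (diagram [a, b]) {1..a + b}" using assms by (simp add: tableaux_two_rows)
  thus "second_row b t \<subseteq> {1..a + b}"
    unfolding second_row_diagram[of b t a] bij_betw_def by auto
  have "inj_on (\<lambda>j. t (1, j)) {..<b}"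
    using bij by (auto simp: bij_betw_def inj_on_def diagram_two_rows)
  thus "card (second_row b t) = b" by (simp add: second_row_def card_image)
qed

lemma first_row:
  assumes "t \<in> tableaux [a, b]"
  shows "t ` {x \<in> diagram [a, b]. fst x = 0} = {1..a + b} - second_row b t"
proof -
  have bij: "inj_on t (diagram [a, b])" "t ` diagram [a, b] = {1..a + b}"
    using assms by (auto simp: tableaux_two_rows bij_betw_def)
  have "{x \<in> diagram [a, b]. fst x = 0} = diagram [a, b] - {x \<in> diagram [a, b]. fst x = 1}"
    by (auto simp: diagram_two_rows)
  hence "t ` {x \<in> diagram [a, b]. fst x = 0} = t ` diagram [a, b] - t ` {x \<in> diagram [a, b]. fst x = 1}"
    using inj_on_image_set_diff[OF bij(1), of "diagram [a, b]" "{x \<in> diagram [a, b]. fst x = 1}"] by auto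
  thus ?thesis by (simp add: bij(2) second_row_diagram[of b t a])
qed

lemma tableaux_permutes:
  assumes "t \<in> tableaux [a, b]" "\<pi> permutes {1..a + b}"
  shows "\<pi> \<circ> t \<in> tableaux [a, b]"
  using assms bij_betw_trans[OF _ permutes_imp_bij[OF assms(2)], of t "diagram [a, b]"]
  by (auto simp: tableaux_two_rows permutes_not_in)

lemma second_row_comp: "second_row b (\<pi> \<circ> t) = \<pi> ` second_row b t"
  by (auto simp: second_row_def)

text \<open>
  Two tableaux with the same second row have the same first row, so the permutation that carries one to
  the other stabilizes the rows.
\<close>

lemma tabloid_eq_row_tabloid:
  assumes t: "t \<in> tableaux [a, b]"
  shows "tabloid [a, b] t = row_tabloid a b (second_row b t)"
proof (intro equalityI subsetI)
  fix t' assume "t' \<in> tabloid [a, b] t"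
  then obtain \<pi> where \<pi>: "\<pi> \<in> row_stabilizer [a, b] t" "t' = \<pi> \<circ> t" by (auto simp: tabloid_def)
  hence "\<pi> permutes {1..a + b}" "\<pi> ` second_row b t = second_row b t"
    by (auto simp: row_stabilizer_def second_row_diagram[of b t a])
  thus "t' \<in> row_tabloid a b (second_row b t)"
    using tableaux_permutes[OF t] \<pi>(2) by (simp add: row_tabloid_def second_row_comp)
next
  fix t' assume "t' \<in> row_tabloid a b (second_row b t)"
  hence t': "t' \<in> tableaux [a, b]" "second_row b t' = second_row b t" by (auto simp: row_tabloid_def)
  let ?D = "diagram [a, b]" and ?V = "{1..a + b}"
  have bt: "bij_betw t ?D ?V" and bt': "bij_betw t' ?D ?V"
    and t0: "\<And>x. x \<notin> ?D \<Longrightarrow> t x = 0" and t0': "\<And>x. x \<notin> ?D \<Longrightarrow> t' x = 0"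
    using t t'(1) by (auto simp: tableaux_two_rows)
  define \<pi> where "\<pi> x = (if x \<in> ?V then t' (inv_into ?D t x) else x)" for x
  have "bij_betw (t' \<circ> inv_into ?D t) ?V ?V"
    by (rule bij_betw_trans[OF bij_betw_inv_into[OF bt] bt'])
  hence "bij_betw \<pi> ?V ?V" by (rule bij_betw_cong[THEN iffD1, rotated]) (simp add: \<pi>_def)
  hence perm: "\<pi> permutes ?V" by (rule bij_imp_permutes) (auto simp: \<pi>_def)
  have comp: "\<pi> (t x) = t' x" for x
  proof (cases "x \<in> ?D")
    case True
    hence "t x \<in> ?V" using bt by (auto simp: bij_betw_def)
    thus ?thesis using True bt by (simp add: \<pi>_def bij_betw_def)
  next
    case False
    thus ?thesis using t0 t0' by (simp add: \<pi>_def)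
  qed
  have "\<pi> ` t ` {x \<in> ?D. fst x = i} = t ` {x \<in> ?D. fst x = i}" for i
  proof -
    have "\<pi> ` t ` {x \<in> ?D. fst x = i} = t' ` {x \<in> ?D. fst x = i}" by (simp add: image_image comp)
    also have "\<dots> = t ` {x \<in> ?D. fst x = i}"
    proof -
      consider "i = 0" | "i = 1" | "{x \<in> ?D. fst x = i} = {}" by (cases "i > 1") (auto simp: diagram_two_rows)
      thus ?thesis
      proof cases
        case 1
        thus ?thesis using first_row[OF t] first_row[OF t'(1)] t'(2) by simp
      next
        case 2
        thus ?thesis using t'(2) by (simp add: second_row_diagram[of b _ a])
      next
        case 3
        show ?thesis unfolding 3 by simp
      qed
    qed
    finally show ?thesis .
  qed
  hence "\<pi> \<in> row_stabilizer [a, b] t" using perm by (simp add: row_stabilizer_def)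
  moreover have "t' = \<pi> \<circ> t" using comp by auto
  ultimately show "t' \<in> tabloid [a, b] t" by (auto simp: tabloid_def)
qed

lemma tableau_of_pairing:
  assumes "b \<le> a" and p: "pairing {1..a + b} b u w"
  obtains t where "t \<in> tableaux [a, b]" "\<And>j. j < b \<Longrightarrow> t (0, j) = u j" "\<And>j. j < b \<Longrightarrow> t (1, j) = w j"
proof -
  let ?V = "{1..a + b}" and ?U = "u ` {..<b}" and ?W = "w ` {..<b}" and ?C = "Pair (0::nat) ` {b..<a}"
  have uw: "inj_on u {..<b}" "inj_on w {..<b}" "?U \<inter> ?W = {}" "?U \<subseteq> ?V" "?W \<subseteq> ?V"
    using p by (auto simp: pairing_def)
  have "card (?V - (?U \<union> ?W)) = a + b - card (?U \<union> ?W)"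
    using uw by (subst card_Diff_subset) auto
  also have "card (?U \<union> ?W) = b + b" using uw by (subst card_Un_disjoint) (auto simp: card_image)
  finally have "card (?V - (?U \<union> ?W)) = card ?C"
    using assms(1) by (simp add: card_image inj_on_def)
  then obtain h where h: "bij_betw h ?C (?V - (?U \<union> ?W))"
    using finite_same_card_bij[of ?C "?V - (?U \<union> ?W)"] by auto
  define t where "t x = (if x \<in> ?C then h x else if x \<in> Pair 0 ` {..<b} then u (snd x)
    else if x \<in> Pair 1 ` {..<b} then w (snd x) else 0)" for x :: "nat \<times> nat"
  have dis: "?C \<inter> Pair 0 ` {..<b} = {}" "?C \<inter> Pair 1 ` {..<b} = {}" "Pair (0::nat) ` {..<b} \<inter> Pair 1 ` {..<b} = {}"
    by auto
  have b1: "bij_betw t ?C (?V - (?U \<union> ?W))"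
    using h by (rule bij_betw_cong[THEN iffD1, rotated]) (simp add: t_def)
  have tu: "t (0, j) = u j" "t (1, j) = w j" if "j < b" for j using that by (auto simp: t_def)
  have "inj_on (t \<circ> Pair 0) {..<b}" "inj_on (t \<circ> Pair 1) {..<b}"
    using uw(1,2) tu by (simp_all add: inj_on_def)
  hence "inj_on t (Pair 0 ` {..<b})" "inj_on t (Pair 1 ` {..<b})" by (blast intro: inj_on_imageI)+
  moreover have "t ` Pair 0 ` {..<b} = ?U" "t ` Pair 1 ` {..<b} = ?W"
    unfolding image_image using tu by (auto intro!: image_cong)
  ultimately have b2: "bij_betw t (Pair 0 ` {..<b}) ?U" and b3: "bij_betw t (Pair 1 ` {..<b}) ?W"
    unfolding bij_betw_def by blast+
  have "bij_betw t (Pair 0 ` {..<b} \<union> Pair 1 ` {..<b}) (?U \<union> ?W)"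
    using bij_betw_combine[OF b2 b3] uw(3) by blast
  hence "bij_betw t (?C \<union> (Pair 0 ` {..<b} \<union> Pair 1 ` {..<b})) (?V - (?U \<union> ?W) \<union> (?U \<union> ?W))"
    by (intro bij_betw_combine[OF b1]) auto
  moreover have "?C \<union> (Pair 0 ` {..<b} \<union> Pair 1 ` {..<b}) = diagram [a, b]"
    using assms(1) by (auto simp: diagram_two_rows image_iff)
  moreover have "?V - (?U \<union> ?W) \<union> (?U \<union> ?W) = ?V" using uw by auto
  ultimately have bij: "bij_betw t (diagram [a, b]) ?V" by simp
  have "t x = 0" if "x \<notin> diagram [a, b]" for x
    using that assms(1) by (auto simp: t_def diagram_two_rows)
  hence "t \<in> tableaux [a, b]" using bij by (simp add: tableaux_two_rows)
  thus ?thesis using tu that by blast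
qed

lemma pairing_of_tableau:
  assumes "b \<le> a" "t \<in> tableaux [a, b]"
  shows "pairing {1..a + b} b (\<lambda>j. t (0, j)) (\<lambda>j. t (1, j))"
proof -
  have inj: "inj_on t (diagram [a, b])" and im: "t ` diagram [a, b] = {1..a + b}"
    using assms(2) by (auto simp: tableaux_two_rows bij_betw_def)
  have mem: "(0, j) \<in> diagram [a, b]" "(1, j) \<in> diagram [a, b]" if "j < b" for j
    using that assms(1) by (auto simp: diagram_two_rows)
  have "inj_on (\<lambda>j. t (0, j)) {..<b}" "inj_on (\<lambda>j. t (1, j)) {..<b}"
    by (auto intro!: inj_onI dest!: inj_onD[OF inj _ mem(1) mem(1)] inj_onD[OF inj _ mem(2) mem(2)] simp del: One_nat_def)
  moreover have "t (0, i) \<noteq> t (1, j)" if "i < b" "j < b" for i j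
    using inj_onD[OF inj _ mem(1)[OF that(1)] mem(2)[OF that(2)]] by auto
  moreover have "t (0, j) \<in> {1..a + b}" "t (1, j) \<in> {1..a + b}" if "j < b" for j
    using mem[OF that] im by blast+
  ultimately show ?thesis unfolding pairing_def by blast
qed

lemma row_tabloid_nonempty:
  assumes "b \<le> a" "B \<subseteq> {1..a + b}" "card B = b"
  shows "row_tabloid a b B \<noteq> {}"
proof -
  have fB: "finite B" using assms(2) finite_subset by blast
  obtain w where w: "bij_betw w {..<b} B"
    using finite_same_card_bij[of "{..<b}" B] fB assms(3) by auto
  have "card ({1..a + b} - B) = a" using assms fB by (simp add: card_Diff_subset)
  then obtain u where u: "bij_betw u {..<a} ({1..a + b} - B)"
    using finite_same_card_bij[of "{..<a}" "{1..a + b} - B"] by auto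
  have "inj_on u {..<b}" "u ` {..<b} \<subseteq> {1..a + b} - B"
    using u assms(1) by (auto simp: bij_betw_def intro: inj_on_subset)
  hence "pairing {1..a + b} b u w" using w assms(2) by (auto simp: pairing_def bij_betw_def)
  from tableau_of_pairing[OF assms(1) this] obtain t where
    t: "t \<in> tableaux [a, b]" "\<And>j. j < b \<Longrightarrow> t (1, j) = w j" by metis
  have "second_row b t = w ` {..<b}" unfolding second_row_def using t(2) by (intro image_cong) auto
  hence "t \<in> row_tabloid a b B" using t(1) w by (simp add: row_tabloid_def bij_betw_def)
  thus ?thesis by blast
qed

lemma row_tabloid_inj:
  assumes "b \<le> a" "B \<subseteq> {1..a + b}" "card B = b" "row_tabloid a b B = row_tabloid a b B'"
  shows "B = B'"
  using row_tabloid_nonempty[OF assms(1-3)] assms(4) by (auto simp: row_tabloid_def)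

lemma tabloids_two_rows:
  assumes "b \<le> a"
  shows "tabloids [a, b] = row_tabloid a b ` {B. B \<subseteq> {1..a + b} \<and> card B = b}"
proof (intro equalityI subsetI)
  fix T assume "T \<in> tabloids [a, b]"
  then obtain t where t: "t \<in> tableaux [a, b]" "T = tabloid [a, b] t" by (auto simp: tabloids_def)
  thus "T \<in> row_tabloid a b ` {B. B \<subseteq> {1..a + b} \<and> card B = b}"
    using second_row_subset[OF t(1)] tabloid_eq_row_tabloid[OF t(1)] by blast
next
  fix T assume "T \<in> row_tabloid a b ` {B. B \<subseteq> {1..a + b} \<and> card B = b}"
  then obtain B where B: "B \<subseteq> {1..a + b}" "card B = b" "T = row_tabloid a b B" by blast
  obtain t where "t \<in> row_tabloid a b B" using row_tabloid_nonempty[OF assms B(1,2)] by blast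
  hence "t \<in> tableaux [a, b]" "tabloid [a, b] t = T"
    using B(3) tabloid_eq_row_tabloid by (auto simp: row_tabloid_def)
  thus "T \<in> tabloids [a, b]" by (auto simp: tabloids_def)
qed

lemma row_tabloid_action:
  assumes "\<pi> permutes {1..a + b}"
  shows "(\<lambda>t. \<pi> \<circ> t) ` row_tabloid a b B = row_tabloid a b (\<pi> ` B)"
proof (intro equalityI subsetI)
  fix t assume "t \<in> (\<lambda>t. \<pi> \<circ> t) ` row_tabloid a b B"
  thus "t \<in> row_tabloid a b (\<pi> ` B)"
    using tableaux_permutes[OF _ assms] by (auto simp: row_tabloid_def second_row_comp)
next
  fix t assume t: "t \<in> row_tabloid a b (\<pi> ` B)"
  have inv: "inv' \<pi> permutes {1..a + b}" by (rule permutes_inv[OF assms])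
  have "inv' \<pi> ` \<pi> ` B = B" using permutes_inv_o(2)[OF assms] by (simp add: image_comp)
  hence "inv' \<pi> \<circ> t \<in> row_tabloid a b B"
    using t tableaux_permutes[OF _ inv] by (auto simp: row_tabloid_def second_row_comp)
  moreover have "t = \<pi> \<circ> (inv' \<pi> \<circ> t)" using permutes_inv_o(1)[OF assms] by (simp add: comp_assoc[symmetric])
  ultimately show "t \<in> (\<lambda>t. \<pi> \<circ> t) ` row_tabloid a b B" by blast
qed

section \<open>Polytabloids with two rows\<close>

text \<open>
  The permutation that exchanges the entries of the columns with index in \<open>J\<close>. It is characterized by its
  values, since only these and its sign are used.
\<close>

lemma swap_permutation_exists:
  assumes p: "pairing V b u w" and J: "finite J" "J \<subseteq> {..<b}"
  shows "\<exists>\<pi>. \<pi> permutes V \<and> permutation \<pi> \<and> sign \<pi> = (-1) ^ card J \<and>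
    (\<forall>j<b. \<pi> (u j) = (if j \<in> J then w j else u j) \<and> \<pi> (w j) = (if j \<in> J then u j else w j)) \<and>
    (\<forall>x. x \<notin> u ` {..<b} \<union> w ` {..<b} \<longrightarrow> \<pi> x = x)"
  using J
proof (induction J rule: finite_induct)
  case empty
  show ?case by (rule exI[of _ id], intro conjI permutes_id permutation_id) (simp_all add: sign_id)
next
  case (insert i J)
  then obtain \<pi> where \<pi>: "\<pi> permutes V" "permutation \<pi>" "sign \<pi> = (-1) ^ card J"
    "\<And>j. j < b \<Longrightarrow> \<pi> (u j) = (if j \<in> J then w j else u j)"
    "\<And>j. j < b \<Longrightarrow> \<pi> (w j) = (if j \<in> J then u j else w j)"
    "\<And>x. x \<notin> u ` {..<b} \<union> w ` {..<b} \<Longrightarrow> \<pi> x = x" by blast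
  have i: "i < b" using insert by auto
  have uw: "u i \<in> V" "w i \<in> V" "u i \<noteq> w i" using p i by (auto simp: pairing_def)
  let ?t = "transpose (u i) (w i)"
  have other: "?t (u j) = u j" "?t (w j) = w j" if "j < b" "j \<noteq> i" for j
  proof -
    have "u j \<noteq> u i" "u j \<noteq> w i" "w j \<noteq> u i" "w j \<noteq> w i"
      using p that i by (auto simp: pairing_def inj_on_def disjoint_iff)
    thus "?t (u j) = u j" "?t (w j) = w j" by (simp_all add: transpose_apply_other)
  qed
  have "?t \<circ> \<pi> permutes V" using permutes_compose[OF \<pi>(1) permutes_swap_id[OF uw(1,2)]] .
  moreover have "permutation (?t \<circ> \<pi>)" by (intro permutation_compose permutation_swap_id \<pi>(2))
  moreover have "sign (?t \<circ> \<pi>) = (-1) ^ card (insert i J)"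
    using sign_compose[OF permutation_swap_id \<pi>(2), of "u i" "w i"] insert.hyps uw \<pi>(3) by (simp add: sign_swap_id)
  moreover have "(?t \<circ> \<pi>) (u j) = (if j \<in> insert i J then w j else u j) \<and>
      (?t \<circ> \<pi>) (w j) = (if j \<in> insert i J then u j else w j)" if "j < b" for j
    using \<pi>(4,5)[OF that] other[OF that] insert.hyps(2) by (cases "j = i") auto
  moreover have "(?t \<circ> \<pi>) x = x" if "x \<notin> u ` {..<b} \<union> w ` {..<b}" for x
    using \<pi>(6)[OF that] that i by (auto simp: transpose_def)
  ultimately show ?case by blast
qed

lemma column_two_rows:
  assumes "b \<le> a"
  shows "j < b \<Longrightarrow> {x \<in> diagram [a, b]. snd x = j} = {(0, j), (1, j)}"
    and "b \<le> j \<Longrightarrow> j < a \<Longrightarrow> {x \<in> diagram [a, b]. snd x = j} = {(0, j)}"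
    and "a \<le> j \<Longrightarrow> {x \<in> diagram [a, b]. snd x = j} = {}"
  using assms by (auto simp: diagram_two_rows)

text \<open>
  The column stabilizer consists of the permutations that exchange the entries of the columns in a set
  \<open>J\<close>. Expanding the product of differences over subsets \<open>J\<close> gives the same sum: the summand of \<open>J\<close> is
  nonzero if and only if all entries that \<open>J\<close> puts into the second row lie in \<open>B\<close>, and then they are
  all of \<open>B\<close> because both sets have \<open>b\<close> elements.
\<close>

lemma polytabloid_two_rows:
  assumes ab: "b \<le> a" and t: "t \<in> tableaux [a, b]" and B: "B \<subseteq> {1..a + b}" "card B = b"
  shows "polytabloid [a, b] t (row_tabloid a b B) =
    (pair_product b (\<lambda>j. t (0, j)) (\<lambda>j. t (1, j)) B :: 'k::field)"
proof -
  let ?V = "{1..a + b}" and ?D = "diagram [a, b]"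
  define u w where "u = (\<lambda>j. t (0, j))" and "w = (\<lambda>j. t (1, j))"
  let ?UW = "u ` {..<b} \<union> w ` {..<b}"
  have p: "pairing ?V b u w" using pairing_of_tableau[OF ab t] unfolding u_def w_def .
  have im: "t ` ?D = ?V" using t by (auto simp: tableaux_two_rows bij_betw_def)
  have fB: "finite B" using B finite_subset by blast
  define good where "good J \<pi> \<longleftrightarrow> \<pi> permutes ?V \<and> permutation \<pi> \<and> sign \<pi> = (-1) ^ card J \<and>
    (\<forall>j<b. \<pi> (u j) = (if j \<in> J then w j else u j) \<and> \<pi> (w j) = (if j \<in> J then u j else w j)) \<and>
    (\<forall>x. x \<notin> ?UW \<longrightarrow> \<pi> x = x)" for J \<pi>
  \<comment> \<open>\<open>sw J\<close> exchanges the entries of the columns in \<open>J\<close>\<close>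
  define sw where "sw J = (SOME \<pi>. good J \<pi>)" for J
  have good: "good J (sw J)" if "J \<in> Pow {..<b}" for J
  proof -
    have "\<exists>\<pi>. good J \<pi>" unfolding good_def
      using that by (intro swap_permutation_exists[OF p]) (auto intro: finite_subset)
    thus ?thesis unfolding sw_def by (rule someI_ex)
  qed
  have uw_neq: "u j \<noteq> w j" if "j < b" for j using p that by (auto simp: pairing_def)
  have colj: "t ` {x \<in> ?D. snd x = j} = {u j, w j}" if "j < b" for j
    using column_two_rows(1)[OF ab that] by (auto simp: u_def w_def)
  have colj': "t ` {x \<in> ?D. snd x = j} = {t (0, j)}" if "b \<le> j" "j < a" for j
    using column_two_rows(2)[OF ab that] by auto
  have rest: "t (0, j) \<notin> ?UW" if "b \<le> j" "j < a" for j
  proof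
    assume "t (0, j) \<in> ?UW"
    then obtain i r where i: "i < b" "t (0, j) = t (r, i)" "r = 0 \<or> r = 1" by (auto simp: u_def w_def)
    define x where "x = (r, i)"
    have x: "x \<in> ?D" "t (0, j) = t x" "snd x < b" using i ab by (auto simp: x_def diagram_two_rows)
    have "inj_on t ?D" "(0, j) \<in> ?D" using t that by (auto simp: tableaux_two_rows bij_betw_def diagram_two_rows)
    hence "(0, j) = x" using x by (auto dest: inj_onD)
    thus False using x(3) that by auto
  qed
  have col: "column_stabilizer [a, b] t = sw ` Pow {..<b}"
  proof (intro equalityI subsetI)
    fix \<pi> assume "\<pi> \<in> column_stabilizer [a, b] t"
    hence perm: "\<pi> permutes ?V" and st: "\<And>j. \<pi> ` t ` {x \<in> ?D. snd x = j} = t ` {x \<in> ?D. snd x = j}"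
      by (auto simp: column_stabilizer_def)
    define J where "J = {j. j < b \<and> \<pi> (u j) = w j}"
    have J: "J \<in> Pow {..<b}" by (auto simp: J_def)
    have "\<pi> x = sw J x" for x
    proof -
      consider j where "j < b" "x = u j \<or> x = w j" | j where "b \<le> j" "j < a" "x = t (0, j)" | "x \<notin> ?V"
      proof (cases "x \<in> ?V")
        case True
        then obtain y where y: "y \<in> ?D" "x = t y" using im by blast
        show ?thesis
        proof (cases "snd y < b")
          case True
          thus ?thesis using that(1)[of "snd y"] y by (auto simp: diagram_two_rows u_def w_def)
        next
          case False
          thus ?thesis using that(2)[of "snd y"] y by (auto simp: diagram_two_rows)
        qed
      qed (use that in blast)
      thus ?thesis
      proof cases
        case 1
        have im: "{\<pi> (u j), \<pi> (w j)} = {u j, w j}" using st[of j] colj[OF 1(1)] by simp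
        have g: "sw J (u j) = (if j \<in> J then w j else u j)" "sw J (w j) = (if j \<in> J then u j else w j)"
          using good[OF J] 1(1) by (auto simp: good_def)
        show ?thesis
        proof (cases "j \<in> J")
          case True
          hence "\<pi> (u j) = w j" by (simp add: J_def)
          hence "\<pi> (w j) = u j" using im uw_neq[OF 1(1)] by (metis doubleton_eq_iff)
          thus ?thesis using True g 1(2) \<open>\<pi> (u j) = w j\<close> by auto
        next
          case False
          hence "\<pi> (u j) \<noteq> w j" using 1(1) by (simp add: J_def)
          hence "\<pi> (u j) = u j" "\<pi> (w j) = w j" using im by (auto simp: doubleton_eq_iff)
          thus ?thesis using False g 1(2) by auto
        qed
      next
        case 2
        have "\<pi> x = x" using st[of j] colj'[OF 2(1,2)] 2(3) by simp
        moreover have "sw J x = x" using good[OF J] rest[OF 2(1,2)] 2(3) by (auto simp: good_def)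
        ultimately show ?thesis by simp
      next
        case 3
        have swJ: "sw J permutes ?V" using good[OF J] unfolding good_def by blast
        show ?thesis unfolding permutes_not_in[OF perm 3] permutes_not_in[OF swJ 3] ..
      qed
    qed
    thus "\<pi> \<in> sw ` Pow {..<b}" using J by blast
  next
    fix \<pi> assume "\<pi> \<in> sw ` Pow {..<b}"
    then obtain J where J: "J \<in> Pow {..<b}" "\<pi> = sw J" by blast
    hence g: "\<pi> permutes ?V"
      "\<And>j. j < b \<Longrightarrow> \<pi> (u j) = (if j \<in> J then w j else u j)"
      "\<And>j. j < b \<Longrightarrow> \<pi> (w j) = (if j \<in> J then u j else w j)"
      "\<And>x. x \<notin> ?UW \<Longrightarrow> \<pi> x = x" using good[OF J(1)] by (auto simp: good_def)
    have "\<pi> ` t ` {x \<in> ?D. snd x = j} = t ` {x \<in> ?D. snd x = j}" for j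
    proof -
      consider "j < b" | "b \<le> j" "j < a" | "a \<le> j" by linarith
      thus ?thesis
      proof cases
        case 1
        thus ?thesis using g(2,3)[OF 1] by (auto simp: colj)
      next
        case 2
        thus ?thesis using g(4)[OF rest[OF 2]] colj'[OF 2] by simp
      next
        case 3
        show ?thesis unfolding column_two_rows(3)[OF ab 3] by simp
      qed
    qed
    thus "\<pi> \<in> column_stabilizer [a, b] t" using g(1) by (simp add: column_stabilizer_def)
  qed
  have inj: "inj_on sw (Pow {..<b})"
  proof (rule inj_onI)
    fix J J' assume J: "J \<in> Pow {..<b}" "J' \<in> Pow {..<b}" "sw J = sw J'"
    have "j \<in> J \<longleftrightarrow> sw J (u j) = w j" "j \<in> J' \<longleftrightarrow> sw J' (u j) = w j" if "j < b" for j
      using good[OF J(1)] good[OF J(2)] that uw_neq[OF that] by (auto simp: good_def)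
    thus "J = J'" using J by (auto simp: subset_iff)
  qed
  have R: "second_row b t = w ` {..<b}" by (simp add: second_row_def w_def)
  have summand: "(if tabloid [a, b] (sw J \<circ> t) = row_tabloid a b B then of_int (sign (sw J)) else 0 :: 'k)
     = (-1) ^ card J * (\<Prod>j\<in>J. of_bool (u j \<in> B)) * (\<Prod>j\<in>{..<b} - J. of_bool (w j \<in> B))"
    if J: "J \<in> Pow {..<b}" for J
  proof -
    have g: "sw J permutes ?V" "sign (sw J) = (-1) ^ card J"
      "\<And>j. j < b \<Longrightarrow> sw J (w j) = (if j \<in> J then u j else w j)" using good[OF J] by (auto simp: good_def)
    have sr: "second_row b (sw J \<circ> t) = sw J ` w ` {..<b}" by (simp add: second_row_comp R)
    have tab: "sw J \<circ> t \<in> tableaux [a, b]" by (rule tableaux_permutes[OF t g(1)])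
    have "tabloid [a, b] (sw J \<circ> t) = row_tabloid a b B \<longleftrightarrow> sw J ` w ` {..<b} = B"
      unfolding tabloid_eq_row_tabloid[OF tab] sr
      using row_tabloid_inj[OF ab B, of "sw J ` w ` {..<b}"] by metis
    also have "\<dots> \<longleftrightarrow> sw J ` w ` {..<b} \<subseteq> B"
      using second_row_subset(2)[OF tab] unfolding sr using card_subset_eq[OF fB] B(2) by blast
    also have "\<dots> \<longleftrightarrow> (\<forall>j\<in>J. u j \<in> B) \<and> (\<forall>j\<in>{..<b} - J. w j \<in> B)"
      using g(3) J by (auto simp: image_subset_iff)
    finally have eq: "tabloid [a, b] (sw J \<circ> t) = row_tabloid a b B \<longleftrightarrow>
      (\<forall>j\<in>J. u j \<in> B) \<and> (\<forall>j\<in>{..<b} - J. w j \<in> B)" .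
    have prod: "(\<Prod>j\<in>A. of_bool (P j)) = (of_bool (\<forall>j\<in>A. P j) :: 'k)" if "finite A" for A :: "nat set" and P
      using that by (induction A rule: finite_induct) auto
    have fJ: "finite J" using J finite_subset by blast
    show ?thesis unfolding eq g(2) prod[OF fJ] prod[OF finite_Diff[OF finite_lessThan]] by auto
  qed
  have "row_tabloid a b B \<in> tabloids [a, b]" using tabloids_two_rows[OF ab] B by blast
  hence "polytabloid [a, b] t (row_tabloid a b B)
     = (\<Sum>\<pi>\<in>sw ` Pow {..<b}. if tabloid [a, b] (\<pi> \<circ> t) = row_tabloid a b B then of_int (sign \<pi>) else 0 :: 'k)"
    by (simp add: polytabloid_def col)
  also have "\<dots> = (\<Sum>J\<in>Pow {..<b}. (-1) ^ card J * (\<Prod>j\<in>J. of_bool (u j \<in> B)) * (\<Prod>j\<in>{..<b} - J. of_bool (w j \<in> B)))"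
    unfolding sum.reindex[OF inj] o_def by (intro sum.cong refl summand[unfolded o_def])
  also have "\<dots> = pair_product b u w B"
    unfolding pair_product_def by (rule prod_diff_conv_sum[symmetric]) simp
  finally show ?thesis by (simp add: u_def w_def)
qed

section \<open>The Specht module as a kernel\<close>

lemma module_perm_rep: "module class_ring (perm_rep G X \<phi> :: ('k::field, 'x \<Rightarrow> 'k, 'g) kG_module)"
proof (rule module_criteria, unfold perm_rep_simps)
  show "cring (class_ring :: 'k ring)" using class_field[where 'a = 'k] unfolding field_def domain_def by blast
  show "\<forall>v\<in>X \<rightarrow>\<^sub>E (UNIV :: 'k set). \<exists>neg_v\<in>X \<rightarrow>\<^sub>E UNIV. (\<lambda>x\<in>X. v x + neg_v x) = (\<lambda>x\<in>X. 0)"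
  proof
    fix v :: "'x \<Rightarrow> 'k"
    show "\<exists>neg_v\<in>X \<rightarrow>\<^sub>E UNIV. (\<lambda>x\<in>X. v x + neg_v x) = (\<lambda>x\<in>X. 0)"
      by (intro bexI[of _ "\<lambda>x\<in>X. - v x"]) auto
  qed
  show "\<forall>v\<in>X \<rightarrow>\<^sub>E (UNIV :: 'k set). (\<lambda>x\<in>X. v x + (\<lambda>x\<in>X. 0) x) = v"
    "\<forall>v\<in>X \<rightarrow>\<^sub>E (UNIV :: 'k set). (\<lambda>x\<in>X. \<one>\<^bsub>class_ring\<^esub> * v x) = v"
    by (auto simp: PiE_iff extensional_def fun_eq_iff)
qed (auto simp: algebra_simps)

text \<open>
  The second row of a tabloid, read off from any of its tableaux.
\<close>

definition row_set :: "nat \<Rightarrow> tableau set \<Rightarrow> nat set"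
  where "row_set b T = second_row b (SOME t. t \<in> T)"

lemma row_set_row_tabloid:
  assumes "b \<le> a" "B \<subseteq> {1..a + b}" "card B = b"
  shows "row_set b (row_tabloid a b B) = B"
  using some_in_eq[of "row_tabloid a b B"] row_tabloid_nonempty[OF assms]
  by (auto simp: row_set_def row_tabloid_def)

lemma polytabloid_restrict:
  assumes ab: "b \<le> a" and t: "t \<in> tableaux [a, b]"
  shows "(polytabloid [a, b] t :: _ \<Rightarrow> 'k::field) =
    (\<lambda>T\<in>tabloids [a, b]. pair_product b (\<lambda>j. t (0, j)) (\<lambda>j. t (1, j)) (row_set b T))"
proof
  fix T
  show "polytabloid [a, b] t T = (\<lambda>T\<in>tabloids [a, b]. pair_product b (\<lambda>j. t (0, j)) (\<lambda>j. t (1, j)) (row_set b T) :: 'k) T"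
  proof (cases "T \<in> tabloids [a, b]")
    case True
    then obtain B where B: "B \<subseteq> {1..a + b}" "card B = b" "T = row_tabloid a b B"
      unfolding tabloids_two_rows[OF ab] by blast
    thus ?thesis using True polytabloid_two_rows[OF ab t B(1,2)] row_set_row_tabloid[OF ab B(1,2)] by simp
  qed (simp add: polytabloid_def)
qed

text \<open>
  Both inclusions are statements about pair products, since these are the coefficients of polytabloids
  and every pairing of points occurs in a tableau.
\<close>

theorem specht_module_two_rows:
  assumes ab: "b \<le> a" and two: "(2::'k::field) \<noteq> 0"
  shows "carrier (specht_module [a, b] :: ('k, tableau set \<Rightarrow> 'k, nat \<Rightarrow> nat) kG_module) =
    {v \<in> extensional (tabloids [a, b]). design {1..a + b} b (\<lambda>_. 0) (\<lambda>B. v (row_tabloid a b B))}"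
    (is "_ = ?K")
proof -
  let ?M = "tabloid_module [a, b] :: ('k, tableau set \<Rightarrow> 'k, nat \<Rightarrow> nat) kG_module"
  let ?X = "tabloids [a, b]" and ?V = "{1..a + b}"
  let ?P = "polytabloid [a, b] ` tableaux [a, b] :: (tableau set \<Rightarrow> 'k) set"
  interpret M: Module.module class_ring ?M unfolding tabloid_module_def by (rule module_perm_rep)
  have Mcarrier: "carrier ?M = ?X \<rightarrow>\<^sub>E UNIV" by (simp add: tabloid_module_def perm_rep_simps)
  have Madd: "f \<oplus>\<^bsub>?M\<^esub> h = (\<lambda>x\<in>?X. f x + h x)" for f h by (simp add: tabloid_module_def perm_rep_simps)
  have Mzero: "\<zero>\<^bsub>?M\<^esub> = (\<lambda>x\<in>?X. 0)" by (simp add: tabloid_module_def perm_rep_simps)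
  have Msmult: "c \<odot>\<^bsub>?M\<^esub> f = (\<lambda>x\<in>?X. c * f x)" for c f by (simp add: tabloid_module_def perm_rep_simps)
  have mem: "row_tabloid a b B \<in> ?X" if "B \<subseteq> ?V" "card B = b" for B
    using that unfolding tabloids_two_rows[OF ab] by blast
  have cong: "design ?V b (\<lambda>_. 0) f \<longleftrightarrow> design ?V b (\<lambda>_. 0) g"
    if "\<And>B. B \<subseteq> ?V \<Longrightarrow> card B = b \<Longrightarrow> f B = g B" for f g :: "nat set \<Rightarrow> 'k"
    using that by (intro design_cong) auto
  have sub: "LinearCombinations.submodule class_ring ?K ?M"
  proof (rule LinearCombinations.submodule.intro)
    show "v \<oplus>\<^bsub>?M\<^esub> w \<in> ?K" if vw: "v \<in> ?K" "w \<in> ?K" for v w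
    proof -
      have "design ?V b (\<lambda>_. 0) (\<lambda>B. v (row_tabloid a b B) + w (row_tabloid a b B))"
        using vw by (simp add: design_def subset_sum_add)
      also have "?this \<longleftrightarrow> design ?V b (\<lambda>_. 0) (\<lambda>B. (\<lambda>x\<in>?X. v x + w x) (row_tabloid a b B))"
        using mem by (intro cong) simp
      finally show ?thesis by (simp add: Madd)
    qed
    show "c \<odot>\<^bsub>?M\<^esub> v \<in> ?K" if v: "v \<in> ?K" for c v
    proof -
      have "design ?V b (\<lambda>_. 0) (\<lambda>B. c * v (row_tabloid a b B))"
        using v by (simp add: design_def subset_sum_mult)
      also have "?this \<longleftrightarrow> design ?V b (\<lambda>_. 0) (\<lambda>B. (\<lambda>x\<in>?X. c * v x) (row_tabloid a b B))"
        using mem by (intro cong) simp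
      finally show ?thesis by (simp add: Msmult)
    qed
    have "design ?V b (\<lambda>_. 0) (\<lambda>B. 0 :: 'k)" by (simp add: design_def subset_sum_def)
    also have "?this \<longleftrightarrow> design ?V b (\<lambda>_. 0) (\<lambda>B. (\<lambda>x\<in>?X. 0 :: 'k) (row_tabloid a b B))"
      using mem by (intro cong) simp
    finally show "\<zero>\<^bsub>?M\<^esub> \<in> ?K" by (simp add: Mzero)
  qed (auto simp: Mcarrier PiE_def M.module_axioms)
  have pt: "?P \<subseteq> ?K"
  proof
    fix v assume "v \<in> ?P"
    then obtain t where t: "t \<in> tableaux [a, b]" "v = polytabloid [a, b] t" by blast
    have "design ?V b (\<lambda>_. 0) (pair_product b (\<lambda>j. t (0, j)) (\<lambda>j. t (1, j)) :: _ \<Rightarrow> 'k)"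
      using pairing_of_tableau[OF ab t(1)] two by (intro pair_product_kernel) auto
    also have "?this \<longleftrightarrow> design ?V b (\<lambda>_. 0) (\<lambda>B. v (row_tabloid a b B))"
      unfolding t(2) by (intro cong polytabloid_two_rows[OF ab t(1), symmetric])
    finally show "v \<in> ?K" using t(2) by (simp add: polytabloid_def)
  qed
  have "?K \<subseteq> M.span ?P"
  proof
    fix v assume v: "v \<in> ?K"
    have PM: "?P \<subseteq> carrier ?M" by (auto simp: Mcarrier polytabloid_def)
    interpret sp: LinearCombinations.submodule class_ring "M.span ?P" ?M by (rule M.span_is_submodule[OF PM])
    have lift: "(\<lambda>T\<in>?X. h (row_set b T)) \<in> M.span ?P" if "pair_span ?V b h" for h :: "nat set \<Rightarrow> 'k"
      using that
    proof (induction rule: pair_span.induct)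
      case zero
      show ?case using sp.zero_closed unfolding Mzero .
    next
      case (step h u w c)
      obtain t where t: "t \<in> tableaux [a, b]" "\<And>j. j < b \<Longrightarrow> t (0, j) = u j" "\<And>j. j < b \<Longrightarrow> t (1, j) = w j"
        using tableau_of_pairing[OF ab step.hyps(2)] by metis
      have "polytabloid [a, b] t \<in> M.span ?P" using M.in_own_span[OF PM] t(1) by blast
      hence "c \<odot>\<^bsub>?M\<^esub> polytabloid [a, b] t \<in> M.span ?P" by (intro sp.smult_closed) simp_all
      hence "(\<lambda>T\<in>?X. h (row_set b T)) \<oplus>\<^bsub>?M\<^esub> (c \<odot>\<^bsub>?M\<^esub> polytabloid [a, b] t) \<in> M.span ?P"
        by (rule sp.m_closed[OF step.IH])
      moreover have "pair_product b (\<lambda>j. t (0, j)) (\<lambda>j. t (1, j)) = (pair_product b u w :: _ \<Rightarrow> 'k)"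
        unfolding pair_product_def using t(2,3) by (intro ext prod.cong) auto
      hence "(\<lambda>T\<in>?X. h (row_set b T)) \<oplus>\<^bsub>?M\<^esub> (c \<odot>\<^bsub>?M\<^esub> polytabloid [a, b] t)
          = (\<lambda>T\<in>?X. h (row_set b T) + c * pair_product b u w (row_set b T))"
        unfolding Madd Msmult polytabloid_restrict[OF ab t(1)] by (intro ext) simp
      ultimately show ?case by (simp only:)
    qed
    have "\<exists>h. pair_span ?V b h \<and> (\<forall>B. B \<subseteq> ?V \<longrightarrow> card B = b \<longrightarrow> v (row_tabloid a b B) = h B)"
      using v ab by (intro kernel_pair_span two) simp_all
    then obtain h where h: "pair_span ?V b h" "\<And>B. B \<subseteq> ?V \<Longrightarrow> card B = b \<Longrightarrow> v (row_tabloid a b B) = h B"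
      by blast
    have "v = (\<lambda>T\<in>?X. h (row_set b T))"
    proof (rule extensionalityI)
      fix T assume "T \<in> ?X"
      moreover then obtain B where B: "B \<subseteq> ?V" "card B = b" "T = row_tabloid a b B"
        unfolding tabloids_two_rows[OF ab] by blast
      ultimately show "v T = (\<lambda>T\<in>?X. h (row_set b T)) T"
        using h(2)[OF B(1,2)] row_set_row_tabloid[OF ab B(1,2)] by simp
    qed (use v in auto)
    thus "v \<in> M.span ?P" using lift[OF h(1)] by (simp only:)
  qed
  moreover have "M.span ?P \<subseteq> ?K" by (rule M.span_is_subset[OF pt sub])
  ultimately show ?thesis by (simp add: specht_module_def)
qed

section \<open>First cohomology of two-row Specht modules\<close>

context
  fixes a b :: nat
  assumes ab: "b \<le> a"
begin

abbreviation (input) points where "points \<equiv> {1..a + b}"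
abbreviation (input) tab where "tab \<equiv> row_tabloid a b"
abbreviation (input) move where "move \<equiv> (\<lambda>\<pi> T. (\<lambda>t. \<pi> \<circ> t) ` T) :: (nat \<Rightarrow> nat) \<Rightarrow> tableau set \<Rightarrow> tableau set"

lemma move_tab:
  assumes "\<pi> permutes points"
  shows "move \<pi> (tab B) = tab (\<pi> ` B)"
  by (rule row_tabloid_action[OF assms])

lemma permutes_subset_card:
  assumes "\<pi> permutes points" "B \<subseteq> points" "card B = b"
  shows "\<pi> ` B \<subseteq> points" "card (\<pi> ` B) = b"
  using permutes_image[OF assms(1)] assms(2,3) permutes_inj_on[OF assms(1)] by (auto simp: card_image)

lemma tabloids_Ball: "(\<forall>T\<in>tabloids [a, b]. P T) \<longleftrightarrow> (\<forall>B. B \<subseteq> points \<longrightarrow> card B = b \<longrightarrow> P (tab B))"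
  unfolding tabloids_two_rows[OF ab] by blast

lemma tab_in_tabloids: "B \<subseteq> points \<Longrightarrow> card B = b \<Longrightarrow> tab B \<in> tabloids [a, b]"
  unfolding tabloids_two_rows[OF ab] by blast

lemma move_closed: "\<pi> permutes points \<Longrightarrow> T \<in> tabloids [a, b] \<Longrightarrow> move \<pi> T \<in> tabloids [a, b]"
  unfolding tabloids_two_rows[OF ab] using permutes_subset_card move_tab by auto

text \<open>
  The first cohomology of the permutation module vanishes: a permutation that stabilizes \<open>B\<close> is the
  product of a permutation of \<open>B\<close> and one of the complement, and characters vanish on both.
\<close>

lemma tabloid_cocycle_is_principal:
  fixes z :: "(nat \<Rightarrow> nat) \<Rightarrow> tableau set \<Rightarrow> 'k::field"
  assumes two: "(2::'k) \<noteq> 0"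
    and z: "\<And>g h T. g \<in> carrier (sym_group (a + b)) \<Longrightarrow> h \<in> carrier (sym_group (a + b)) \<Longrightarrow> T \<in> tabloids [a, b] \<Longrightarrow>
      z (g \<otimes>\<^bsub>sym_group (a + b)\<^esub> h) T = z g T + z h (move (inv\<^bsub>sym_group (a + b)\<^esub> g) T)"
  shows "\<exists>v. \<forall>g\<in>carrier (sym_group (a + b)). \<forall>T\<in>tabloids [a, b].
    z g T = v (move (inv\<^bsub>sym_group (a + b)\<^esub> g) T) - v T"
proof -
  interpret group "sym_group (a + b)" by (rule sym_group_is_group)
  obtain B where B: "B \<subseteq> points" "card B = b" using obtain_subset_with_card_n[of b points] by auto
  show ?thesis
  proof (rule transitive_cocycle_is_principal[where ?x0.0 = "tab B"])
    fix \<chi> :: "(nat \<Rightarrow> nat) \<Rightarrow> 'k" and \<pi>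
    assume \<chi>: "\<And>g h. g \<in> carrier (sym_group (a + b)) \<Longrightarrow> h \<in> carrier (sym_group (a + b)) \<Longrightarrow>
        move g (tab B) = tab B \<Longrightarrow> move h (tab B) = tab B \<Longrightarrow> \<chi> (g \<otimes>\<^bsub>sym_group (a + b)\<^esub> h) = \<chi> g + \<chi> h"
      and \<pi>: "\<pi> \<in> carrier (sym_group (a + b))" "move \<pi> (tab B) = tab B"
    have fix_iff: "move g (tab B) = tab B \<longleftrightarrow> g ` B = B" if "g permutes points" for g
      using move_tab[OF that, of B] row_tabloid_inj[OF ab B, of "g ` B"] by auto
    have add: "\<chi> (g \<circ> h) = \<chi> g + \<chi> h"
      if "g permutes points" "h permutes points" "g ` B = B" "h ` B = B" for g h
      using \<chi>[of g h] that fix_iff by (simp add: sym_group_carrier sym_group_mult)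
    have p: "\<pi> permutes points" using \<pi>(1) by (simp add: sym_group_carrier)
    hence "\<pi> ` B = B" using \<pi>(2) fix_iff by blast
    then obtain \<sigma> \<tau> where st: "\<sigma> permutes B" "\<tau> permutes points - B" "\<pi> = \<sigma> \<circ> \<tau>"
      using permutes_split[OF p B(1)] by blast
    have inB: "g permutes points" "g ` B = B" if "g permutes B" for g
      using permutes_subset[OF that B(1)] permutes_image[OF that] by auto
    have outB: "g permutes points" "g ` B = B" if g: "g permutes points - B" for g
    proof -
      show "g permutes points" using permutes_subset[OF g] by blast
      have "g x = x" if "x \<in> B" for x using permutes_not_in[OF g] that by simp
      thus "g ` B = B" by simp
    qed
    have fin: "finite B" using B(1) finite_subset by blast
    have "\<chi> \<sigma> = 0"
      by (rule additive_character_permutes[OF fin two _ st(1)]) (intro add inB)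
    moreover have "\<chi> \<tau> = 0"
      by (rule additive_character_permutes[OF _ two _ st(2)]) (simp, intro add outB)
    ultimately show "\<chi> \<pi> = 0" using add[OF inB(1) outB(1) inB(2) outB(2), OF st(1,2) st(1,2)] st(3) by simp
  next
    fix T assume T: "T \<in> tabloids [a, b]"
    then obtain C where C: "C \<subseteq> points" "card C = b" "T = tab C" unfolding tabloids_two_rows[OF ab] by blast
    obtain \<pi> where "\<pi> permutes points" "\<pi> ` C = B"
      using permutes_transitive_subsets[of points C B] B C by auto
    thus "\<exists>g\<in>carrier (sym_group (a + b)). move g T = tab B"
      using move_tab C(3) by (auto simp: sym_group_carrier)
  next
    show "tab B \<in> tabloids [a, b]" by (rule tab_in_tabloids[OF B])
    show "move g T \<in> tabloids [a, b]" if "g \<in> carrier (sym_group (a + b))" "T \<in> tabloids [a, b]" for g T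
      using that(1) unfolding sym_group_carrier by (rule move_closed[OF _ that(2)])
    show "move \<one>\<^bsub>sym_group (a + b)\<^esub> T = T" for T by (simp add: sym_group_one)
    show "move (g \<otimes>\<^bsub>sym_group (a + b)\<^esub> h) T = move g (move h T)" for g h T
      unfolding sym_group_mult image_image comp_assoc ..
  qed (rule z)
qed

lemma specht_subrep:
  assumes two: "(2::'k::field) \<noteq> 0"
  shows "perm_subrep_H1 (sym_group (a + b)) (tabloids [a, b]) move
    (carrier (specht_module [a, b] :: ('k, tableau set \<Rightarrow> 'k, nat \<Rightarrow> nat) kG_module))"
proof -
  let ?G = "sym_group (a + b)" and ?X = "tabloids [a, b]"
  let ?S = "carrier (specht_module [a, b] :: ('k, tableau set \<Rightarrow> 'k, nat \<Rightarrow> nat) kG_module)"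
  note S = specht_module_two_rows[OF ab two]
  interpret group ?G by (rule sym_group_is_group)
  have cong: "design points b (\<lambda>_. 0) f \<Longrightarrow> (\<And>B. B \<subseteq> points \<Longrightarrow> card B = b \<Longrightarrow> g B = f B) \<Longrightarrow> design points b (\<lambda>_. 0) g"
    for f g :: "nat set \<Rightarrow> 'k"
    using design_cong[of points b "\<lambda>_. 0" "\<lambda>_. 0" f g] by simp
  have inv: "inv\<^bsub>?G\<^esub> g permutes points" if "g \<in> carrier ?G" for g
    using inv_closed[OF that] by (simp add: sym_group_carrier)
  show ?thesis
  proof (intro perm_subrep_H1.intro perm_subrep.intro perm_subrep_axioms.intro perm_subrep_H1_axioms.intro)
    show "group ?G" by (rule sym_group_is_group)
    show "finite (carrier ?G)" by (simp add: sym_group_def finite_permutations)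
    show "move g T \<in> ?X" if "g \<in> carrier ?G" "T \<in> ?X" for g T
      using that(1) unfolding sym_group_carrier by (rule move_closed[OF _ that(2)])
    show "move \<one>\<^bsub>?G\<^esub> T = T" for T by (simp add: sym_group_one)
    show "move (g \<otimes>\<^bsub>?G\<^esub> h) T = move g (move h T)" for g h T
      unfolding sym_group_mult image_image comp_assoc ..
    show "v \<in> extensional ?X" if "v \<in> ?S" for v using that unfolding S by blast
    have "design points b (\<lambda>_. 0) (\<lambda>_. 0 :: 'k)" by (simp add: design_def subset_sum_def)
    hence "design points b (\<lambda>_. 0) (\<lambda>B. (\<lambda>x\<in>?X. 0 :: 'k) (tab B))"
      by (rule cong) (simp add: tab_in_tabloids)
    thus "(\<lambda>x\<in>?X. 0) \<in> ?S" unfolding S by simp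
    show "(\<lambda>x\<in>?X. v x + w x) \<in> ?S" if vw: "v \<in> ?S" "w \<in> ?S" for v w
    proof -
      have "design points b (\<lambda>_. 0) (\<lambda>B. v (tab B) + w (tab B))"
        using vw unfolding S by (simp add: design_def subset_sum_add)
      hence "design points b (\<lambda>_. 0) (\<lambda>B. (\<lambda>x\<in>?X. v x + w x) (tab B))"
        by (rule cong) (simp add: tab_in_tabloids)
      thus ?thesis unfolding S by simp
    qed
    show "(\<lambda>x\<in>?X. c * v x) \<in> ?S" if v: "v \<in> ?S" for c v
    proof -
      have "design points b (\<lambda>_. 0) (\<lambda>B. c * v (tab B))"
        using v unfolding S by (simp add: design_def subset_sum_mult)
      hence "design points b (\<lambda>_. 0) (\<lambda>B. (\<lambda>x\<in>?X. c * v x) (tab B))"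
        by (rule cong) (simp add: tab_in_tabloids)
      thus ?thesis unfolding S by simp
    qed
    show "(\<lambda>x\<in>?X. v (move (inv\<^bsub>?G\<^esub> g) x)) \<in> ?S" if g: "g \<in> carrier ?G" and v: "v \<in> ?S" for g v
    proof -
      let ?\<pi> = "inv\<^bsub>?G\<^esub> g"
      have p: "?\<pi> permutes points" by (rule inv[OF g])
      have "design points b (\<lambda>_. 0) (\<lambda>B. v (tab (?\<pi> ` B)))"
        unfolding design_def
      proof (intro allI impI)
        fix I assume I: "I \<subseteq> points" "card I < b"
        have card: "card (?\<pi> ` I) = card I" using permutes_inj_on[OF p] by (simp add: card_image)
        have sub: "?\<pi> ` I \<subseteq> points" using permutes_image[OF p] I(1) by blast
        have D: "design points b (\<lambda>_. 0) (\<lambda>B. v (tab B))" using v unfolding S by simp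
        have "subset_sum (points - ?\<pi> ` I) (b - card (?\<pi> ` I)) (\<lambda>T. v (tab (?\<pi> ` I \<union> T))) = 0"
          using D[unfolded design_def, rule_format, OF sub] card I(2) by simp
        thus "subset_sum (points - I) (b - card I) (\<lambda>T. v (tab (?\<pi> ` (I \<union> T)))) = 0"
          unfolding subset_sum_permute[OF p I(1), of _ "\<lambda>B. v (tab B)"] card .
      qed
      hence "design points b (\<lambda>_. 0) (\<lambda>B. (\<lambda>x\<in>?X. v (move ?\<pi> x)) (tab B))"
        by (rule cong) (simp add: tab_in_tabloids move_tab[OF p])
      thus ?thesis unfolding S by simp
    qed
    show "\<exists>v. \<forall>g\<in>carrier ?G. \<forall>x\<in>?X. z g x = v (move (inv\<^bsub>?G\<^esub> g) x) - v x"
      if "\<And>g h x. g \<in> carrier ?G \<Longrightarrow> h \<in> carrier ?G \<Longrightarrow> x \<in> ?X \<Longrightarrow>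
        z (g \<otimes>\<^bsub>?G\<^esub> h) x = z g x + z h (move (inv\<^bsub>?G\<^esub> g) x)" for z :: "(nat \<Rightarrow> nat) \<Rightarrow> tableau set \<Rightarrow> 'k"
      by (rule tabloid_cocycle_is_principal[OF two that])
  qed
qed

lemma specht_almost_invariant_iff:
  fixes v :: "tableau set \<Rightarrow> 'k::field"
  assumes two: "(2::'k) \<noteq> 0"
  shows "perm_subrep.almost_invariant (sym_group (a + b)) (tabloids [a, b]) move
      (carrier (specht_module [a, b] :: ('k, tableau set \<Rightarrow> 'k, nat \<Rightarrow> nat) kG_module)) v \<longleftrightarrow>
    (\<exists>c. design points b (\<lambda>I. c (card I)) (\<lambda>B. v (tab B)))"
proof -
  let ?G = "sym_group (a + b)" and ?X = "tabloids [a, b]"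
  interpret H: perm_subrep_H1 ?G ?X move "carrier (specht_module [a, b] :: ('k, tableau set \<Rightarrow> 'k, nat \<Rightarrow> nat) kG_module)"
    by (rule specht_subrep[OF two])
  note S = specht_module_two_rows[OF ab two]
  have "H.almost_invariant v \<longleftrightarrow>
      (\<forall>g\<in>carrier ?G. design points b (\<lambda>_. 0) (\<lambda>B. v (tab ((inv\<^bsub>?G\<^esub> g) ` B)) - v (tab B)))"
    unfolding H.almost_invariant_def
  proof (rule ball_cong[OF refl])
    fix g assume "g \<in> carrier ?G"
    hence p: "inv\<^bsub>?G\<^esub> g permutes points" using H.inv_closed by (simp add: sym_group_carrier)
    have "design points b (\<lambda>_. 0) (\<lambda>B. (\<lambda>x\<in>?X. v (move (inv\<^bsub>?G\<^esub> g) x) - v x) (tab B)) \<longleftrightarrow>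
        design points b (\<lambda>_. 0) (\<lambda>B. v (tab ((inv\<^bsub>?G\<^esub> g) ` B)) - v (tab B))"
      by (rule design_cong) (simp_all add: tab_in_tabloids move_tab[OF p])
    thus "(\<lambda>x\<in>?X. v (move (inv\<^bsub>?G\<^esub> g) x) - v x) \<in> carrier (specht_module [a, b] :: ('k, tableau set \<Rightarrow> 'k, nat \<Rightarrow> nat) kG_module) \<longleftrightarrow>
        design points b (\<lambda>_. 0) (\<lambda>B. v (tab ((inv\<^bsub>?G\<^esub> g) ` B)) - v (tab B))"
      unfolding S by simp
  qed
  also have "\<dots> \<longleftrightarrow> (\<forall>\<pi>. \<pi> permutes points \<longrightarrow> design points b (\<lambda>_. 0) (\<lambda>B. v (tab (\<pi> ` B)) - v (tab B)))"
  proof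
    assume *: "\<forall>g\<in>carrier ?G. design points b (\<lambda>_. 0) (\<lambda>B. v (tab ((inv\<^bsub>?G\<^esub> g) ` B)) - v (tab B))"
    show "\<forall>\<pi>. \<pi> permutes points \<longrightarrow> design points b (\<lambda>_. 0) (\<lambda>B. v (tab (\<pi> ` B)) - v (tab B))"
    proof (intro allI impI)
      fix \<pi> assume "\<pi> permutes points"
      hence "\<pi> \<in> carrier ?G" by (simp add: sym_group_carrier)
      thus "design points b (\<lambda>_. 0) (\<lambda>B. v (tab (\<pi> ` B)) - v (tab B))"
        using *[rule_format, of "inv\<^bsub>?G\<^esub> \<pi>"] H.inv_inv H.inv_closed by simp
    qed
  next
    assume *: "\<forall>\<pi>. \<pi> permutes points \<longrightarrow> design points b (\<lambda>_. 0) (\<lambda>B. v (tab (\<pi> ` B)) - v (tab B))"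
    show "\<forall>g\<in>carrier ?G. design points b (\<lambda>_. 0) (\<lambda>B. v (tab ((inv\<^bsub>?G\<^esub> g) ` B)) - v (tab B))"
    proof
      fix g assume "g \<in> carrier ?G"
      hence "inv\<^bsub>?G\<^esub> g permutes points" using H.inv_closed unfolding sym_group_carrier by blast
      thus "design points b (\<lambda>_. 0) (\<lambda>B. v (tab ((inv\<^bsub>?G\<^esub> g) ` B)) - v (tab B))" using * by blast
    qed
  qed
  also have "\<dots> \<longleftrightarrow> (\<exists>c. design points b (\<lambda>I. c (card I)) (\<lambda>B. v (tab B)))"
    by (rule design_almost_invariant_iff) auto
  finally show ?thesis .
qed

lemma tabloid_invariant_iff:
  fixes v :: "tableau set \<Rightarrow> 'k::field"
  assumes two: "(2::'k) \<noteq> 0"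
  shows "perm_subrep.invariant (sym_group (a + b)) (tabloids [a, b]) move v \<longleftrightarrow>
    (\<exists>e. \<forall>B. B \<subseteq> points \<longrightarrow> card B = b \<longrightarrow> v (tab B) = e)"
proof -
  let ?G = "sym_group (a + b)" and ?X = "tabloids [a, b]"
  interpret H: perm_subrep_H1 ?G ?X move "carrier (specht_module [a, b] :: ('k, tableau set \<Rightarrow> 'k, nat \<Rightarrow> nat) kG_module)"
    by (rule specht_subrep[OF two])
  have "H.invariant v \<longleftrightarrow> (\<forall>\<pi>. \<pi> permutes points \<longrightarrow> (\<forall>B. B \<subseteq> points \<longrightarrow> card B = b \<longrightarrow> v (tab (\<pi> ` B)) = v (tab B)))"
    unfolding H.invariant_def tabloids_Ball using move_tab by (simp add: sym_group_def)
  also have "\<dots> \<longleftrightarrow> (\<exists>e. \<forall>B. B \<subseteq> points \<longrightarrow> card B = b \<longrightarrow> v (tab B) = e)"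
  proof
    assume *: "\<forall>\<pi>. \<pi> permutes points \<longrightarrow> (\<forall>B. B \<subseteq> points \<longrightarrow> card B = b \<longrightarrow> v (tab (\<pi> ` B)) = v (tab B))"
    obtain B where B: "B \<subseteq> points" "card B = b" using obtain_subset_with_card_n[of b points] by auto
    show "\<exists>e. \<forall>B. B \<subseteq> points \<longrightarrow> card B = b \<longrightarrow> v (tab B) = e"
    proof (intro exI[of _ "v (tab B)"] allI impI)
      fix C assume C: "C \<subseteq> points" "card C = b"
      obtain \<pi> where "\<pi> permutes points" "\<pi> ` B = C"
        using permutes_transitive_subsets[of points B C] B C by auto
      thus "v (tab C) = v (tab B)" using * B by blast
    qed
  next
    assume "\<exists>e. \<forall>B. B \<subseteq> points \<longrightarrow> card B = b \<longrightarrow> v (tab B) = e"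
    then obtain e where e: "\<And>B. B \<subseteq> points \<Longrightarrow> card B = b \<Longrightarrow> v (tab B) = e" by blast
    show "\<forall>\<pi>. \<pi> permutes points \<longrightarrow> (\<forall>B. B \<subseteq> points \<longrightarrow> card B = b \<longrightarrow> v (tab (\<pi> ` B)) = v (tab B))"
      using e permutes_subset_card by simp
  qed
  finally show ?thesis .
qed

end

theorem corollary8:
  fixes p a b n :: nat
  assumes "prime p" and "p \<ge> 3"
    and "CHAR('k::field) = p"
    and "a \<ge> b" and "b > 0" and "a + b = n"
  shows "has_dim
    (group_cohomology (sym_group n)
      (specht_module [a, b] :: ('k, tableau set \<Rightarrow> 'k, nat \<Rightarrow> nat) kG_module) 1)
    (if James_partition p a b \<or> pointed_partition p a b then 1 else 0)"
proof -
  note ab = \<open>a \<ge> b\<close>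
  have two: "(2::'k) \<noteq> 0"
  proof
    assume "(2::'k) = 0"
    hence "of_nat 2 = (0::'k)" by simp
    hence "p dvd 2" unfolding of_nat_eq_0_iff_char_dvd assms(3) .
    thus False using assms(2) by (auto dest: dvd_imp_le)
  qed
  let ?G = "sym_group (a + b)" and ?X = "tabloids [a, b]" and ?V = "{1..a + b}" and ?t = "row_tabloid a b"
  let ?move = "(\<lambda>\<pi> T. (\<lambda>t. \<pi> \<circ> t) ` T) :: (nat \<Rightarrow> nat) \<Rightarrow> tableau set \<Rightarrow> tableau set"
  let ?S = "carrier (specht_module [a, b] :: ('k, tableau set \<Rightarrow> 'k, nat \<Rightarrow> nat) kG_module)"
  interpret H: perm_subrep_H1 ?G ?X ?move ?S by (rule specht_subrep[OF ab two])
  have N: "H.N = specht_module [a, b]" by (simp add: specht_module_def tabloid_module_def)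
  note S = specht_module_two_rows[OF ab two]
  note almost = specht_almost_invariant_iff[OF ab two]
  note invariant = tabloid_invariant_iff[OF ab two]
  define d0 where "d0 j = (of_nat ((a + j) choose j) :: 'k)" for j
  have tabX: "?t B \<in> ?X" if "B \<subseteq> ?V" "card B = b" for B by (rule tab_in_tabloids[OF ab that])
  have const: "design ?V b (\<lambda>I. d0 (b - card I) * e) (\<lambda>_. e)" for e
  proof -
    have "(a + b - i) choose (b - i) = (a + (b - i)) choose (b - i)" if "i < b" for i using that by simp
    hence "design ?V b (\<lambda>I. d0 (b - card I) * e) (\<lambda>_. e) \<longleftrightarrow>
      design ?V b (\<lambda>I. of_nat ((card ?V - card I) choose (b - card I)) * e) (\<lambda>_. e)"
      by (intro design_cong) (simp_all add: d0_def)
    thus ?thesis using design_const[of ?V b e] by simp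
  qed
  have split: "\<exists>w\<in>?S. H.invariant (\<lambda>x. v x - w x)"
    if v: "design ?V b (\<lambda>I. d0 (b - card I) * e) (\<lambda>B. v (?t B))" for v e
  proof (rule bexI)
    let ?w = "\<lambda>x\<in>?X. v x - e"
    have "design ?V b (\<lambda>I. d0 (b - card I) * e + (-1) * (d0 (b - card I) * e)) (\<lambda>B. v (?t B) + (-1) * e)"
      by (rule design_add[OF v const])
    hence "design ?V b (\<lambda>_. 0) (\<lambda>B. v (?t B) - e)" by simp
    also have "?this \<longleftrightarrow> design ?V b (\<lambda>_. 0) (\<lambda>B. ?w (?t B))" by (rule design_cong) (simp_all add: tabX)
    finally show "?w \<in> ?S" unfolding S by simp
    show "H.invariant (\<lambda>x. v x - ?w x)" unfolding invariant by (intro exI[of _ e]) (simp add: tabX)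
  qed
  have weights: "\<exists>d. weight_solution a b d \<and> design ?V b (\<lambda>I. d (b - card I)) (\<lambda>B. v (?t B))"
    if ai: "H.almost_invariant v" for v
  proof -
    obtain c where c: "design ?V b (\<lambda>I. c (card I)) (\<lambda>B. v (?t B))" using ai unfolding almost by blast
    hence "weight_solution a b (\<lambda>j. c (b - j))"
      using constant_design_iff[of ?V a b c] ab by auto
    moreover have "design ?V b (\<lambda>I. c (b - (b - card I))) (\<lambda>B. v (?t B)) \<longleftrightarrow> design ?V b (\<lambda>I. c (card I)) (\<lambda>B. v (?t B))"
      by (rule design_cong) auto
    ultimately show ?thesis using c by blast
  qed
  have agree: "design ?V b (\<lambda>I. y (b - card I)) f"
    if "design ?V b (\<lambda>I. x (b - card I)) f" "\<And>j. j \<in> {1..b} \<Longrightarrow> x j = y j" for x y :: "nat \<Rightarrow> 'k" and f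
  proof -
    have "design ?V b (\<lambda>I. x (b - card I)) f \<longleftrightarrow> design ?V b (\<lambda>I. y (b - card I)) f"
      by (rule design_cong) (simp_all add: that(2))
    thus ?thesis using that(1) by blast
  qed
  note solutions = weight_solutions[OF assms(1,3,5), of a, folded d0_def]
  show ?thesis
  proof (cases "James_partition p a b \<or> pointed_partition p a b")
    case False
    have "has_dim (group_cohomology ?G H.N 1) 0"
    proof (rule H.has_dim_H1_0)
      fix v assume "H.almost_invariant v"
      then obtain d where d: "weight_solution a b d" "design ?V b (\<lambda>I. d (b - card I)) (\<lambda>B. v (?t B))"
        using weights by blast
      have "\<exists>e. \<forall>j\<in>{1..b}. d j = e * d0 j" using solutions False d(1) by simp
      then obtain e where e: "\<And>j. j \<in> {1..b} \<Longrightarrow> d j = e * d0 j" by blast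
      have "design ?V b (\<lambda>I. d0 (b - card I) * e) (\<lambda>B. v (?t B))"
        by (rule agree[OF d(2), of "\<lambda>j. d0 j * e"]) (simp add: e mult.commute)
      thus "\<exists>w\<in>?S. H.invariant (\<lambda>x. v x - w x)" by (rule split)
    qed
    thus ?thesis unfolding N assms(6)[symmetric] if_not_P[OF False] .
  next
    case True
    then obtain d where d: "weight_solution a b d" "\<And>c. \<exists>j\<in>{1..b}. d j \<noteq> c * d0 j"
      "\<And>e. weight_solution a b e \<Longrightarrow> \<exists>c c'. \<forall>j\<in>{1..b}. e j = c * d j + c' * d0 j"
      using solutions unfolding if_P[OF True] by blast
    \<comment> \<open>the nontrivial solution is realized by a vector \<open>e\<close>, whose class spans the cohomology\<close>
    have "weight_solution a b (\<lambda>j. d (b - (b - j)))"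
      using d(1) unfolding weight_solution_def by auto
    hence "\<exists>f. design ?V b (\<lambda>I. d (b - card I)) f"
      using constant_design_iff[of ?V a b "\<lambda>i. d (b - i)"] ab by simp
    then obtain f where f: "design ?V b (\<lambda>I. d (b - card I)) f" by blast
    define e where "e T = f (row_set b T)" for T
    have et: "e (?t B) = f B" if "B \<subseteq> ?V" "card B = b" for B
      using row_set_row_tabloid[OF ab that] by (simp add: e_def)
    have "design ?V b (\<lambda>I. d (b - card I)) (\<lambda>B. e (?t B)) \<longleftrightarrow> design ?V b (\<lambda>I. d (b - card I)) f"
      by (rule design_cong) (simp_all add: et)
    hence e: "design ?V b (\<lambda>I. d (b - card I)) (\<lambda>B. e (?t B))" using f by simp
    have "has_dim (group_cohomology ?G H.N 1) 1"
    proof (rule H.has_dim_H1_1)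
      show "H.almost_invariant e" unfolding almost using e by (rule exI[of _ "\<lambda>i. d (b - i)"])
      show "\<not> (\<exists>w\<in>?S. H.invariant (\<lambda>x. e x - w x))"
      proof
        assume "\<exists>w\<in>?S. H.invariant (\<lambda>x. e x - w x)"
        then obtain w r where w: "w \<in> ?S" "\<And>B. B \<subseteq> ?V \<Longrightarrow> card B = b \<Longrightarrow> e (?t B) - w (?t B) = r"
          unfolding invariant by blast
        have "design ?V b (\<lambda>_. 0) (\<lambda>B. w (?t B))" using w(1) unfolding S by simp
        hence "design ?V b (\<lambda>I. 0 + 1 * (d0 (b - card I) * r)) (\<lambda>B. w (?t B) + 1 * r)"
          by (rule design_add[OF _ const])
        also have "?this \<longleftrightarrow> design ?V b (\<lambda>I. d0 (b - card I) * r) (\<lambda>B. e (?t B))"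
        proof (rule design_cong)
          fix B assume "B \<subseteq> ?V" "card B = b"
          thus "w (?t B) + 1 * r = e (?t B)" using w(2)[of B] by (simp add: diff_eq_eq add.commute)
        qed auto
        finally have r: "design ?V b (\<lambda>I. d0 (b - card I) * r) (\<lambda>B. e (?t B))" .
        obtain j where j: "j \<in> {1..b}" "d j \<noteq> r * d0 j" using d(2) by blast
        have "b - j \<le> card ?V" by simp
        then obtain I where I: "I \<subseteq> ?V" "card I = b - j"
          using obtain_subset_with_card_n by metis
        have "d (b - card I) = d0 (b - card I) * r"
          using e[unfolded design_def, rule_format, of I] r[unfolded design_def, rule_format, of I] I j(1) by auto
        thus False using I(2) j by (simp add: mult.commute)
      qed
      fix v assume "H.almost_invariant v"
      then obtain dv where dv: "weight_solution a b dv" "design ?V b (\<lambda>I. dv (b - card I)) (\<lambda>B. v (?t B))"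
        using weights by blast
      then obtain c c' where c: "\<And>j. j \<in> {1..b} \<Longrightarrow> dv j = c * d j + c' * d0 j" using d(3) by blast
      have "design ?V b (\<lambda>I. dv (b - card I) + (- c) * d (b - card I)) (\<lambda>B. v (?t B) + (- c) * e (?t B))"
        by (rule design_add[OF dv(2) e])
      hence "design ?V b (\<lambda>I. d0 (b - card I) * c') (\<lambda>B. v (?t B) + (- c) * e (?t B))"
        by (rule agree[of "\<lambda>j. dv j + (- c) * d j" _ "\<lambda>j. d0 j * c'"]) (simp add: c mult.commute)
      hence "design ?V b (\<lambda>I. d0 (b - card I) * c') (\<lambda>B. v (?t B) - c * e (?t B))" by simp
      from split[OF this] show "\<exists>c. \<exists>w\<in>?S. H.invariant (\<lambda>x. v x - c * e x - w x)" by blast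
    qed
    thus ?thesis unfolding N assms(6)[symmetric] if_P[OF True] .
  qed
qed

end
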